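(* Let $\kappa,\tau\in\mathbb{R}$ with $\kappa\neq 4\tau^2$, and let $\mathcal{M}$ be an oriented, simply connected, non minimal biconservative surface immersed in the Bianchi-Cartan-Vranceanu space $\mathcal{N}_{\kappa,\tau}$. Then the following statements are equivalent: (a) $\mathcal{M}$ is a constant angle surface; (b) $\mathcal{M}$ is a CMC surface (i.e. its mean curvature function $f$ is constant); (c) $\mathcal{M}$ is a Hopf tube over a curve with constant geodesic curvature.
   Context: BCV-spaces. For $\kappa,\tau\in\mathbb{R}$ put $F(x,y)=1+\frac{\kappa}{4}(x^2+y^2)$ and $\mathcal{N}=\{(x,y,z)\in\mathbb{R}^3: F(x,y)>0\}$. The Bianchi-Cartan-Vranceanu space (BCV-space) is $\mathcal{N}_{\kappa,\tau}=(\mathcal{N},g_{\kappa,\tau})$ with $$g_{\kappa,\tau}=\frac{dx^2+dy^2}{F^2}+\Big(dz+\tau\,\frac{y\,dx-x\,dy}{F}\Big)^2 .$$ The Hopf fibration is the Riemannian submersion $\psi(x,y,z)=(x,y)$ from $\mathcal{N}_{\kappa,\tau}$ onto $M^2(\kappa)$, the planar domain $\{F>0\}$ with the metric $h=(dx^2+dy^2)/F^2$ of constant Gaussian curvature $\kappa$. The unit Killing field $E_3=\partial/\partial z$, tangent to the fibers of $\psi$, is the Hopf vector field. Surfaces. For an oriented surface $\mathcal{M}$ immersed in $\mathcal{N}_{\kappa,\tau}$ with unit normal field $N$, the shape operator is $AX=-\overline{\nabla}_XN$ ($\overline\nabla$ the Levi-Civita connection of $\mathcal{N}_{\kappa,\tau}$),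 the mean curvature function is $f=\operatorname{trace}A$ (so the mean curvature vector is $(f/2)N$), and $\mathcal{M}$ is minimal if $f\equiv 0$. Let $\operatorname{Ricci}(N)^{\top}$ denote the tangent component of the Ricci curvature of $\mathcal{N}_{\kappa,\tau}$ in the direction $N$, i.e. $\operatorname{Ricci}(N)^\top=\sum_i\operatorname{Ricci}(N,e_i)e_i$ for a local orthonormal frame $\{e_1,e_2\}$ of $\mathcal{M}$. The surface is biconservative if $$2A(\operatorname{grad} f)+f\operatorname{grad} f-2f\operatorname{Ricci}(N)^\top=0 .$$ It is a constant angle surface (helix surface) if the angle $\alpha\in[0,\pi]$ between $N$ and $E_3$, $\cos\alpha=g_{\kappa,\tau}(E_3,N)$, is constant on $\mathcal{M}$. A Hopf tube over a curve $c$ in $M^2(\kappa)$ is the surface $\psi^{-1}(c)$, which is everywhere tangent to $E_3$; being a Hopf tube is understood locally, i.e. up to taking open parts. Geodesic curvature of $c$ is computed in $M^2(\kappa)$. *)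

theory Defs
  imports "HOL-Analysis.Analysis"
begin

section \<open>Smooth maps\<close>

text \<open>Used on open sets only; \<open>frechet_derivative\<close> takes the total derivative at an interior point.\<close>

primrec Ck_on :: "nat \<Rightarrow> 'a::real_normed_vector set \<Rightarrow> ('a \<Rightarrow> 'b::real_normed_vector) \<Rightarrow> bool" where
  "Ck_on 0 S f \<longleftrightarrow> continuous_on S f"
| "Ck_on (Suc k) S f \<longleftrightarrow>
     (\<forall>x\<in>S. f differentiable (at x)) \<and>
     (\<forall>v. Ck_on k S (\<lambda>x. frechet_derivative f (at x) v))"

definition smooth_on :: "'a::real_normed_vector set \<Rightarrow> ('a \<Rightarrow> 'b::real_normed_vector) \<Rightarrow> bool" where
  "smooth_on S f \<longleftrightarrow> (\<forall>k. Ck_on k S f)"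

definition partial :: "'n::finite \<Rightarrow> (real^'n \<Rightarrow> 'b::real_normed_vector) \<Rightarrow> real^'n \<Rightarrow> 'b" where
  "partial i f p = frechet_derivative f (at p) (axis i 1)"


section \<open>Riemannian metrics on open subsets of coordinate space\<close>

text \<open>A metric is given by the inner products \<open>g p v w\<close> of tangent vectors \<open>v\<close>, \<open>w\<close> at \<open>p\<close>;
  tangent vectors are identified with their components in the coordinate frame.\<close>

type_synonym 'n metric = "real^'n \<Rightarrow> real^'n \<Rightarrow> real^'n \<Rightarrow> real"

definition metric_coeff :: "('n::finite) metric \<Rightarrow> 'n \<Rightarrow> 'n \<Rightarrow> real^'n \<Rightarrow> real" where
  "metric_coeff g i j p = g p (axis i 1) (axis j 1)"

text \<open>\<open>christoffel g k i j p\<close> is \<open>\<Gamma>\<^sup>k\<^sub>i\<^sub>j(p)\<close> of the Levi-Civita connection.\<close>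

definition christoffel :: "('n::finite) metric \<Rightarrow> 'n \<Rightarrow> 'n \<Rightarrow> 'n \<Rightarrow> real^'n \<Rightarrow> real" where
  "christoffel g k i j p =
     (\<Sum>l\<in>UNIV. matrix_inv (\<chi> a b. metric_coeff g a b p) $ k $ l *
        (partial i (metric_coeff g j l) p + partial j (metric_coeff g i l) p
          - partial l (metric_coeff g i j) p)) / 2"

definition christoffel_form :: "('n::finite) metric \<Rightarrow> real^'n \<Rightarrow> real^'n \<Rightarrow> real^'n \<Rightarrow> real^'n" where
  "christoffel_form g p v w =
     (\<chi> k. \<Sum>i\<in>UNIV. \<Sum>j\<in>UNIV. christoffel g k i j p * v $ i * w $ j)"

definition nabla ::
  "('n::finite) metric \<Rightarrow> (real^'n \<Rightarrow> real^'n) \<Rightarrow> (real^'n \<Rightarrow> real^'n) \<Rightarrow> real^'n \<Rightarrow> real^'n" where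
  "nabla g X Y p = frechet_derivative Y (at p) (X p) + christoffel_form g p (X p) (Y p)"

text \<open>Covariant derivative, in the parameter direction \<open>v\<close>, of a vector field \<open>V\<close> along a map \<open>r\<close>.\<close>

definition nabla_along ::
  "('n::finite) metric \<Rightarrow> ('b::real_normed_vector \<Rightarrow> real^'n) \<Rightarrow> ('b \<Rightarrow> real^'n) \<Rightarrow> 'b \<Rightarrow> 'b \<Rightarrow> real^'n" where
  "nabla_along g r V u v =
     frechet_derivative V (at u) v
       + christoffel_form g (r u) (frechet_derivative r (at u) v) (V u)"

text \<open>\<open>curvature g p a b w = R(a,b)w = \<nabla>\<^sub>a\<nabla>\<^sub>b w - \<nabla>\<^sub>b\<nabla>\<^sub>a w - \<nabla>\<^bsub>[a,b]\<^esub> w\<close>; the vectors are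
  extended to fields with constant components, so that the bracket term vanishes.\<close>

definition curvature ::
  "('n::finite) metric \<Rightarrow> real^'n \<Rightarrow> real^'n \<Rightarrow> real^'n \<Rightarrow> real^'n \<Rightarrow> real^'n" where
  "curvature g p a b w =
     nabla g (\<lambda>_. a) (nabla g (\<lambda>_. b) (\<lambda>_. w)) p - nabla g (\<lambda>_. b) (nabla g (\<lambda>_. a) (\<lambda>_. w)) p"

definition ricci :: "('n::finite) metric \<Rightarrow> real^'n \<Rightarrow> real^'n \<Rightarrow> real^'n \<Rightarrow> real" where
  "ricci g p v w = trace (matrix (\<lambda>z. curvature g p z v w))"


section \<open>BCV-spaces and the Hopf fibration\<close>

definition bcv_F :: "real \<Rightarrow> real \<Rightarrow> real \<Rightarrow> real" where
  "bcv_F \<kappa> x y = 1 + \<kappa> / 4 * (x\<^sup>2 + y\<^sup>2)"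

definition bcv_domain :: "real \<Rightarrow> (real^3) set" where
  "bcv_domain \<kappa> = {p. bcv_F \<kappa> (p$1) (p$2) > 0}"

definition bcv_metric :: "real \<Rightarrow> real \<Rightarrow> 3 metric" where
  "bcv_metric \<kappa> \<tau> p v w =
     (let F = bcv_F \<kappa> (p$1) (p$2);
          \<theta> = (\<lambda>v. v$3 + \<tau> * (p$2 * v$1 - p$1 * v$2) / F)
      in (v$1 * w$1 + v$2 * w$2) / F\<^sup>2 + \<theta> v * \<theta> w)"

definition hopf_field :: "real^3" where
  "hopf_field = axis 3 1"

definition hopf_fibration :: "real^3 \<Rightarrow> real^2" where
  "hopf_fibration p = vector [p$1, p$2]"

definition base_domain :: "real \<Rightarrow> (real^2) set" where
  "base_domain \<kappa> = {p. bcv_F \<kappa> (p$1) (p$2) > 0}"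

definition base_metric :: "real \<Rightarrow> 2 metric" where
  "base_metric \<kappa> p v w = (v$1 * w$1 + v$2 * w$2) / (bcv_F \<kappa> (p$1) (p$2))\<^sup>2"


section \<open>Geodesic curvature of plane curves\<close>

definition regular_curve_in :: "(real^2) set \<Rightarrow> real set \<Rightarrow> (real \<Rightarrow> real^2) \<Rightarrow> bool" where
  "regular_curve_in D I c \<longleftrightarrow>
     open I \<and> is_interval I \<and> smooth_on I c \<and> c ` I \<subseteq> D \<and>
     (\<forall>t\<in>I. vector_derivative c (at t) \<noteq> 0)"

definition curve_speed :: "2 metric \<Rightarrow> (real \<Rightarrow> real^2) \<Rightarrow> real \<Rightarrow> real" where
  "curve_speed h c t =
     sqrt (h (c t) (vector_derivative c (at t)) (vector_derivative c (at t)))"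

definition unit_tangent :: "2 metric \<Rightarrow> (real \<Rightarrow> real^2) \<Rightarrow> real \<Rightarrow> real^2" where
  "unit_tangent h c t = vector_derivative c (at t) /\<^sub>R curve_speed h c t"

definition quarter_turn :: "real^2 \<Rightarrow> real^2" where
  "quarter_turn v = vector [- v$2, v$1]"

text \<open>Signed geodesic curvature. The Euclidean quarter turn is the rotation by \<open>\<pi>/2\<close> for every metric
  conformal to the Euclidean one, in particular for \<open>base_metric \<kappa>\<close>.\<close>

definition geodesic_curvature :: "2 metric \<Rightarrow> (real \<Rightarrow> real^2) \<Rightarrow> real \<Rightarrow> real" where
  "geodesic_curvature h c t =
     h (c t) (nabla_along h c (unit_tangent h c) t 1) (quarter_turn (unit_tangent h c t))
       / curve_speed h c t"


section \<open>Parametrized surface patches\<close>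

text \<open>Here \<open>r\<close> is a regular parametrization with unit normal \<open>n\<close>, and a tangent vector of the surface is
  represented by its components \<open>v\<close> in the coordinate frame, i.e. \<open>v\<close> stands for \<open>dr(v)\<close>.\<close>

definition first_form :: "3 metric \<Rightarrow> (real^2 \<Rightarrow> real^3) \<Rightarrow> real^2 \<Rightarrow> real^2^2" where
  "first_form g r u = (\<chi> i j. g (r u) (partial i r u) (partial j r u))"

text \<open>The tangent vector that represents a linear form under the induced metric.\<close>

definition sharp :: "3 metric \<Rightarrow> (real^2 \<Rightarrow> real^3) \<Rightarrow> real^2 \<Rightarrow> (real^2 \<Rightarrow> real) \<Rightarrow> real^2" where
  "sharp g r u \<omega> = matrix_inv (first_form g r u) *v (\<chi> i. \<omega> (axis i 1))"

definition surface_grad ::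
  "3 metric \<Rightarrow> (real^2 \<Rightarrow> real^3) \<Rightarrow> (real^2 \<Rightarrow> real) \<Rightarrow> real^2 \<Rightarrow> real^2" where
  "surface_grad g r f u = sharp g r u (frechet_derivative f (at u))"

definition tangent_part :: "3 metric \<Rightarrow> (real^2 \<Rightarrow> real^3) \<Rightarrow> real^2 \<Rightarrow> real^3 \<Rightarrow> real^2" where
  "tangent_part g r u X = sharp g r u (\<lambda>w. g (r u) X (frechet_derivative r (at u) w))"

text \<open>\<open>A X = - \<nabla>\<^sub>X N\<close>. This vector is tangent to the surface because \<open>N\<close> has constant length, so
  \<open>tangent_part\<close> only passes to its components.\<close>

definition shape_operator ::
  "3 metric \<Rightarrow> (real^2 \<Rightarrow> real^3) \<Rightarrow> (real^2 \<Rightarrow> real^3) \<Rightarrow> real^2 \<Rightarrow> real^2 \<Rightarrow> real^2" where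
  "shape_operator g r n u v = tangent_part g r u (- nabla_along g r n u v)"

definition mean_curvature ::
  "3 metric \<Rightarrow> (real^2 \<Rightarrow> real^3) \<Rightarrow> (real^2 \<Rightarrow> real^3) \<Rightarrow> real^2 \<Rightarrow> real" where
  "mean_curvature g r n u = trace (matrix (shape_operator g r n u))"

definition ricci_normal_tangent ::
  "3 metric \<Rightarrow> (real^2 \<Rightarrow> real^3) \<Rightarrow> (real^2 \<Rightarrow> real^3) \<Rightarrow> real^2 \<Rightarrow> real^2" where
  "ricci_normal_tangent g r n u =
     sharp g r u (\<lambda>v. ricci g (r u) (n u) (frechet_derivative r (at u) v))"

definition biconservative_at ::
  "3 metric \<Rightarrow> (real^2 \<Rightarrow> real^3) \<Rightarrow> (real^2 \<Rightarrow> real^3) \<Rightarrow> real^2 \<Rightarrow> bool" where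
  "biconservative_at g r n u \<longleftrightarrow>
     (let f = mean_curvature g r n; gradf = surface_grad g r f u
      in 2 *\<^sub>R shape_operator g r n u gradf + f u *\<^sub>R gradf
           - (2 * f u) *\<^sub>R ricci_normal_tangent g r n u = 0)"

definition orthonormal_frame ::
  "3 metric \<Rightarrow> (real^2 \<Rightarrow> real^3) \<Rightarrow> real^2 \<Rightarrow> (2 \<Rightarrow> real^2) \<Rightarrow> bool" where
  "orthonormal_frame g r u e \<longleftrightarrow>
     (\<forall>i j. g (r u) (frechet_derivative r (at u) (e i)) (frechet_derivative r (at u) (e j))
              = (if i = j then 1 else 0))"

text \<open>In an orthonormal frame \<open>e\<close>: the vector representing \<open>\<omega>\<close> is \<open>\<Sum>\<^sub>i \<omega>(e\<^sub>i) e\<^sub>i\<close>; in particular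
  \<open>Ricci(N)\<^sup>T = \<Sum>\<^sub>i Ricci(N, e\<^sub>i) e\<^sub>i\<close>.\<close>

lemma sharp_orthonormal_frame:
  assumes r: "linear (frechet_derivative r (at u))" and g: "bilinear (g (r u))"
    and \<omega>: "linear \<omega>" and e: "orthonormal_frame g r u e"
  shows "sharp g r u \<omega> = (\<Sum>i\<in>UNIV. \<omega> (e i) *\<^sub>R e i)"
proof -
  let ?d = "frechet_derivative r (at u)"
  let ?G = "first_form g r u"
  define E :: "real^2^2" where "E = (\<chi> a i. e i $ a)"
  have expand: "v = (\<Sum>a\<in>UNIV. v $ a *\<^sub>R axis a 1)" for v :: "real^2"
    by (subst basis_expansion[symmetric]) (simp add: scalar_mult_eq_scaleR)
  have dlin: "?d v = (\<Sum>a\<in>UNIV. v $ a *\<^sub>R partial a r u)" for v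
    unfolding partial_def by (subst expand[of v]) (simp add: linear_sum[OF r] linear_scale[OF r])
  have \<omega>lin: "\<omega> v = (\<Sum>a\<in>UNIV. v $ a * \<omega> (axis a 1))" for v
    by (subst expand[of v]) (simp add: linear_sum[OF \<omega>] linear_scale[OF \<omega>])
  have gl: "linear (\<lambda>x. g (r u) x y)" and gr: "linear (g (r u) x)" for x y
    using g unfolding bilinear_def by auto
  have gG: "g (r u) (?d v) (?d w) = (\<Sum>b\<in>UNIV. \<Sum>a\<in>UNIV. v $ a * (?G $ a $ b * w $ b))" for v w
    by (simp add: dlin linear_sum[OF gl] linear_sum[OF gr] linear_scale[OF gl] linear_scale[OF gr]
        first_form_def mult.assoc mult.left_commute sum_distrib_left)
      (auto intro!: sum.cong simp: mult.commute)
  have "(transpose E ** (?G ** E)) $ i $ j = (mat 1 :: real^2^2) $ i $ j" for i j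
  proof -
    have "(transpose E ** (?G ** E)) $ i $ j = g (r u) (?d (e i)) (?d (e j))"
      unfolding gG by (simp add: matrix_matrix_mult_def transpose_def E_def sum_distrib_left)
        (rule sum.swap)
    then show ?thesis using e by (simp add: orthonormal_frame_def mat_def)
  qed
  then have "transpose E ** (?G ** E) = mat 1"
    by (simp add: vec_eq_iff)
  then have "(?G ** E) ** transpose E = mat 1"
    by (simp add: matrix_left_right_inverse)
  then have GE: "?G ** (E ** transpose E) = mat 1"
    by (simp add: matrix_mul_assoc)
  then have EG: "(E ** transpose E) ** ?G = mat 1"
    by (simp add: matrix_left_right_inverse)
  have invG: "matrix_inv ?G ** ?G = mat 1"
    unfolding matrix_inv_def by (rule someI2[where a = "E ** transpose E"]) (use GE EG in auto)
  then have "matrix_inv ?G = matrix_inv ?G ** (?G ** (E ** transpose E))"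
    using GE by simp
  also have "\<dots> = E ** transpose E"
    by (simp add: matrix_mul_assoc invG)
  finally have inv: "matrix_inv ?G = E ** transpose E" .
  have tE: "transpose E *v (\<chi> a. \<omega> (axis a 1)) = (\<chi> i. \<omega> (e i))"
    by (simp add: vec_eq_iff matrix_vector_mult_def transpose_def E_def \<omega>lin[of "e _"])
  show ?thesis
    unfolding sharp_def inv matrix_vector_mul_assoc[symmetric] tE
    by (simp add: vec_eq_iff matrix_vector_mult_def E_def mult.commute)
qed

lemma mean_curvature_orthonormal_frame:
  assumes r: "linear (frechet_derivative r (at u))" and n: "linear (frechet_derivative n (at u))"
    and g: "bilinear (g (r u))" and e: "orthonormal_frame g r u e"
  shows "mean_curvature g r n u =
    (\<Sum>i\<in>UNIV. g (r u) (- nabla_along g r n u (e i)) (frechet_derivative r (at u) (e i)))"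
proof -
  let ?d = "frechet_derivative r (at u)"
  let ?II = "\<lambda>v w. g (r u) (- nabla_along g r n u v) (?d w)"
  have gl: "linear (\<lambda>x. g (r u) x y)" and gr: "linear (g (r u) x)" for x y
    using g unfolding bilinear_def by auto
  have cf: "linear (\<lambda>v. christoffel_form g p v w)" for p w
    by (rule linearI) (simp_all add: christoffel_form_def vec_eq_iff algebra_simps sum.distrib
        sum_distrib_left)
  have "linear (nabla_along g r n u)"
    unfolding nabla_along_def
    using linear_compose_add[OF n linear_compose[OF r cf, unfolded o_def]] by simp
  then have "linear (\<lambda>v. - nabla_along g r n u v)" by (rule linear_compose_neg)
  then have IIl: "linear (\<lambda>v. ?II v w)" for w
    using linear_compose[OF _ gl] by (auto simp: o_def)
  have IIr: "linear (?II v)" for v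
    using linear_compose[OF r gr] by (auto simp: o_def)
  have S: "shape_operator g r n u v = (\<Sum>k\<in>UNIV. ?II v (e k) *\<^sub>R e k)" for v
    unfolding shape_operator_def tangent_part_def by (rule sharp_orthonormal_frame[OF r g IIr e])
  have expand: "?II v w = (\<Sum>a\<in>UNIV. ?II (axis a 1) w * v $ a)" for v w
  proof -
    have v: "v = (\<Sum>a\<in>UNIV. v $ a *\<^sub>R axis a 1)"
      by (subst basis_expansion[symmetric]) (simp add: scalar_mult_eq_scaleR)
    show ?thesis
      by (subst v) (simp only: linear_sum[OF IIl] linear_scale[OF IIl] real_scaleR_def mult.commute)
  qed
  have "mean_curvature g r n u = (\<Sum>a\<in>UNIV. \<Sum>k\<in>UNIV. ?II (axis a 1) (e k) * e k $ a)"
    by (simp add: mean_curvature_def trace_def matrix_def S)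
  also have "\<dots> = (\<Sum>k\<in>UNIV. ?II (e k) (e k))"
    by (subst sum.swap) (simp only: expand[symmetric])
  finally show ?thesis .
qed


section \<open>Immersed surfaces\<close>

text \<open>An abstract oriented smooth surface: \<open>\<A>\<close> is an atlas of local parametrizations \<open>x : D \<rightarrow> M\<close>
  (inverse charts), with smooth orientation preserving changes of coordinates. The class constraint
  provides the Hausdorff and second countability axioms; \<open>M\<close> carries the subspace topology.\<close>

type_synonym 'a atlas = "((real^2) set \<times> (real^2 \<Rightarrow> 'a)) set"

definition oriented_surface ::
  "('a::{t2_space,second_countable_topology}) set \<Rightarrow> 'a atlas \<Rightarrow> bool" where
  "oriented_surface M \<A> \<longleftrightarrow>
     (\<forall>(D, x)\<in>\<A>. open D \<and> openin (top_of_set M) (x ` D) \<and> (\<exists>y. homeomorphism D (x ` D) x y)) \<and>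
     M = (\<Union>(D, x)\<in>\<A>. x ` D) \<and>
     (\<forall>(D, x)\<in>\<A>. \<forall>(E, y)\<in>\<A>.
        let W = {u\<in>D. x u \<in> y ` E}; t = inv_into E y \<circ> x
        in smooth_on W t \<and> (\<forall>u\<in>W. det (matrix (frechet_derivative t (at u))) > 0))"

definition immersion_in :: "(real^3) set \<Rightarrow> 'a set \<Rightarrow> 'a atlas \<Rightarrow> ('a \<Rightarrow> real^3) \<Rightarrow> bool" where
  "immersion_in B M \<A> \<phi> \<longleftrightarrow>
     \<phi> ` M \<subseteq> B \<and>
     (\<forall>(D, x)\<in>\<A>. smooth_on D (\<phi> \<circ> x) \<and> (\<forall>u\<in>D. inj (frechet_derivative (\<phi> \<circ> x) (at u))))"

definition unit_normal :: "3 metric \<Rightarrow> 'a atlas \<Rightarrow> ('a \<Rightarrow> real^3) \<Rightarrow> ('a \<Rightarrow> real^3) \<Rightarrow> bool" where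
  "unit_normal g \<A> \<phi> N \<longleftrightarrow>
     (\<forall>(D, x)\<in>\<A>. smooth_on D (N \<circ> x) \<and>
        (\<forall>u\<in>D. g (\<phi> (x u)) (N (x u)) (N (x u)) = 1 \<and>
           (\<forall>v. g (\<phi> (x u)) (frechet_derivative (\<phi> \<circ> x) (at u) v) (N (x u)) = 0)))"

definition bcv_immersed_surface ::
  "real \<Rightarrow> real \<Rightarrow> ('a::{t2_space,second_countable_topology}) set \<Rightarrow> 'a atlas \<Rightarrow>
     ('a \<Rightarrow> real^3) \<Rightarrow> ('a \<Rightarrow> real^3) \<Rightarrow> bool" where
  "bcv_immersed_surface \<kappa> \<tau> M \<A> \<phi> N \<longleftrightarrow>
     oriented_surface M \<A> \<and> immersion_in (bcv_domain \<kappa>) M \<A> \<phi> \<and>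
     unit_normal (bcv_metric \<kappa> \<tau>) \<A> \<phi> N"

text \<open>The mean curvature at a point of \<open>M\<close> does not depend on the parametrization used to compute it,
  so requirements on it are imposed in all parametrizations of the atlas.\<close>

definition minimal_surface ::
  "real \<Rightarrow> real \<Rightarrow> 'a atlas \<Rightarrow> ('a \<Rightarrow> real^3) \<Rightarrow> ('a \<Rightarrow> real^3) \<Rightarrow> bool" where
  "minimal_surface \<kappa> \<tau> \<A> \<phi> N \<longleftrightarrow>
     (\<forall>(D, x)\<in>\<A>. \<forall>u\<in>D. mean_curvature (bcv_metric \<kappa> \<tau>) (\<phi> \<circ> x) (N \<circ> x) u = 0)"

definition cmc_surface ::
  "real \<Rightarrow> real \<Rightarrow> 'a atlas \<Rightarrow> ('a \<Rightarrow> real^3) \<Rightarrow> ('a \<Rightarrow> real^3) \<Rightarrow> bool" where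
  "cmc_surface \<kappa> \<tau> \<A> \<phi> N \<longleftrightarrow>
     (\<exists>f0. \<forall>(D, x)\<in>\<A>. \<forall>u\<in>D. mean_curvature (bcv_metric \<kappa> \<tau>) (\<phi> \<circ> x) (N \<circ> x) u = f0)"

definition biconservative_surface ::
  "real \<Rightarrow> real \<Rightarrow> 'a atlas \<Rightarrow> ('a \<Rightarrow> real^3) \<Rightarrow> ('a \<Rightarrow> real^3) \<Rightarrow> bool" where
  "biconservative_surface \<kappa> \<tau> \<A> \<phi> N \<longleftrightarrow>
     (\<forall>(D, x)\<in>\<A>. \<forall>u\<in>D. biconservative_at (bcv_metric \<kappa> \<tau>) (\<phi> \<circ> x) (N \<circ> x) u)"

definition constant_angle_surface ::
  "real \<Rightarrow> real \<Rightarrow> 'a set \<Rightarrow> ('a \<Rightarrow> real^3) \<Rightarrow> ('a \<Rightarrow> real^3) \<Rightarrow> bool" where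
  "constant_angle_surface \<kappa> \<tau> M \<phi> N \<longleftrightarrow>
     (\<exists>\<alpha>\<in>{0..pi}. \<forall>p\<in>M. cos \<alpha> = bcv_metric \<kappa> \<tau> (\<phi> p) hopf_field (N p))"

definition hopf_tube :: "real \<Rightarrow> (real \<Rightarrow> real^2) \<Rightarrow> real set \<Rightarrow> (real^3) set" where
  "hopf_tube \<kappa> c J = {q \<in> bcv_domain \<kappa>. hopf_fibration q \<in> c ` J}"

text \<open>Locally the immersed surface is an open part of the Hopf tube over \<open>c\<close>. Passing to subarcs \<open>J\<close>
  allows for curves with self-intersections.\<close>

definition is_hopf_tube_over ::
  "real \<Rightarrow> ('a::topological_space) set \<Rightarrow> ('a \<Rightarrow> real^3) \<Rightarrow> real set \<Rightarrow> (real \<Rightarrow> real^2) \<Rightarrow> bool" where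
  "is_hopf_tube_over \<kappa> M \<phi> I c \<longleftrightarrow>
     regular_curve_in (base_domain \<kappa>) I c \<and>
     (\<forall>p\<in>M. \<exists>U J. openin (top_of_set M) U \<and> p \<in> U \<and>
        open J \<and> is_interval J \<and> J \<subseteq> I \<and> openin (top_of_set (hopf_tube \<kappa> c J)) (\<phi> ` U))"

definition hopf_tube_const_geodesic_curvature ::
  "real \<Rightarrow> ('a::topological_space) set \<Rightarrow> ('a \<Rightarrow> real^3) \<Rightarrow> bool" where
  "hopf_tube_const_geodesic_curvature \<kappa> M \<phi> \<longleftrightarrow>
     (\<exists>I c k. is_hopf_tube_over \<kappa> M \<phi> I c \<and>
        (\<forall>t\<in>I. geodesic_curvature (base_metric \<kappa>) c t = k))"

end

theory Submission
  imports Defs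
begin

text \<open>Everything is computed in the orthonormal frame \<open>F \<partial>\<^sub>x - \<tau> y \<partial>\<^sub>z\<close>, \<open>F \<partial>\<^sub>y + \<tau> x \<partial>\<^sub>z\<close>, \<open>E\<^sub>3 = \<partial>\<^sub>z\<close>, in which
  the connection form has simple coefficients and the Ricci tensor is \<open>(\<kappa> - 2 \<tau>\<^sup>2) g + (4 \<tau>\<^sup>2 - \<kappa>) \<eta> \<otimes> \<eta>\<close>,
  \<open>\<eta> = g(E\<^sub>3, _)\<close> (\<open>ricci_bcv\<close>). Put \<open>\<nu> = cos \<alpha>\<close> and let \<open>T\<close> be the tangential part of \<open>E\<^sub>3\<close>; the biconservative
  equation reads \<open>2 A(grad f) + f grad f = 2 f (4 \<tau>\<^sup>2 - \<kappa>) \<nu> T\<close>.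

  If \<open>f\<close> is a constant, it is nonzero and \<open>\<nu> T = 0\<close>, so \<open>\<nu> \<in> {0, 1, - 1}\<close> is constant on the connected surface.
  A surface with \<open>\<nu> = \<plusminus> 1\<close> is minimal (\<open>vertical_normal_minimal\<close>), hence \<open>\<nu> = 0\<close>. This proves that (b)
  implies (a) and shows that the surface is tangent to \<open>E\<^sub>3\<close> (\<open>cmc_imp_horizontal_normal\<close>).

  Let conversely \<open>\<nu>\<close> be constant. Again \<open>\<nu>\<^sup>2 < 1\<close>; put \<open>s = sqrt (1 - \<nu>\<^sup>2)\<close> and \<open>e\<^sub>1 = T / s\<close>. Constancy of the angle
  determines the shape operator up to \<open>f\<close>. If \<open>\<nu> \<noteq> 0\<close>, the surface is locally a graph over the base, and
  \<open>N\<close> projects to a vector field there which has constant length, constant rotation and divergence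
  \<open>- f\<close>, and whose turning is subject to the curvature of the base. In general it is the rotation form of
  the projected normal (\<open>curl_Theta\<close>) that yields the Riccati equation
  \<open>e\<^sub>1(f) = - (\<nu> / s) (f\<^sup>2 + \<kappa> s\<^sup>2 + 4 \<tau>\<^sup>2 \<nu>\<^sup>2)\<close> (\<open>riccati\<close>). Combined with the two components of the
  biconservative equation it gives, for \<open>\<nu> \<noteq> 0\<close>, a polynomial equation for \<open>f\<close> with constant coefficients,
  so \<open>f\<close> is constant; for \<open>\<nu> = 0\<close> it says \<open>e\<^sub>1(f) = 0\<close>, and the component orthogonal to \<open>e\<^sub>1\<close> then gives
  \<open>f grad f = 0\<close> (\<open>constant_angle_imp_cmc\<close>).

  The equivalence of (b) and (c) rests on the fact that the curves of constant geodesic curvature of the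
  base are Euclidean circles and lines. A curve determines at each point its osculating circle, and this circle
  is constant when the geodesic curvature is (\<open>osculating_circle_constant\<close>). Applied to the projection of a
  surface of constant mean curvature this puts the whole surface over one circle
  (\<open>cmc_imp_projects_to_circle\<close>), and being an immersion tangent to the cylinder over the circle it is
  locally an open part of the Hopf tube (\<open>circle_imp_hopf_tube\<close>). Applied to the curve in (c) it again puts
  the surface over one circle, and then the normal, and with it \<open>f\<close>, can be read off from the equation of the
  circle (\<open>projects_to_circle_imp_cmc\<close>).\<close>

section \<open>Calculus of smooth functions\<close>

lemma frechet_derivative_cong_open:
  assumes "open S" "x \<in> S" "\<And>y. y \<in> S \<Longrightarrow> f y = g y"
  shows "frechet_derivative f (at x) = frechet_derivative g (at x)"
proof -
  have "(f has_derivative D) (at x) \<longleftrightarrow> (g has_derivative D) (at x)" for D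
    using has_derivative_transform_within_open[OF _ assms(1,2), of f D UNIV g]
      has_derivative_transform_within_open[OF _ assms(1,2), of g D UNIV f] assms(3) by auto
  then show ?thesis unfolding frechet_derivative_def by simp
qed

lemma differentiable_cong_open:
  assumes "open S" "x \<in> S" "\<And>y. y \<in> S \<Longrightarrow> f y = g y" "f differentiable (at x)"
  shows "g differentiable (at x)"
  using assms has_derivative_transform_within_open[OF _ assms(1,2), of f _ UNIV g]
  unfolding differentiable_def by blast

lemma Ck_on_cong:
  assumes "open S" "\<And>y. y \<in> S \<Longrightarrow> f y = g y" "Ck_on k S f"
  shows "Ck_on k S g"
  using assms(2,3)
proof (induction k arbitrary: f g)
  case 0
  then show ?case using continuous_on_cong by force
next
  case (Suc k)
  show ?case
    unfolding Ck_on.simps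
  proof (intro conjI ballI allI)
    fix x assume "x \<in> S"
    then show "g differentiable at x"
      using differentiable_cong_open[OF assms(1), of x f g] Suc.prems by auto
  next
    fix v
    show "Ck_on k S (\<lambda>x. frechet_derivative g (at x) v)"
      by (rule Suc.IH[of "\<lambda>x. frechet_derivative f (at x) v"])
        (use Suc.prems frechet_derivative_cong_open[OF assms(1), of _ f g] in auto)
  qed
qed

lemma Ck_on_mono: "Ck_on (Suc k) S f \<Longrightarrow> Ck_on k S f"
proof (induction k arbitrary: f)
  case 0
  then show ?case
    by (auto intro!: continuous_at_imp_continuous_on differentiable_imp_continuous_within)
next
  case (Suc k)
  then show ?case by (metis Ck_on.simps(2))
qed

lemma smooth_on_cong:
  "open S \<Longrightarrow> (\<And>y. y \<in> S \<Longrightarrow> f y = g y) \<Longrightarrow> smooth_on S f \<Longrightarrow> smooth_on S g"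
  unfolding smooth_on_def using Ck_on_cong by blast

lemma smooth_on_differentiable: "smooth_on S f \<Longrightarrow> x \<in> S \<Longrightarrow> f differentiable (at x)"
  unfolding smooth_on_def using Ck_on.simps(2) by blast

lemma smooth_on_continuous: "smooth_on S f \<Longrightarrow> continuous_on S f"
  unfolding smooth_on_def using Ck_on.simps(1) by blast

lemma smooth_on_derivative: "smooth_on S f \<Longrightarrow> smooth_on S (\<lambda>x. frechet_derivative f (at x) v)"
  unfolding smooth_on_def using Ck_on.simps(2) by blast

lemma has_derivative_frechet:
  "f differentiable (at x) \<Longrightarrow> (f has_derivative frechet_derivative f (at x)) (at x)"
  by (simp add: frechet_derivative_works)

lemmas frechet_eqI = frechet_derivative_at[symmetric]

lemma Ck_on_const: "Ck_on k S (\<lambda>_. c)"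
  by (induction k arbitrary: c) (auto simp: frechet_derivative_const)

lemma smooth_on_const: "smooth_on S (\<lambda>_. c)"
  by (simp add: smooth_on_def Ck_on_const)

lemma Ck_on_SucI:
  assumes "open S" "\<And>x. x \<in> S \<Longrightarrow> (f has_derivative f' x) (at x)" "\<And>v. Ck_on k S (\<lambda>x. f' x v)"
  shows "Ck_on (Suc k) S f"
proof -
  have "Ck_on k S (\<lambda>x. frechet_derivative f (at x) v)" for v
    by (rule Ck_on_cong[OF assms(1) _ assms(3)]) (simp add: frechet_eqI[OF assms(2)])
  then show ?thesis using assms(2) by (auto intro: differentiableI)
qed

lemma Ck_on_SucE:
  assumes "Ck_on (Suc k) S f"
  obtains "\<And>x. x \<in> S \<Longrightarrow> (f has_derivative frechet_derivative f (at x)) (at x)"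
    "\<And>v. Ck_on k S (\<lambda>x. frechet_derivative f (at x) v)" "Ck_on k S f"
  using assms Ck_on_mono[OF assms] by (auto intro: has_derivative_frechet)

lemma Ck_on_add:
  assumes "open S" shows "Ck_on k S f \<Longrightarrow> Ck_on k S g \<Longrightarrow> Ck_on k S (\<lambda>x. f x + g x)"
proof (induction k arbitrary: f g)
  case (Suc k)
  from Suc.prems show ?case
    by (elim Ck_on_SucE) (rule Ck_on_SucI[OF assms has_derivative_add Suc.IH])
qed (auto intro: continuous_intros)

text \<open>Bounded linear images cover constant multiples, components and negation at once.\<close>

lemma Ck_on_linear:
  assumes "open S" and h: "bounded_linear h"
  shows "Ck_on k S f \<Longrightarrow> Ck_on k S (\<lambda>x. h (f x))"
proof (induction k arbitrary: f)
  case 0 then show ?case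
    using linear_continuous_on[OF h] by (auto intro!: continuous_on_compose2[of UNIV h S f])
next
  case (Suc k)
  from Suc.prems show ?case
    by (elim Ck_on_SucE) (rule Ck_on_SucI[OF assms(1) bounded_linear.has_derivative[OF h] Suc.IH])
qed

lemma Ck_on_mult:
  fixes f g :: "'a::real_normed_vector \<Rightarrow> real"
  assumes "open S" shows "Ck_on k S f \<Longrightarrow> Ck_on k S g \<Longrightarrow> Ck_on k S (\<lambda>x. f x * g x)"
proof (induction k arbitrary: f g)
  case (Suc k)
  from Suc.prems show ?case
    by (elim Ck_on_SucE) (rule Ck_on_SucI[OF assms has_derivative_mult Ck_on_add[OF assms Suc.IH Suc.IH]])
qed (auto intro: continuous_intros)

lemma Ck_on_inverse:
  fixes f :: "'a::real_normed_vector \<Rightarrow> real"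
  assumes S: "open S" and nz: "\<And>x. x \<in> S \<Longrightarrow> f x \<noteq> 0"
  shows "Ck_on k S f \<Longrightarrow> Ck_on k S (\<lambda>x. inverse (f x))"
proof (induction k)
  case (Suc k)
  have minus: "Ck_on k S f \<Longrightarrow> Ck_on k S (\<lambda>x. - f x)" for f :: "'a \<Rightarrow> real"
    by (rule Ck_on_linear[OF S bounded_linear_minus[OF bounded_linear_ident]])
  from Suc.prems show ?case
    by (elim Ck_on_SucE)
      (rule Ck_on_SucI[OF S Deriv.has_derivative_inverse[of f]], auto simp: nz intro!: minus Ck_on_mult[OF S] Suc.IH)
qed (use nz in \<open>auto intro!: continuous_intros\<close>)

context
  fixes S :: "'a::real_normed_vector set" assumes S: "open S"
begin

lemma smooth_on_add: "smooth_on S f \<Longrightarrow> smooth_on S g \<Longrightarrow> smooth_on S (\<lambda>x. f x + g x)"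
  by (simp add: smooth_on_def Ck_on_add[OF S])

lemma smooth_on_linear: "bounded_linear h \<Longrightarrow> smooth_on S f \<Longrightarrow> smooth_on S (\<lambda>x. h (f x))"
  by (simp add: smooth_on_def Ck_on_linear[OF S])

lemma smooth_on_minus: "smooth_on S f \<Longrightarrow> smooth_on S (\<lambda>x. - f x)"
  using smooth_on_linear[of uminus] by (simp add: bounded_linear_minus bounded_linear_ident)

lemma smooth_on_diff: "smooth_on S f \<Longrightarrow> smooth_on S g \<Longrightarrow> smooth_on S (\<lambda>x. f x - g x)"
  using smooth_on_add[of f "\<lambda>x. - g x"] smooth_on_minus[of g] by simp

lemma smooth_on_component: "smooth_on S f \<Longrightarrow> smooth_on S (\<lambda>x. f x $ i)"
  for f :: "'a \<Rightarrow> real^'n"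
  by (rule smooth_on_linear[of "\<lambda>v. v $ i"]) (rule bounded_linear_vec_nth)

lemma smooth_on_mult: "smooth_on S f \<Longrightarrow> smooth_on S g \<Longrightarrow> smooth_on S (\<lambda>x. f x * g x)"
  for f g :: "'a \<Rightarrow> real"
  by (simp add: smooth_on_def Ck_on_mult[OF S])

lemma smooth_on_divide:
  "smooth_on S f \<Longrightarrow> smooth_on S g \<Longrightarrow> (\<And>x. x \<in> S \<Longrightarrow> g x \<noteq> 0) \<Longrightarrow> smooth_on S (\<lambda>x. f x / g x)"
  for f g :: "'a \<Rightarrow> real"
  unfolding divide_inverse
  by (rule smooth_on_mult) (auto simp: smooth_on_def intro!: Ck_on_inverse[OF S])

lemma smooth_on_power: "smooth_on S f \<Longrightarrow> smooth_on S (\<lambda>x. f x ^ n)"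
  for f :: "'a \<Rightarrow> real"
  by (induction n) (auto intro: smooth_on_const smooth_on_mult)

lemmas smooth_on_intros =
  smooth_on_add smooth_on_minus smooth_on_diff smooth_on_component smooth_on_mult smooth_on_divide
  smooth_on_power smooth_on_const

end

subsection \<open>Symmetry of mixed partial derivatives\<close>

lemma mvt_direction:
  fixes f :: "'a::real_normed_vector \<Rightarrow> real"
  assumes h: "0 < h" and S: "\<And>t. 0 \<le> t \<Longrightarrow> t \<le> h \<Longrightarrow> a + t *\<^sub>R v \<in> S"
    and d: "\<And>x. x \<in> S \<Longrightarrow> f differentiable (at x)"
  obtains t where "0 < t" "t < h"
    "f (a + h *\<^sub>R v) - f a = h * frechet_derivative f (at (a + t *\<^sub>R v)) v"
proof -
  have "((\<lambda>t. f (a + t *\<^sub>R v)) has_real_derivative frechet_derivative f (at (a + t *\<^sub>R v)) v) (at t)"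
    if "0 \<le> t" "t \<le> h" for t
  proof -
    have "((\<lambda>t. a + t *\<^sub>R v) has_derivative (\<lambda>s. s *\<^sub>R v)) (at t)"
      by (auto intro!: derivative_eq_intros)
    moreover have F: "(f has_derivative frechet_derivative f (at (a + t *\<^sub>R v))) (at (a + t *\<^sub>R v))"
      using S[OF that] d has_derivative_frechet by blast
    ultimately have "(f \<circ> (\<lambda>t. a + t *\<^sub>R v) has_derivative
        frechet_derivative f (at (a + t *\<^sub>R v)) \<circ> (\<lambda>s. s *\<^sub>R v)) (at t)"
      by (rule diff_chain_at)
    then show ?thesis
      using linear_scale[OF has_derivative_linear[OF F]]
      by (simp add: has_field_derivative_def o_def mult_commute_abs)
  qed
  then have "\<exists>z. 0 < z \<and> z < h \<and> f (a + h *\<^sub>R v) - f (a + 0 *\<^sub>R v)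
      = (h - 0) * frechet_derivative f (at (a + z *\<^sub>R v)) v"
    using h by (intro MVT2) auto
  then show ?thesis using that by auto
qed

text \<open>Both mixed derivatives are the limit of the second difference of \<open>f\<close> on a shrinking
  parallelogram, by the mean value theorem in one direction and then in the other.\<close>

lemma mixed_derivatives_commute:
  fixes f :: "'a::real_normed_vector \<Rightarrow> real"
  assumes S: "open S" and f: "smooth_on S f" and a: "a \<in> S"
  shows "frechet_derivative (\<lambda>x. frechet_derivative f (at x) v) (at a) w
       = frechet_derivative (\<lambda>x. frechet_derivative f (at x) w) (at a) v"
proof -
  let ?D = "\<lambda>v x. frechet_derivative f (at x) v"
  let ?DD = "\<lambda>v w x. frechet_derivative (?D v) (at x) w"
  have cont: "continuous_on S (?DD v w)" for v w
    using f by (intro smooth_on_continuous smooth_on_derivative)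
  have second_difference: "\<exists>s t. 0 < s \<and> s < h \<and> 0 < t \<and> t < h \<and>
      f (a + h *\<^sub>R v + h *\<^sub>R w) - f (a + h *\<^sub>R v) - f (a + h *\<^sub>R w) + f a
        = h * h * ?DD v w (a + s *\<^sub>R v + t *\<^sub>R w)"
    if h: "0 < h" and sub: "\<And>s t. 0 \<le> s \<Longrightarrow> s \<le> h \<Longrightarrow> 0 \<le> t \<Longrightarrow> t \<le> h \<Longrightarrow> a + s *\<^sub>R v + t *\<^sub>R w \<in> S"
    for h v w
  proof -
    define \<phi> where "\<phi> x = f (x + h *\<^sub>R w) - f x" for x
    have dif: "(\<phi> has_derivative (\<lambda>z. ?D z (x + h *\<^sub>R w) - ?D z x)) (at x)"
      if "x \<in> S" "x + h *\<^sub>R w \<in> S" for x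
    proof -
      have "(f \<circ> (\<lambda>x. x + h *\<^sub>R w) has_derivative (\<lambda>z. ?D z (x + h *\<^sub>R w)) \<circ> (\<lambda>z. z)) (at x)"
        using that smooth_on_differentiable[OF f]
        by (intro diff_chain_at has_derivative_frechet) (auto intro!: derivative_eq_intros)
      then show ?thesis
        unfolding \<phi>_def using that smooth_on_differentiable[OF f]
        by (intro has_derivative_diff has_derivative_frechet) (auto simp: o_def)
    qed
    obtain s where s: "0 < s" "s < h"
      "\<phi> (a + h *\<^sub>R v) - \<phi> a = h * frechet_derivative \<phi> (at (a + s *\<^sub>R v)) v"
    proof (rule mvt_direction[of h a v "{x \<in> S. x + h *\<^sub>R w \<in> S}" \<phi>])
      fix t assume t: "0 \<le> t" "t \<le> h"
      show "a + t *\<^sub>R v \<in> {x \<in> S. x + h *\<^sub>R w \<in> S}"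
        using sub[of t 0] sub[of t h] t h by auto
    next
      fix x assume "x \<in> {x \<in> S. x + h *\<^sub>R w \<in> S}"
      then show "\<phi> differentiable at x" using dif by (auto simp: differentiable_def)
    qed (use h in auto)
    have "frechet_derivative \<phi> (at (a + s *\<^sub>R v)) v = ?D v (a + s *\<^sub>R v + h *\<^sub>R w) - ?D v (a + s *\<^sub>R v)"
      using frechet_eqI[OF dif[of "a + s *\<^sub>R v"]] sub[of s 0] sub[of s h] s by auto
    moreover obtain t where "0 < t" "t < h"
      "?D v (a + s *\<^sub>R v + h *\<^sub>R w) - ?D v (a + s *\<^sub>R v) = h * ?DD v w (a + s *\<^sub>R v + t *\<^sub>R w)"
      using mvt_direction[of h "a + s *\<^sub>R v" w S "?D v"] h s sub
        smooth_on_differentiable[OF smooth_on_derivative[OF f]] by (metis less_imp_le)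
    ultimately show ?thesis
      using s by (intro exI[of _ s] exI[of _ t]) (auto simp: \<phi>_def algebra_simps)
  qed
  have gap: "\<bar>?DD v w a - ?DD w v a\<bar> \<le> e + e" if e: "e > 0" for e
  proof -
    have "\<exists>d>0. \<forall>x\<in>S. dist x a < d \<longrightarrow> dist (?DD v w x) (?DD v w a) < e" for v w
      using cont[of v w] a e unfolding continuous_on_iff by blast
    then obtain d1 d2 where d: "d1 > 0" "d2 > 0"
      "\<And>x. x \<in> S \<Longrightarrow> dist x a < d1 \<Longrightarrow> dist (?DD v w x) (?DD v w a) < e"
      "\<And>x. x \<in> S \<Longrightarrow> dist x a < d2 \<Longrightarrow> dist (?DD w v x) (?DD w v a) < e"
      by metis
    obtain d3 where d3: "d3 > 0" "ball a d3 \<subseteq> S" using S a openE by blast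
    define d where "d = min d1 (min d2 d3)"
    define h where "h = d / (2 * (norm v + norm w + 1))"
    have nn: "norm v + norm w + 1 > 0" by (simp add: add_nonneg_pos)
    have h0: "h > 0" using d d3 nn by (simp add: h_def d_def)
    have near: "dist (a + s *\<^sub>R v + t *\<^sub>R w) a < d" if "0 \<le> s" "s \<le> h" "0 \<le> t" "t \<le> h" for s t
    proof -
      have "norm (s *\<^sub>R v + t *\<^sub>R w) \<le> s * norm v + t * norm w"
        using that by (intro order.trans[OF norm_triangle_ineq]) auto
      also have "\<dots> \<le> h * norm v + h * norm w"
        using that by (intro add_mono mult_right_mono) auto
      also have "\<dots> < 2 * h * (norm v + norm w + 1)"
        using h0 by (simp add: algebra_simps add_strict_increasing2)
      also have "\<dots> = d" using nn by (simp add: h_def field_simps)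
      finally show ?thesis by (simp add: dist_norm add.assoc)
    qed
    have near': "dist (a + t *\<^sub>R w + s *\<^sub>R v) a < d" if "0 \<le> s" "s \<le> h" "0 \<le> t" "t \<le> h" for s t
      using near[OF that] by (simp add: algebra_simps)
    have inS: "x \<in> S" if "dist x a < d" for x
      using that d3 by (auto simp: d_def dist_commute)
    obtain s t where st: "0 < s" "s < h" "0 < t" "t < h"
      "f (a + h *\<^sub>R v + h *\<^sub>R w) - f (a + h *\<^sub>R v) - f (a + h *\<^sub>R w) + f a
        = h * h * ?DD v w (a + s *\<^sub>R v + t *\<^sub>R w)"
      using second_difference[of h v w] h0 near inS by blast
    obtain s' t' where st': "0 < s'" "s' < h" "0 < t'" "t' < h"
      "f (a + h *\<^sub>R w + h *\<^sub>R v) - f (a + h *\<^sub>R w) - f (a + h *\<^sub>R v) + f a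
        = h * h * ?DD w v (a + s' *\<^sub>R w + t' *\<^sub>R v)"
      using second_difference[of h w v] h0 near' inS by blast
    have "h * h * ?DD v w (a + s *\<^sub>R v + t *\<^sub>R w) = h * h * ?DD w v (a + s' *\<^sub>R w + t' *\<^sub>R v)"
      unfolding st(5)[symmetric] st'(5)[symmetric] by (simp add: add.commute add.left_commute)
    then have "?DD v w (a + s *\<^sub>R v + t *\<^sub>R w) = ?DD w v (a + s' *\<^sub>R w + t' *\<^sub>R v)"
      using h0 by simp
    moreover have "dist (?DD v w (a + s *\<^sub>R v + t *\<^sub>R w)) (?DD v w a) < e"
      using d(3) near[of s t] st inS by (auto simp: d_def)
    moreover have "dist (?DD w v (a + s' *\<^sub>R w + t' *\<^sub>R v)) (?DD w v a) < e"
      using d(4) near'[of t' s'] st' inS by (auto simp: d_def)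
    ultimately show ?thesis by (simp add: dist_real_def)
  qed
  have "\<bar>?DD v w a - ?DD w v a\<bar> \<le> 0 + e" if "e > 0" for e
    using gap[of "e / 2"] that by simp
  then have "\<bar>?DD v w a - ?DD w v a\<bar> \<le> 0" by (rule field_le_epsilon)
  then show ?thesis by simp
qed

section \<open>Computing with the Levi-Civita connection\<close>

lemma vec_sum_axis: "v = (\<Sum>a\<in>UNIV. v $ a *\<^sub>R axis a (1::real))"
  by (subst basis_expansion[symmetric]) (simp add: scalar_mult_eq_scaleR)

lemma bilinear_axis_expand:
  assumes "bilinear (h :: real^'n \<Rightarrow> real^'m \<Rightarrow> 'b::real_vector)"
  shows "h v w = (\<Sum>i\<in>UNIV. \<Sum>j\<in>UNIV. (v $ i * w $ j) *\<^sub>R h (axis i 1) (axis j 1))"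
proof -
  have l: "linear (\<lambda>x. h x y)" and r: "linear (h x)" for x y
    using assms unfolding bilinear_def by auto
  show ?thesis
    by (subst vec_sum_axis[of v], subst vec_sum_axis[of w])
      (simp add: linear_sum[OF l] linear_sum[OF r] linear_scale[OF l] linear_scale[OF r]
        scaleR_sum_right, subst sum.swap, simp add: mult.commute)
qed

text \<open>The Koszul formula: a symmetric, metric connection has lowered coefficients determined by the
  derivatives of the metric. So the Christoffel symbols of a concrete metric need not be expanded; it is
  enough to guess the connection, here from a frame, and to verify symmetry and compatibility.\<close>

lemma christoffel_form_unique:
  fixes g :: "('n::finite) metric"
  assumes bil: "bilinear (g p)" and sym: "\<And>v w. g p v w = g p w v"
    and pos: "\<And>v. v \<noteq> 0 \<Longrightarrow> g p v v \<noteq> 0"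
    and G: "bilinear G" and Gsym: "\<And>v w. G v w = G w v"
    and compatible: "\<And>v w u. frechet_derivative (\<lambda>q. g q w u) (at p) v = g p (G v w) u + g p w (G v u)"
  shows "christoffel_form g p v w = G v w"
proof -
  define M :: "real^'n^'n" where "M = (\<chi> a b. metric_coeff g a b p)"
  have gM: "g p x (axis l 1) = (\<Sum>m\<in>UNIV. M $ l $ m * x $ m)" for x l
  proof -
    have lin: "linear (\<lambda>x. g p x (axis l 1))" using bil unfolding bilinear_def by auto
    show ?thesis
      by (subst vec_sum_axis[of x]) (simp add: linear_sum[OF lin] linear_scale[OF lin] M_def
          metric_coeff_def sym[of "axis l 1"] mult.commute)
  qed
  have "x = 0" if "M *v x = 0" for x
  proof -
    have lin: "linear (g p x)" using bil unfolding bilinear_def by auto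
    have "g p x (axis l 1) = 0" for l
      using that unfolding gM by (simp add: vec_eq_iff matrix_vector_mult_def)
    then have "g p x x = 0"
      by (subst (2) vec_sum_axis[of x]) (simp add: linear_sum[OF lin] linear_scale[OF lin])
    then show ?thesis using pos by blast
  qed
  then have "\<exists>B. B ** M = mat 1" unfolding matrix_left_invertible_ker by blast
  then have inv: "matrix_inv M ** M = mat 1"
    unfolding matrix_inv_def by (metis (mono_tags, lifting) matrix_left_right_inverse someI_ex)
  have chr: "christoffel g k i j p = G (axis i 1) (axis j 1) $ k" for k i j
  proof -
    have part: "partial i (metric_coeff g j l) p
        = g p (G (axis i 1) (axis j 1)) (axis l 1) + g p (axis j 1) (G (axis i 1) (axis l 1))" for i j l
      using compatible by (simp add: partial_def metric_coeff_def[abs_def])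
    have "partial i (metric_coeff g j l) p + partial j (metric_coeff g i l) p
        - partial l (metric_coeff g i j) p
      = 2 * (\<Sum>m\<in>UNIV. M $ l $ m * G (axis i 1) (axis j 1) $ m)" for l
      unfolding part gM[symmetric]
      by (simp add: sym[of "axis j 1"] sym[of "axis i 1"] Gsym[of "axis j 1" "axis i 1"]
          Gsym[of "axis i 1" "axis l 1"] Gsym[of "axis j 1" "axis l 1"])
    then have "christoffel g k i j p
        = (\<Sum>l\<in>UNIV. matrix_inv M $ k $ l * (\<Sum>m\<in>UNIV. M $ l $ m * G (axis i 1) (axis j 1) $ m))"
      by (simp add: christoffel_def M_def[symmetric] sum_divide_distrib)
    also have "\<dots> = (matrix_inv M *v (M *v G (axis i 1) (axis j 1))) $ k"
      by (simp add: matrix_vector_mult_def)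
    also have "\<dots> = G (axis i 1) (axis j 1) $ k"
      by (simp add: matrix_vector_mul_assoc inv)
    finally show ?thesis .
  qed
  show ?thesis
    by (simp add: vec_eq_iff christoffel_form_def chr bilinear_axis_expand[OF G, of v w] mult_ac)
qed

lemma has_derivative_vector_3:
  assumes "(a has_derivative a') F" "(b has_derivative b') F" "(c has_derivative c') F"
  shows "((\<lambda>u. vector [a u, b u, c u] :: real^3) has_derivative (\<lambda>v. vector [a' v, b' v, c' v])) F"
proof -
  have e: "(vector [x, y, z] :: real^3) = x *\<^sub>R axis 1 1 + y *\<^sub>R axis 2 1 + z *\<^sub>R axis 3 1" for x y z
    by (simp add: vec_eq_iff forall_3 axis_def)
  show ?thesis unfolding e
    by (intro has_derivative_add bounded_linear.has_derivative[OF bounded_linear_scaleR_left] assms)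
qed

lemma has_derivative_vector_2:
  assumes "(a has_derivative a') F" "(b has_derivative b') F"
  shows "((\<lambda>u. vector [a u, b u] :: real^2) has_derivative (\<lambda>v. vector [a' v, b' v])) F"
proof -
  have e: "(vector [x, y] :: real^2) = x *\<^sub>R axis 1 1 + y *\<^sub>R axis 2 1" for x y
    by (simp add: vec_eq_iff forall_2 axis_def)
  show ?thesis unfolding e
    by (intro has_derivative_add bounded_linear.has_derivative[OF bounded_linear_scaleR_left] assms)
qed

lemma has_derivative_cross3:
  assumes "(f has_derivative f') (at x within S)" "(g has_derivative g') (at x within S)"
  shows "((\<lambda>x. cross3 (f x) (g x)) has_derivative (\<lambda>h. cross3 (f x) (g' h) + cross3 (f' h) (g x))) (at x within S)"
  by (rule bounded_bilinear.FDERIV[OF _ assms])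
    (simp add: bilinear_conv_bounded_bilinear[symmetric] bilinear_cross)

lemma has_derivative_component [derivative_intros]:
  "(f has_derivative f') F \<Longrightarrow> ((\<lambda>x. f x $ i) has_derivative (\<lambda>h. f' h $ i)) F" for i :: "'n::finite"
  by (rule bounded_linear.has_derivative[OF bounded_linear_vec_nth])


section \<open>The orthonormal frame of a BCV-space\<close>

text \<open>The components of a tangent vector in the orthonormal frame
  \<open>F \<partial>\<^sub>x - \<tau> y \<partial>\<^sub>z\<close>, \<open>F \<partial>\<^sub>y + \<tau> x \<partial>\<^sub>z\<close>, \<open>\<partial>\<^sub>z\<close>.\<close>

definition frame_of :: "real \<Rightarrow> real \<Rightarrow> real^3 \<Rightarrow> real^3 \<Rightarrow> real^3" where
  "frame_of \<kappa> \<tau> p v = (let F = bcv_F \<kappa> (p$1) (p$2) in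
     vector [v$1 / F, v$2 / F, v$3 + \<tau> * (p$2 * v$1 - p$1 * v$2) / F])"

definition of_frame :: "real \<Rightarrow> real \<Rightarrow> real^3 \<Rightarrow> real^3 \<Rightarrow> real^3" where
  "of_frame \<kappa> \<tau> p V = (let F = bcv_F \<kappa> (p$1) (p$2) in
     vector [F * V$1, F * V$2, V$3 - \<tau> * (p$2 * V$1 - p$1 * V$2)])"

text \<open>The Levi-Civita connection in the frame: since it is metric, its connection form is skew and is
  recorded by a vector, acting by the cross product.\<close>

definition frame_connection :: "real \<Rightarrow> real \<Rightarrow> real^3 \<Rightarrow> real^3 \<Rightarrow> real^3" where
  "frame_connection \<kappa> \<tau> p V =
     vector [\<tau> * V$1, \<tau> * V$2, \<kappa> / 2 * (p$2 * V$1 - p$1 * V$2) - \<tau> * V$3]"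

text \<open>The derivative of \<open>q \<mapsto> frame_of \<kappa> \<tau> q w\<close> at \<open>p\<close> in the direction \<open>v\<close>.\<close>

definition frame_derivative :: "real \<Rightarrow> real \<Rightarrow> real^3 \<Rightarrow> real^3 \<Rightarrow> real^3 \<Rightarrow> real^3" where
  "frame_derivative \<kappa> \<tau> p v w = (let F = bcv_F \<kappa> (p$1) (p$2);
       dI = - (\<kappa> / 2 * (p$1 * v$1 + p$2 * v$2)) / F\<^sup>2 in
     vector [w$1 * dI, w$2 * dI,
       \<tau> * ((v$2 * w$1 - v$1 * w$2) / F + (p$2 * w$1 - p$1 * w$2) * dI)])"

locale bcv_point =
  fixes \<kappa> \<tau> :: real and p :: "real^3"
  assumes in_domain: "p \<in> bcv_domain \<kappa>"
begin

abbreviation "fr \<equiv> frame_of \<kappa> \<tau>"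
abbreviation "dfr \<equiv> frame_derivative \<kappa> \<tau>"
abbreviation "conn \<equiv> frame_connection \<kappa> \<tau>"
abbreviation "Fp \<equiv> bcv_F \<kappa> (p$1) (p$2)"

lemma F_pos: "Fp > 0" using in_domain by (simp add: bcv_domain_def)
lemma F_nz: "Fp \<noteq> 0" using F_pos by simp

lemma of_frame_inverse: "fr p (of_frame \<kappa> \<tau> p V) = V"
  using F_nz by (simp add: frame_of_def of_frame_def Let_def vec_eq_iff forall_3 field_simps)

lemma frame_of_inverse: "of_frame \<kappa> \<tau> p (fr p v) = v"
  using F_nz by (simp add: frame_of_def of_frame_def Let_def vec_eq_iff forall_3 field_simps)

lemma linear_frame_of: "linear (fr p)"
  by (rule linearI) (simp_all add: frame_of_def Let_def vec_eq_iff forall_3 add_divide_distrib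
      diff_divide_distrib algebra_simps)

lemma linear_of_frame: "linear (of_frame \<kappa> \<tau> p)"
  by (rule linearI) (simp_all add: of_frame_def Let_def vec_eq_iff forall_3 algebra_simps)

lemma metric_frame: "bcv_metric \<kappa> \<tau> p v w = fr p v \<bullet> fr p w"
  by (simp add: bcv_metric_def frame_of_def Let_def inner_vec_def sum_3 power2_eq_square
      add_divide_distrib)

lemma bilinear_metric: "bilinear (bcv_metric \<kappa> \<tau> p)"
  unfolding bilinear_def metric_frame
  using linear_compose[OF linear_frame_of, of "\<lambda>x. x \<bullet> _"] linear_compose[OF linear_frame_of, of "\<lambda>x. _ \<bullet> x"]
  by (auto simp: o_def bounded_linear.linear bounded_linear_inner_left bounded_linear_inner_right)

lemma F_has_derivative:
  "((\<lambda>q. bcv_F \<kappa> (q$1) (q$2)) has_derivative (\<lambda>v. \<kappa> / 2 * (p$1 * v$1 + p$2 * v$2))) (at p)"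
  unfolding bcv_F_def power2_eq_square
  by (rule has_derivative_eq_rhs, (rule derivative_intros)+) (simp add: fun_eq_iff algebra_simps)

lemma frame_of_has_derivative:
  "((\<lambda>q. fr q w) has_derivative (\<lambda>v. dfr p v w)) (at p)"
proof -
  have "((\<lambda>q. inverse (bcv_F \<kappa> (q$1) (q$2))) has_derivative
      (\<lambda>v. - (\<kappa> / 2 * (p$1 * v$1 + p$2 * v$2)) / Fp\<^sup>2)) (at p)"
    by (rule has_derivative_eq_rhs[OF Deriv.has_derivative_inverse[OF F_nz F_has_derivative]])
      (simp add: fun_eq_iff power2_eq_square field_simps)
  note d = this
  have L: "((\<lambda>q. \<tau> * (q$2 * w$1 - q$1 * w$2)) has_derivative (\<lambda>v. \<tau> * (v$2 * w$1 - v$1 * w$2))) (at p)"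
    by (rule derivative_intros)+
  note third = has_derivative_add[OF has_derivative_const[of "w$3"] has_derivative_mult[OF L d]]
  show ?thesis
    unfolding frame_of_def Let_def divide_inverse[of _ "bcv_F _ _ _"]
    by (rule has_derivative_eq_rhs[OF has_derivative_vector_3[OF has_derivative_mult_right[OF d]
          has_derivative_mult_right[OF d] third]])
      (simp add: frame_derivative_def Let_def fun_eq_iff vec_eq_iff forall_3 divide_simps,
        simp add: algebra_simps)
qed

text \<open>The first structure equations of the coframe. Only the third component uses the shape of \<open>F\<close>, in the
  form \<open>4 / F = 4 - \<kappa> |p|\<^sup>2 / F\<close>.\<close>

lemma frame_torsion_free:
  "dfr p v w + cross3 (conn p (fr p v)) (fr p w)
   = dfr p w v + cross3 (conn p (fr p w)) (fr p v)"
proof -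
  define I where "I = inverse Fp"
  have I: "I * (4 + \<kappa> * ((p$1)\<^sup>2 + (p$2)\<^sup>2)) = 4"
    using F_nz by (simp add: I_def bcv_F_def field_simps)
  then have third: "\<tau> * (v$2 * w$1 - v$1 * w$2) * I * (4 - I * (4 + \<kappa> * ((p$1)\<^sup>2 + (p$2)\<^sup>2))) = 0"
    by simp
  show ?thesis
    unfolding frame_derivative_def frame_connection_def frame_of_def Let_def divide_inverse[of _ "Fp"]
      divide_inverse[of _ "Fp\<^sup>2"] power_inverse[symmetric] I_def[symmetric] vec_eq_iff forall_3
    apply (simp add: cross3_def)
    apply (intro conjI)
    subgoal by (simp add: field_simps power2_eq_square)
    subgoal by (simp add: field_simps power2_eq_square)
    subgoal
      using third by (simp add: field_simps power2_eq_square)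
    done
qed

text \<open>The right-hand side is symmetric by the structure equations, and compatible with the metric because
  the cross product is skew.\<close>

lemma christoffel_bcv:
  "christoffel_form (bcv_metric \<kappa> \<tau>) p v w = of_frame \<kappa> \<tau> p (dfr p v w
     + cross3 (conn p (fr p v)) (fr p w))"
    (is "_ = of_frame \<kappa> \<tau> p (?G v w)")
proof (rule christoffel_form_unique)
  show "bilinear (bcv_metric \<kappa> \<tau> p)" by (rule bilinear_metric)
  show "bcv_metric \<kappa> \<tau> p v w = bcv_metric \<kappa> \<tau> p w v" for v w by (simp add: metric_frame inner_commute)
  show "bcv_metric \<kappa> \<tau> p v v \<noteq> 0" if "v \<noteq> 0" for v
    using that frame_of_inverse[of v] linear_0[OF linear_of_frame] by (auto simp: metric_frame)
  show "of_frame \<kappa> \<tau> p (?G v w) = of_frame \<kappa> \<tau> p (?G w v)" for v w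
    using frame_torsion_free by simp
  have conn: "linear (conn p)"
    by (rule linearI) (simp_all add: frame_connection_def vec_eq_iff forall_3 algebra_simps)
  have deriv: "bilinear (dfr p)"
    unfolding bilinear_def
    by (intro conjI allI linearI) (simp_all add: frame_derivative_def Let_def vec_eq_iff forall_3
        add_divide_distrib diff_divide_distrib algebra_simps)
  show "bilinear (\<lambda>v w. of_frame \<kappa> \<tau> p (?G v w))"
    unfolding bilinear_def
    by (intro conjI allI linearI)
      (simp_all add: linear_add[OF linear_of_frame] linear_cmul[OF linear_of_frame]
        linear_add[OF linear_frame_of] linear_cmul[OF linear_frame_of] linear_add[OF conn] linear_cmul[OF conn]
        bilinear_ladd[OF deriv] bilinear_radd[OF deriv] bilinear_lmul[OF deriv] bilinear_rmul[OF deriv]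
        cross_add_left cross_add_right cross_mult_left cross_mult_right scaleR_add_right)
next
  fix v w u
  have H: "((\<lambda>q. fr q w \<bullet> fr q u) has_derivative
      (\<lambda>v. fr p w \<bullet> dfr p v u + dfr p v w \<bullet> fr p u)) (at p)"
    by (intro has_derivative_inner frame_of_has_derivative)
  have E: "(\<lambda>q. bcv_metric \<kappa> \<tau> q w u) = (\<lambda>q. fr q w \<bullet> fr q u)"
    by (simp add: fun_eq_iff bcv_metric_def frame_of_def Let_def inner_vec_def sum_3 power2_eq_square
        add_divide_distrib)
  have D: "frechet_derivative (\<lambda>q. bcv_metric \<kappa> \<tau> q w u) (at p) v
     = fr p w \<bullet> dfr p v u + dfr p v w \<bullet> fr p u"
    unfolding E frechet_eqI[OF H] ..
  have skew: "cross3 a b \<bullet> c = - (b \<bullet> cross3 a c)" for a b c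
    by (simp add: cross3_simps)
  show "frechet_derivative (\<lambda>q. bcv_metric \<kappa> \<tau> q w u) (at p) v
     = bcv_metric \<kappa> \<tau> p (of_frame \<kappa> \<tau> p (?G v w)) u + bcv_metric \<kappa> \<tau> p w (of_frame \<kappa> \<tau> p (?G v u))"
    unfolding D metric_frame of_frame_inverse inner_add_left inner_add_right skew by simp
qed

end

text \<open>The derivative of the frame hidden in the Christoffel form completes the derivative of the coordinate
  components to that of the frame components.\<close>

lemma frame_nabla_along:
  assumes "r u \<in> bcv_domain \<kappa>" and r: "(r has_derivative r') (at u)" and V: "(V has_derivative V') (at u)"
  shows "((\<lambda>x. frame_of \<kappa> \<tau> (r x) (V x)) has_derivative
     (\<lambda>v. frame_derivative \<kappa> \<tau> (r u) (r' v) (V u) + frame_of \<kappa> \<tau> (r u) (V' v))) (at u)" (is ?D)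
    and "frame_of \<kappa> \<tau> (r u) (nabla_along (bcv_metric \<kappa> \<tau>) r V u v)
      = frechet_derivative (\<lambda>x. frame_of \<kappa> \<tau> (r x) (V x)) (at u) v
        + cross3 (frame_connection \<kappa> \<tau> (r u) (frame_of \<kappa> \<tau> (r u) (r' v))) (frame_of \<kappa> \<tau> (r u) (V u))"
proof -
  interpret bcv_point \<kappa> \<tau> "r u" using assms(1) by unfold_locales
  have nz: "bcv_F \<kappa> (r u $ 1) (r u $ 2) \<noteq> 0" by (rule F_nz)
  have dF: "((\<lambda>x. bcv_F \<kappa> (r x$1) (r x$2)) has_derivative
      (\<lambda>v. \<kappa> / 2 * (r u$1 * r' v$1 + r u$2 * r' v$2))) (at u)"
    using diff_chain_at[OF r F_has_derivative] by (simp add: o_def)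
  have "((\<lambda>x. inverse (bcv_F \<kappa> (r x$1) (r x$2))) has_derivative
      (\<lambda>v. - (\<kappa> / 2 * (r u$1 * r' v$1 + r u$2 * r' v$2)) / (bcv_F \<kappa> (r u $ 1) (r u $ 2))\<^sup>2)) (at u)"
    by (rule has_derivative_eq_rhs[OF Deriv.has_derivative_inverse[OF nz dF]])
      (simp add: fun_eq_iff power2_eq_square field_simps)
  note d = this
  note [derivative_intros] = r V
  have L: "((\<lambda>x. \<tau> * (r x$2 * V x$1 - r x$1 * V x$2)) has_derivative
      (\<lambda>v. \<tau> * (r u$2 * V' v$1 + r' v$2 * V u$1 - (r u$1 * V' v$2 + r' v$1 * V u$2)))) (at u)"
    by (rule derivative_intros)+
  have V': "((\<lambda>x. V x$i) has_derivative (\<lambda>v. V' v$i)) (at u)" for i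
    by (rule derivative_intros)+
  note third = has_derivative_add[OF V'[of 3] has_derivative_mult[OF L d]]
  show D: ?D
    unfolding frame_of_def Let_def divide_inverse[of _ "bcv_F _ _ _"]
    by (rule has_derivative_eq_rhs[OF has_derivative_vector_3[OF has_derivative_mult[OF V' d]
          has_derivative_mult[OF V' d] third]])
      (simp add: frame_derivative_def Let_def fun_eq_iff vec_eq_iff forall_3 divide_simps,
        simp add: algebra_simps)
  show "frame_of \<kappa> \<tau> (r u) (nabla_along (bcv_metric \<kappa> \<tau>) r V u v)
      = frechet_derivative (\<lambda>x. frame_of \<kappa> \<tau> (r x) (V x)) (at u) v
        + cross3 (frame_connection \<kappa> \<tau> (r u) (frame_of \<kappa> \<tau> (r u) (r' v))) (frame_of \<kappa> \<tau> (r u) (V u))"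
    unfolding nabla_along_def frechet_eqI[OF D] frechet_eqI[OF r] frechet_eqI[OF V] christoffel_bcv
    by (simp add: linear_add[OF linear_frame_of] of_frame_inverse)
qed


section \<open>The Ricci tensor of a BCV-space\<close>

context bcv_point
begin

definition dI :: "real^3 \<Rightarrow> real" where
  "dI v = - (\<kappa> / 2 * (p$1 * v$1 + p$2 * v$2)) / Fp\<^sup>2"

lemma inverse_F_has_derivative: "((\<lambda>q. inverse (bcv_F \<kappa> (q$1) (q$2))) has_derivative dI) (at p)"
  unfolding dI_def
  by (rule has_derivative_eq_rhs[OF Deriv.has_derivative_inverse[OF F_nz F_has_derivative]])
    (simp add: fun_eq_iff power2_eq_square field_simps)

lemma connection_has_derivative:
  "((\<lambda>q. conn q (fr q b)) has_derivative
    (\<lambda>a. vector [\<tau> * b$1 * dI a, \<tau> * b$2 * dI a,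
       (\<kappa> / 2 - \<tau>\<^sup>2) * ((a$2 * b$1 - a$1 * b$2) * inverse Fp + (p$2 * b$1 - p$1 * b$2) * dI a)])) (at p)"
proof -
  have L: "((\<lambda>q. (\<kappa> / 2 - \<tau>\<^sup>2) * (q$2 * b$1 - q$1 * b$2)) has_derivative
      (\<lambda>a. (\<kappa> / 2 - \<tau>\<^sup>2) * (a$2 * b$1 - a$1 * b$2))) (at p)"
    by (rule derivative_intros)+
  note third = has_derivative_add[OF has_derivative_const[of "- \<tau> * b$3"]
      has_derivative_mult[OF L inverse_F_has_derivative]]
  have eq: "conn q (fr q b) =
      vector [(\<tau> * b$1) * inverse (bcv_F \<kappa> (q$1) (q$2)), (\<tau> * b$2) * inverse (bcv_F \<kappa> (q$1) (q$2)),
        - \<tau> * b$3 + ((\<kappa> / 2 - \<tau>\<^sup>2) * (q$2 * b$1 - q$1 * b$2)) * inverse (bcv_F \<kappa> (q$1) (q$2))]" for q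
    by (simp add: frame_connection_def frame_of_def Let_def vec_eq_iff forall_3
        divide_inverse[of _ "bcv_F _ _ _"] power2_eq_square algebra_simps)
  show ?thesis unfolding eq
    by (rule has_derivative_eq_rhs[OF has_derivative_vector_3[OF
          has_derivative_mult_right[OF inverse_F_has_derivative]
          has_derivative_mult_right[OF inverse_F_has_derivative] third]])
      (simp add: fun_eq_iff vec_eq_iff forall_3 algebra_simps)
qed

text \<open>In the curvature the second derivatives of the frame cancel by symmetry, so only their existence and
  symmetry are recorded.\<close>

lemma second_frame_derivative:
  obtains H where "\<And>b. ((\<lambda>q. dfr q b w) has_derivative (\<lambda>a. H a b)) (at p)"
    "\<And>a b. H a b = H b a"
proof -
  define ddI where "ddI a b = - (\<kappa> / 2 * (a$1 * b$1 + a$2 * b$2)) * (inverse Fp)\<^sup>2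
    - \<kappa> * (p$1 * b$1 + p$2 * b$2) * inverse Fp * dI a" for a b :: "real^3"
  have ddI_sym: "ddI a b = ddI b a" for a b
    by (simp add: ddI_def dI_def power_inverse divide_inverse[of _ "Fp\<^sup>2"] algebra_simps)
  have J: "((\<lambda>q. - (\<kappa> / 2 * (q$1 * b$1 + q$2 * b$2)) * (inverse (bcv_F \<kappa> (q$1) (q$2)))\<^sup>2)
      has_derivative (\<lambda>a. ddI a b)) (at p)" for b
  proof -
    have L: "((\<lambda>q. - (\<kappa> / 2 * (q$1 * b$1 + q$2 * b$2))) has_derivative
        (\<lambda>a. - (\<kappa> / 2 * (a$1 * b$1 + a$2 * b$2)))) (at p)"
      by (rule derivative_intros)+
    show ?thesis unfolding power2_eq_square
      by (rule has_derivative_eq_rhs[OF has_derivative_mult[OF L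
            has_derivative_mult[OF inverse_F_has_derivative inverse_F_has_derivative]]])
        (simp add: fun_eq_iff ddI_def power2_eq_square algebra_simps)
  qed
  have eq: "dfr q b w =
     (let J = - (\<kappa> / 2 * (q$1 * b$1 + q$2 * b$2)) * (inverse (bcv_F \<kappa> (q$1) (q$2)))\<^sup>2 in
      vector [w$1 * J, w$2 * J,
       (\<tau> * (b$2 * w$1 - b$1 * w$2)) * inverse (bcv_F \<kappa> (q$1) (q$2)) + (\<tau> * (q$2 * w$1 - q$1 * w$2)) * J])" for q b
    by (simp add: frame_derivative_def Let_def vec_eq_iff forall_3 divide_inverse[of _ "bcv_F _ _ _"]
        divide_inverse[of _ "(bcv_F _ _ _)\<^sup>2"] power_inverse algebra_simps)
  have L: "((\<lambda>q. \<tau> * (q$2 * w$1 - q$1 * w$2)) has_derivative (\<lambda>v. \<tau> * (v$2 * w$1 - v$1 * w$2))) (at p)"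
    by (rule derivative_intros)+
  define H :: "real^3 \<Rightarrow> real^3 \<Rightarrow> real^3" where "H a b = vector [w$1 * ddI a b, w$2 * ddI a b,
       (\<tau> * (b$2 * w$1 - b$1 * w$2)) * dI a + (\<tau> * (a$2 * w$1 - a$1 * w$2)) * dI b
         + \<tau> * (p$2 * w$1 - p$1 * w$2) * ddI a b]" for a b
  have "((\<lambda>q. dfr q b w) has_derivative (\<lambda>a. H a b)) (at p)" for b
    unfolding eq Let_def
    by (rule has_derivative_eq_rhs[OF has_derivative_vector_3[OF has_derivative_mult_right[OF J]
          has_derivative_mult_right[OF J] has_derivative_add[OF
          has_derivative_mult_right[OF inverse_F_has_derivative] has_derivative_mult[OF L J]]]])
      (simp add: fun_eq_iff vec_eq_iff forall_3 H_def dI_def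
        divide_inverse[of _ "Fp\<^sup>2"] power_inverse algebra_simps)
  moreover have "H a b = H b a" for a b
    by (simp add: H_def vec_eq_iff forall_3 ddI_sym[of a b] algebra_simps)
  ultimately show ?thesis by (rule that)
qed

text \<open>The curvature operator \<open>R(V, W)\<close> is skew and acts as the cross product with this vector, which is the
  image of \<open>V \<times> W\<close> under the diagonal matrix with entries \<open>- \<tau>\<^sup>2, - \<tau>\<^sup>2, - (\<kappa> - 3 \<tau>\<^sup>2)\<close>.\<close>

definition curvature_vector :: "real^3 \<Rightarrow> real^3 \<Rightarrow> real^3" where
  "curvature_vector V W = (let C = cross3 V W in
     vector [- \<tau>\<^sup>2 * C$1, - \<tau>\<^sup>2 * C$2, - (\<kappa> - 3 * \<tau>\<^sup>2) * C$3])"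

end

lemma open_bcv_domain: "open (bcv_domain \<kappa>)"
  unfolding bcv_domain_def bcv_F_def
  by (intro open_Collect_less continuous_intros)

context bcv_point
begin

text \<open>Cartan's second structure equation \<open>d\<Omega>(a, b) + [\<Omega>(a), \<Omega>(b)]\<close>; with the connection form encoded by
  vectors the commutator is again a cross product, by the Jacobi identity.\<close>

lemma frame_curvature:
  "fr p (curvature (bcv_metric \<kappa> \<tau>) p a b w)
   = cross3 (curvature_vector (fr p a) (fr p b)) (fr p w)"
proof -
  obtain H where H: "\<And>b. ((\<lambda>q. dfr q b w) has_derivative (\<lambda>a. H a b)) (at p)"
    "\<And>a b. H a b = H b a"
    using second_frame_derivative[of w] by blast
  define c where "c q v = conn q (fr q v)" for q v
  define dc where "dc a b = (vector [\<tau> * b$1 * dI a, \<tau> * b$2 * dI a,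
       (\<kappa> / 2 - \<tau>\<^sup>2) * ((a$2 * b$1 - a$1 * b$2) * inverse Fp + (p$2 * b$1 - p$1 * b$2) * dI a)] :: real^3)"
    for a b :: "real^3"
  have c: "((\<lambda>q. c q b) has_derivative (\<lambda>a. dc a b)) (at p)" for b
    using connection_has_derivative[of b] by (simp add: c_def dc_def)
  note fr = frame_of_has_derivative[of w]
  define N where "N b q = nabla (bcv_metric \<kappa> \<tau>) (\<lambda>_. b) (\<lambda>_. w) q" for b q
  have frN: "fr q (N b q) = dfr q b w + cross3 (c q b) (fr q w)"
    if "q \<in> bcv_domain \<kappa>" for b q
  proof -
    interpret q: bcv_point \<kappa> \<tau> q using that by unfold_locales
    show ?thesis
      by (simp add: N_def nabla_def frechet_derivative_const q.christoffel_bcv q.of_frame_inverse c_def)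
  qed
  have frN': "((\<lambda>q. fr q (N b q)) has_derivative
     (\<lambda>a. H a b + (cross3 (c p b) (dfr p a w) + cross3 (dc a b) (fr p w)))) (at p)" for b
    by (rule has_derivative_transform_within_open[OF _ open_bcv_domain in_domain frN[symmetric]])
      (intro has_derivative_add H has_derivative_cross3 c fr)
  have N_diff: "(N b has_derivative frechet_derivative (N b) (at p)) (at p)" for b
  proof -
    have eq: "N b q = of_frame \<kappa> \<tau> q (dfr q b w + cross3 (c q b) (fr q w))"
      if "q \<in> bcv_domain \<kappa>" for q
    proof -
      interpret q: bcv_point \<kappa> \<tau> q using that by unfold_locales
      show ?thesis by (simp add: frN[OF that, symmetric] q.frame_of_inverse)
    qed
    have of_frame_diff: "(\<lambda>q. of_frame \<kappa> \<tau> q (V q)) differentiable at p"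
      if "(V has_derivative V') (at p)" for V V'
      unfolding differentiable_def of_frame_def Let_def
      by (rule exI, rule has_derivative_vector_3)
        ((rule F_has_derivative that has_derivative_component[OF that] derivative_intros)+)
    have "(\<lambda>q. of_frame \<kappa> \<tau> q (dfr q b w + cross3 (c q b) (fr q w)))
        differentiable at p"
      by (rule of_frame_diff[OF has_derivative_add[OF H(1) has_derivative_cross3[OF c fr]]])
    then have "N b differentiable at p"
      by (rule differentiable_cong_open[OF open_bcv_domain in_domain, rotated]) (rule eq[symmetric])
    then show ?thesis by (rule has_derivative_frechet)
  qed
  have frNN: "fr p (nabla (bcv_metric \<kappa> \<tau>) (\<lambda>_. a) (N b) p)
    = H a b + (cross3 (c p b) (dfr p a w) + cross3 (dc a b) (fr p w))
      + cross3 (c p a) (dfr p b w + cross3 (c p b) (fr p w))" for a b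
  proof -
    have "nabla (bcv_metric \<kappa> \<tau>) (\<lambda>_. a) (N b) p = nabla_along (bcv_metric \<kappa> \<tau>) (\<lambda>x. x) (N b) p a"
      by (simp add: nabla_def nabla_along_def)
    then show ?thesis
      using frame_nabla_along(2)[of "\<lambda>x. x" p \<kappa> "\<lambda>x. x" "N b", OF in_domain has_derivative_ident N_diff, of \<tau> a]
        frechet_eqI[OF frN', of b] by (simp add: frN[OF in_domain] c_def)
  qed
  have jacobi: "cross3 x (cross3 y z) - cross3 y (cross3 x z) = cross3 (cross3 x y) z" for x y z
    by (simp add: cross3_simps)
  have "fr p (curvature (bcv_metric \<kappa> \<tau>) p a b w)
      = fr p (nabla (bcv_metric \<kappa> \<tau>) (\<lambda>_. a) (N b) p) - fr p (nabla (bcv_metric \<kappa> \<tau>) (\<lambda>_. b) (N a) p)"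
    unfolding curvature_def N_def[abs_def] by (rule linear_diff[OF linear_frame_of])
  also have "\<dots> = cross3 (dc a b - dc b a) (fr p w) + cross3 (cross3 (c p a) (c p b)) (fr p w)"
    unfolding frNN H(2)[of b a] jacobi[symmetric]
    by (simp add: cross_add_right Cross3.left_diff_distrib)
  also have "\<dots> = cross3 (dc a b - dc b a + cross3 (c p a) (c p b)) (fr p w)"
    by (simp add: cross_add_left)
  also have "dc a b - dc b a + cross3 (c p a) (c p b) = curvature_vector (fr p a) (fr p b)"
  proof -
    define I where "I = inverse Fp"
    have I: "I * (4 + \<kappa> * ((p$1)\<^sup>2 + (p$2)\<^sup>2)) = 4"
      using F_nz by (simp add: I_def bcv_F_def field_simps)
    \<comment> \<open>the third components differ by a multiple of this relation between \<open>I = 1 / F\<close> and the coordinates\<close>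
    then have third: "x * I * (4 - I * (4 + \<kappa> * ((p$1)\<^sup>2 + (p$2)\<^sup>2))) = 0" for x
      by simp
    show ?thesis
      unfolding dc_def c_def curvature_vector_def frame_of_def frame_connection_def dI_def Let_def divide_inverse[of _ "Fp"]
        divide_inverse[of _ "Fp\<^sup>2"] power_inverse[symmetric] I_def[symmetric] vec_eq_iff forall_3
      apply (simp add: cross3_def)
      apply (intro conjI)
      subgoal by (simp add: field_simps power2_eq_square)
      subgoal by (simp add: field_simps power2_eq_square)
      subgoal
        using third[of "(\<kappa>/2 - \<tau>\<^sup>2) * (a$2 * b$1 - a$1 * b$2)"] by (simp add: field_simps power2_eq_square)
      done
  qed
  finally show ?thesis .
qed

text \<open>For a unit normal \<open>N\<close> the first term drops out on tangent vectors, which leaves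
  \<open>Ricci(N)\<^sup>T = (4 \<tau>\<^sup>2 - \<kappa>) cos \<alpha> E\<^sub>3\<^sup>T\<close>. This is where \<open>\<kappa> \<noteq> 4 \<tau>\<^sup>2\<close> enters the equivalence.\<close>

lemma ricci_bcv:
  "ricci (bcv_metric \<kappa> \<tau>) p v w = (\<kappa> - 2 * \<tau>\<^sup>2) * (fr p v \<bullet> fr p w)
     + (4 * \<tau>\<^sup>2 - \<kappa>) * (fr p v $ 3 * fr p w $ 3)"
proof -
  define V W where "V = fr p v" and "W = fr p w"
  have "curvature (bcv_metric \<kappa> \<tau>) p z v w
      = of_frame \<kappa> \<tau> p (cross3 (curvature_vector (fr p z) V) W)" for z
    using frame_curvature[of z v w] frame_of_inverse unfolding V_def W_def by metis
  then have "ricci (bcv_metric \<kappa> \<tau>) p v w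
    = (\<Sum>k\<in>UNIV. of_frame \<kappa> \<tau> p (cross3 (curvature_vector (fr p (axis k 1)) V) W) $ k)"
    by (simp add: ricci_def trace_def matrix_def)
  also have "\<dots> = (\<kappa> - 2 * \<tau>\<^sup>2) * (V \<bullet> W) + (4 * \<tau>\<^sup>2 - \<kappa>) * (V $ 3 * W $ 3)"
  proof -
    have "fr p (axis 1 1) = vector [1 / Fp, 0, \<tau> * p$2 / Fp]"
      "fr p (axis 2 1) = vector [0, 1 / Fp, - \<tau> * p$1 / Fp]"
      "fr p (axis 3 1) = vector [0, 0, 1]"
      by (simp_all add: frame_of_def Let_def vec_eq_iff forall_3 axis_def)
    then show ?thesis
      using F_nz
      by (simp add: sum_3 of_frame_def curvature_vector_def Let_def cross3_def inner_vec_def)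
        (simp add: field_simps power2_eq_square)
  qed
  finally show ?thesis unfolding V_def W_def .
qed

end

section \<open>Differential forms on plane domains\<close>

definition exterior :: "(real^2 \<Rightarrow> real) \<Rightarrow> real^2 \<Rightarrow> real^2 \<Rightarrow> real" where
  "exterior h u v = frechet_derivative h (at u) v"

text \<open>The coefficients of \<open>\<alpha> \<and> \<beta>\<close> and of \<open>d\<alpha>\<close> with respect to \<open>du\<^sub>1 \<and> du\<^sub>2\<close>.\<close>

definition wedge :: "(real^2 \<Rightarrow> real^2 \<Rightarrow> real) \<Rightarrow> (real^2 \<Rightarrow> real^2 \<Rightarrow> real) \<Rightarrow> real^2 \<Rightarrow> real" where
  "wedge \<alpha> \<beta> u = \<alpha> u (axis 1 1) * \<beta> u (axis 2 1) - \<alpha> u (axis 2 1) * \<beta> u (axis 1 1)"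

definition curl :: "(real^2 \<Rightarrow> real^2 \<Rightarrow> real) \<Rightarrow> real^2 \<Rightarrow> real" where
  "curl \<alpha> u = exterior (\<lambda>x. \<alpha> x (axis 2 1)) u (axis 1 1) - exterior (\<lambda>x. \<alpha> x (axis 1 1)) u (axis 2 1)"

definition smooth_form :: "(real^2) set \<Rightarrow> (real^2 \<Rightarrow> real^2 \<Rightarrow> real) \<Rightarrow> bool" where
  "smooth_form S \<alpha> \<longleftrightarrow> (\<forall>v. smooth_on S (\<lambda>u. \<alpha> u v))"

lemma exterior_eqI: "(h has_derivative h') (at u) \<Longrightarrow> exterior h u = h'"
  by (simp add: exterior_def[abs_def] frechet_eqI)

lemma exterior_cong: "open S \<Longrightarrow> u \<in> S \<Longrightarrow> (\<And>x. x \<in> S \<Longrightarrow> h x = k x) \<Longrightarrow> exterior h u = exterior k u"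
  unfolding exterior_def using frechet_derivative_cong_open by metis

lemma exterior_has_derivative: "smooth_on S h \<Longrightarrow> u \<in> S \<Longrightarrow> (h has_derivative exterior h u) (at u)"
  unfolding exterior_def[abs_def] by (rule has_derivative_frechet) (rule smooth_on_differentiable)

lemma exterior_mult:
  "smooth_on S h \<Longrightarrow> smooth_on S k \<Longrightarrow> u \<in> S \<Longrightarrow>
    exterior (\<lambda>x. h x * k x) u v = h u * exterior k u v + exterior h u v * k u"
  by (subst exterior_eqI[OF has_derivative_mult]) (auto intro: exterior_has_derivative)

lemma exterior_add:
  "smooth_on S h \<Longrightarrow> smooth_on S k \<Longrightarrow> u \<in> S \<Longrightarrow>
    exterior (\<lambda>x. h x + k x) u v = exterior h u v + exterior k u v"
  by (subst exterior_eqI[OF has_derivative_add]) (auto intro: exterior_has_derivative)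

lemma exterior_diff:
  "smooth_on S h \<Longrightarrow> smooth_on S k \<Longrightarrow> u \<in> S \<Longrightarrow>
    exterior (\<lambda>x. h x - k x) u v = exterior h u v - exterior k u v"
  by (subst exterior_eqI[OF has_derivative_diff]) (auto intro: exterior_has_derivative)

lemma exterior_const [simp]: "exterior (\<lambda>x. c) u v = 0"
  by (simp add: exterior_def frechet_derivative_const)

lemma smooth_form_exterior: "smooth_on S h \<Longrightarrow> smooth_form S (exterior h)"
  unfolding smooth_form_def exterior_def by (simp add: smooth_on_derivative)

lemma curl_cong:
  assumes "open S" "u \<in> S" "\<And>x v. x \<in> S \<Longrightarrow> \<alpha> x v = \<beta> x v"
  shows "curl \<alpha> u = curl \<beta> u"
  unfolding curl_def using exterior_cong[OF assms(1,2)] assms(3) by metis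

lemma curl_exterior: "open S \<Longrightarrow> smooth_on S h \<Longrightarrow> u \<in> S \<Longrightarrow> curl (exterior h) u = 0"
  unfolding curl_def exterior_def[abs_def] by (simp add: mixed_derivatives_commute[of S h u "axis 2 1" "axis 1 1"])

lemma curl_mult:
  assumes "smooth_on S h" "smooth_form S \<alpha>" "u \<in> S"
  shows "curl (\<lambda>x v. h x * \<alpha> x v) u = wedge (exterior h) \<alpha> u + h u * curl \<alpha> u"
  using assms unfolding curl_def wedge_def smooth_form_def
  by (subst (1 2) exterior_mult[of S]) (auto simp: algebra_simps)

lemma curl_add:
  assumes "smooth_form S \<alpha>" "smooth_form S \<beta>" "u \<in> S"
  shows "curl (\<lambda>x v. \<alpha> x v + \<beta> x v) u = curl \<alpha> u + curl \<beta> u"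
  using assms unfolding curl_def smooth_form_def
  by (subst (1 2) exterior_add[of S]) auto

lemma curl_diff:
  assumes "smooth_form S \<alpha>" "smooth_form S \<beta>" "u \<in> S"
  shows "curl (\<lambda>x v. \<alpha> x v - \<beta> x v) u = curl \<alpha> u - curl \<beta> u"
  using assms unfolding curl_def smooth_form_def
  by (subst (1 2) exterior_diff[of S]) auto

lemma curl_cmult:
  assumes "smooth_form S \<alpha>" "u \<in> S"
  shows "curl (\<lambda>x v. c * \<alpha> x v) u = c * curl \<alpha> u"
  using curl_mult[OF smooth_on_const assms, of c] by (simp add: wedge_def)

context fixes S :: "(real^2) set" assumes S: "open S" begin

lemma smooth_form_mult: "smooth_on S h \<Longrightarrow> smooth_form S \<alpha> \<Longrightarrow> smooth_form S (\<lambda>x v. h x * \<alpha> x v)"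
  unfolding smooth_form_def by (auto intro!: smooth_on_mult[OF S])
lemma smooth_form_cmult: "smooth_form S \<alpha> \<Longrightarrow> smooth_form S (\<lambda>x v. c * \<alpha> x v)"
  by (rule smooth_form_mult[OF smooth_on_const])
lemma smooth_form_add: "smooth_form S \<alpha> \<Longrightarrow> smooth_form S \<beta> \<Longrightarrow> smooth_form S (\<lambda>x v. \<alpha> x v + \<beta> x v)"
  unfolding smooth_form_def by (auto intro!: smooth_on_add[OF S])
lemma smooth_form_diff: "smooth_form S \<alpha> \<Longrightarrow> smooth_form S \<beta> \<Longrightarrow> smooth_form S (\<lambda>x v. \<alpha> x v - \<beta> x v)"
  unfolding smooth_form_def by (auto intro!: smooth_on_diff[OF S])

lemmas smooth_form_intros = smooth_form_mult smooth_form_cmult smooth_form_add smooth_form_diff smooth_form_exterior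
end

section \<open>Surface patches in the frame\<close>

locale surface_patch =
  fixes \<kappa> \<tau> :: real and D :: "(real^2) set" and r n :: "real^2 \<Rightarrow> real^3"
  assumes open_D: "open D"
    and smooth_r: "smooth_on D r" and smooth_n: "smooth_on D n"
    and r_in: "\<And>u. u \<in> D \<Longrightarrow> r u \<in> bcv_domain \<kappa>"
    and immersion: "\<And>u. u \<in> D \<Longrightarrow> inj (frechet_derivative r (at u))"
    and unit: "\<And>u. u \<in> D \<Longrightarrow> bcv_metric \<kappa> \<tau> (r u) (n u) (n u) = 1"
    and normal: "\<And>u v. u \<in> D \<Longrightarrow> bcv_metric \<kappa> \<tau> (r u) (frechet_derivative r (at u) v) (n u) = 0"
begin

abbreviation "g \<equiv> bcv_metric \<kappa> \<tau>"

text \<open>From here on the surface is described by \<open>\<real>\<^sup>3\<close>-valued data: the differential, the unit normal, the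
  connection form along the surface and the second fundamental form, all in frame components.\<close>

definition dr :: "real^2 \<Rightarrow> real^2 \<Rightarrow> real^3" where
  "dr u v = frame_of \<kappa> \<tau> (r u) (frechet_derivative r (at u) v)"

definition nn :: "real^2 \<Rightarrow> real^3" where
  "nn u = frame_of \<kappa> \<tau> (r u) (n u)"

definition con :: "real^2 \<Rightarrow> real^2 \<Rightarrow> real^3" where
  "con u v = frame_connection \<kappa> \<tau> (r u) (dr u v)"

definition II :: "real^2 \<Rightarrow> real^2 \<Rightarrow> real^2 \<Rightarrow> real" where
  "II u v w = - ((frechet_derivative nn (at u) v + cross3 (con u v) (nn u)) \<bullet> dr u w)"

abbreviation "H \<equiv> mean_curvature g r n"

lemma r_deriv: "u \<in> D \<Longrightarrow> (r has_derivative frechet_derivative r (at u)) (at u)"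
  by (rule has_derivative_frechet) (rule smooth_on_differentiable[OF smooth_r])

lemma n_deriv: "u \<in> D \<Longrightarrow> (n has_derivative frechet_derivative n (at u)) (at u)"
  by (rule has_derivative_frechet) (rule smooth_on_differentiable[OF smooth_n])

lemma point: "u \<in> D \<Longrightarrow> bcv_point \<kappa> (r u)"
  by (simp add: bcv_point_def r_in)

lemma nn_unit: "u \<in> D \<Longrightarrow> nn u \<bullet> nn u = 1"
  using unit[of u] bcv_point.metric_frame[OF point] by (simp add: nn_def)

lemma nn_normal: "u \<in> D \<Longrightarrow> dr u v \<bullet> nn u = 0"
  using normal[of u v] bcv_point.metric_frame[OF point] by (simp add: nn_def dr_def)

lemma linear_dr: "u \<in> D \<Longrightarrow> linear (dr u)"
  unfolding dr_def[abs_def]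
  using linear_compose[OF has_derivative_linear[OF r_deriv] bcv_point.linear_frame_of[OF point]]
  by (simp add: o_def)

lemma inj_dr: "u \<in> D \<Longrightarrow> inj (dr u)"
  using immersion[of u] bcv_point.frame_of_inverse[OF point, of u] unfolding dr_def inj_def by metis

text \<open>By dimension the image of the differential is the whole orthogonal complement of the normal.\<close>

lemma tangent_vector_exists:
  assumes "u \<in> D" "w \<bullet> nn u = 0"
  obtains a where "dr u a = w"
proof -
  have "dim (range (dr u)) = 2"
    using dim_image_eq[OF linear_dr[OF assms(1)], of UNIV] inj_dr[OF assms(1)] by simp
  moreover have "nn u \<noteq> 0" using nn_unit[OF assms(1)] by auto
  then have "dim {x. nn u \<bullet> x = 0} = 2" by (simp add: dim_hyperplane)
  moreover have "range (dr u) \<subseteq> {x. nn u \<bullet> x = 0}"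
    using nn_normal[OF assms(1)] by (auto simp: inner_commute)
  ultimately have "range (dr u) = {x. nn u \<bullet> x = 0}"
    using subspace_dim_equal[of "range (dr u)" "{x. nn u \<bullet> x = 0}"]
      linear_subspace_image[OF linear_dr[OF assms(1)] subspace_UNIV] subspace_hyperplane[of "nn u"] by simp
  then have "w \<in> range (dr u)" using assms(2) by (simp add: inner_commute)
  then show ?thesis using that by blast
qed

lemma orthonormal_frame_dr:
  assumes "u \<in> D"
  shows "orthonormal_frame g r u e \<longleftrightarrow> (\<forall>i j. dr u (e i) \<bullet> dr u (e j) = (if i = j then 1 else 0))"
  unfolding orthonormal_frame_def dr_def using bcv_point.metric_frame[OF point[OF assms]] by simp

lemma frame_vectors:
  assumes "u \<in> D" "w1 \<bullet> nn u = 0" "w2 \<bullet> nn u = 0" "w1 \<bullet> w1 = 1" "w2 \<bullet> w2 = 1" "w1 \<bullet> w2 = 0"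
  obtains e :: "2 \<Rightarrow> real^2" where "orthonormal_frame g r u e" "dr u (e 1) = w1" "dr u (e 2) = w2"
proof -
  obtain a1 a2 where "dr u a1 = w1" "dr u a2 = w2"
    using tangent_vector_exists assms by metis
  then show ?thesis
    using assms that[of "\<lambda>i. if i = 1 then a1 else a2"]
    by (auto simp: orthonormal_frame_dr forall_2 inner_commute)
qed

lemma nn_has_derivative: "u \<in> D \<Longrightarrow> (nn has_derivative frechet_derivative nn (at u)) (at u)"
  using frame_nabla_along(1)[OF r_in r_deriv n_deriv] unfolding nn_def[abs_def]
  by (blast intro: has_derivative_frechet differentiableI)

lemma frame_nabla_normal:
  assumes "u \<in> D"
  shows "g (r u) (- nabla_along g r n u v) (frechet_derivative r (at u) w) = II u v w"
proof -
  interpret bcv_point \<kappa> \<tau> "r u" by (rule point[OF assms])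
  show ?thesis
    using frame_nabla_along(2)[OF r_in r_deriv n_deriv, OF assms assms assms, of \<tau> v]
    by (simp add: metric_frame linear_neg[OF linear_frame_of] II_def dr_def con_def nn_def[abs_def]
        inner_diff_left inner_add_left)
qed

lemma mean_curvature_frame:
  assumes "u \<in> D" "orthonormal_frame g r u e"
  shows "H u = II u (e 1) (e 1) + II u (e 2) (e 2)"
  using mean_curvature_orthonormal_frame[OF has_derivative_linear[OF r_deriv] has_derivative_linear[OF n_deriv]
      bcv_point.bilinear_metric[OF point] assms(2)] assms(1)
  by (simp add: frame_nabla_normal sum_2)

lemma linear_II: "u \<in> D \<Longrightarrow> linear (II u v)"
  unfolding II_def[abs_def]
  by (intro linear_compose_neg linear_compose[OF linear_dr, unfolded o_def])
    (auto simp: bounded_linear.linear bounded_linear_inner_right)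

text \<open>The biconservative equation tested against \<open>e\<^sub>k\<close>; the Ricci term involves only the vertical components of
  the normal and of \<open>e\<^sub>k\<close>.\<close>

lemma biconservative_frame:
  assumes u: "u \<in> D" and e: "orthonormal_frame g r u e"
    and H: "H differentiable (at u)" and bi: "biconservative_at g r n u"
  shows "2 * (exterior H u (e 1) * II u (e 1) (e k) + exterior H u (e 2) * II u (e 2) (e k))
     + H u * exterior H u (e k) - 2 * H u * ((4 * \<tau>\<^sup>2 - \<kappa>) * (nn u $ 3 * dr u (e k) $ 3)) = 0"
proof -
  note r = has_derivative_linear[OF r_deriv[OF u]]
  note bil = bcv_point.bilinear_metric[OF point[OF u], of \<tau>]
  have dH: "linear (exterior H u)"
    unfolding exterior_def[abs_def] using has_derivative_linear[OF has_derivative_frechet[OF H]] .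
  have gr: "surface_grad g r H u = exterior H u (e 1) *\<^sub>R e 1 + exterior H u (e 2) *\<^sub>R e 2"
    using sharp_orthonormal_frame[OF r bil dH e]
    by (simp add: surface_grad_def exterior_def[abs_def] sum_2)
  have ricci: "ricci g (r u) (n u) (frechet_derivative r (at u) v) = (4 * \<tau>\<^sup>2 - \<kappa>) * (nn u $ 3 * dr u v $ 3)" for v
    using nn_normal[OF u, of v]
    by (simp add: bcv_point.ricci_bcv[OF point[OF u]] nn_def dr_def inner_commute)
  have lin3: "linear (\<lambda>v. (4 * \<tau>\<^sup>2 - \<kappa>) * (nn u $ 3 * dr u v $ 3))"
    using linear_add[OF linear_dr[OF u]] linear_cmul[OF linear_dr[OF u]]
    by (auto intro!: linearI simp: algebra_simps)
  have ric: "ricci_normal_tangent g r n u = (\<Sum>i\<in>UNIV. ((4 * \<tau>\<^sup>2 - \<kappa>) * (nn u $ 3 * dr u (e i) $ 3)) *\<^sub>R e i)"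
    unfolding ricci_normal_tangent_def ricci by (rule sharp_orthonormal_frame[OF r bil lin3 e])
  have shape: "shape_operator g r n u v = (\<Sum>i\<in>UNIV. II u v (e i) *\<^sub>R e i)" for v
    unfolding shape_operator_def tangent_part_def frame_nabla_normal[OF u]
    by (rule sharp_orthonormal_frame[OF r bil linear_II[OF u] e])
  have IIl: "II u (a *\<^sub>R v + b *\<^sub>R w) x = a * II u v x + b * II u w x" for a b v w x
  proof -
    have "linear (con u)"
      using linear_add[OF linear_dr[OF u]] linear_cmul[OF linear_dr[OF u]]
      by (auto intro!: linearI simp: con_def frame_connection_def vec_eq_iff forall_3 algebra_simps)
    moreover have "linear (frechet_derivative nn (at u))"
      by (rule has_derivative_linear[OF nn_has_derivative[OF u]])
    ultimately show ?thesis
      by (simp add: II_def linear_add linear_cmul cross_add_left cross_mult_left inner_add_left algebra_simps)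
  qed
  define c where "c k = 2 * (exterior H u (e 1) * II u (e 1) (e k) + exterior H u (e 2) * II u (e 2) (e k))
     + H u * exterior H u (e k) - 2 * H u * ((4 * \<tau>\<^sup>2 - \<kappa>) * (nn u $ 3 * dr u (e k) $ 3))" for k
  have "c 1 *\<^sub>R e 1 + c 2 *\<^sub>R e 2 = 0"
    using bi unfolding biconservative_at_def Let_def gr ric shape IIl c_def
    by (simp add: sum_2 algebra_simps)
  then have "dr u (c 1 *\<^sub>R e 1 + c 2 *\<^sub>R e 2) = 0" using linear_0[OF linear_dr[OF u]] by simp
  then have "(c 1 *\<^sub>R dr u (e 1) + c 2 *\<^sub>R dr u (e 2)) \<bullet> dr u (e k) = 0" for k
    using linear_add[OF linear_dr[OF u]] linear_cmul[OF linear_dr[OF u]] by simp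
  then have z: "c 1 * (if 1 = k then 1 else 0) + c 2 * (if 2 = k then 1 else 0) = 0" for k :: 2
    using e unfolding orthonormal_frame_dr[OF u] by (simp add: inner_add_left)
  have "c k = 0" for k
    using z[of 1] z[of 2] exhaust_2[of k] by auto
  then show ?thesis by (simp add: c_def)
qed

text \<open>The normal is then constant in the frame, so the shape operator comes from the connection form alone,
  and that contribution is skew on the horizontal plane: its trace vanishes.\<close>

lemma vertical_normal_minimal:
  assumes "\<And>u. u \<in> D \<Longrightarrow> nn u $ 3 = \<epsilon>" "\<epsilon>\<^sup>2 = 1" "u \<in> D"
  shows "H u = 0"
proof -
  have nn: "nn x = vector [0, 0, \<epsilon>]" if "x \<in> D" for x
    using nn_unit[OF that] assms(1)[OF that] assms(2)
    by (simp add: vec_eq_iff forall_3 inner_vec_def sum_3 power2_eq_square sum_squares_eq_zero_iff)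
  have d: "frechet_derivative nn (at u) v = 0" for v
    using frechet_derivative_cong_open[OF open_D assms(3) nn] by (simp add: frechet_derivative_const)
  obtain e where e: "orthonormal_frame g r u e" "dr u (e 1) = vector [1, 0, 0]" "dr u (e 2) = vector [0, 1, 0]"
    by (rule frame_vectors[OF assms(3), of "vector [1, 0, 0]" "vector [0, 1, 0]"])
      (simp_all add: nn[OF assms(3)] inner_vec_def sum_3)
  show ?thesis
    unfolding mean_curvature_frame[OF assms(3) e(1)] II_def d con_def e nn[OF assms(3)] frame_connection_def
    by (simp add: cross3_def inner_vec_def sum_3)
qed

end

context surface_patch
begin

section \<open>Structure equations\<close>

abbreviation "X u \<equiv> r u $ 1"
abbreviation "Y u \<equiv> r u $ 2"
definition I :: "real^2 \<Rightarrow> real" where "I u = inverse (bcv_F \<kappa> (r u $ 1) (r u $ 2))"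

text \<open>The connection form of the base metric.\<close>

definition chi :: "real^2 \<Rightarrow> real^2 \<Rightarrow> real" where
  "chi u v = \<kappa> / 2 * (Y u * dr u v $ 1 - X u * dr u v $ 2)"

lemma smooth_r_component: "smooth_on D (\<lambda>u. r u $ i)"
  by (rule smooth_on_component[OF open_D smooth_r])

lemma exterior_component: "u \<in> D \<Longrightarrow> exterior (\<lambda>u. r u $ i) u v = frechet_derivative r (at u) v $ i"
  by (subst exterior_eqI[OF has_derivative_component[OF r_deriv]]) auto

lemma dr_1: "u \<in> D \<Longrightarrow> dr u v $ 1 = I u * exterior X u v"
  and dr_2: "u \<in> D \<Longrightarrow> dr u v $ 2 = I u * exterior Y u v"
  and dr_3: "u \<in> D \<Longrightarrow> dr u v $ 3 = exterior (\<lambda>u. r u $ 3) u v + \<tau> * (Y u * dr u v $ 1 - X u * dr u v $ 2)"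
  by (simp_all add: dr_def frame_of_def Let_def exterior_component I_def divide_inverse[of _ "bcv_F _ _ _"] algebra_simps)

lemma smooth_I: "smooth_on D I"
proof -
  have "1 + \<kappa> / 4 * ((X u)\<^sup>2 + (Y u)\<^sup>2) \<noteq> 0" if "u \<in> D" for u
    using r_in[OF that] by (simp add: bcv_domain_def bcv_F_def)
  then have "smooth_on D (\<lambda>u. 1 / bcv_F \<kappa> (r u $ 1) (r u $ 2))"
    unfolding bcv_F_def by (intro smooth_on_intros[OF open_D] smooth_r)
  then show ?thesis by (simp add: I_def[abs_def] divide_inverse)
qed

lemma exterior_I: "u \<in> D \<Longrightarrow> exterior I u v = - (\<kappa> / 2 * (X u * exterior X u v + Y u * exterior Y u v)) * (I u)\<^sup>2"
proof -
  assume u: "u \<in> D"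
  interpret bcv_point \<kappa> \<tau> "r u" by (rule point[OF u])
  have "(I has_derivative dI \<circ> frechet_derivative r (at u)) (at u)"
    using diff_chain_at[OF r_deriv[OF u] inverse_F_has_derivative] by (simp add: o_def I_def[abs_def])
  then show ?thesis
    by (simp add: exterior_eqI dI_def exterior_component[OF u] I_def power_inverse
        divide_inverse[of _ "(bcv_F _ _ _)\<^sup>2"])
qed

lemma smooth_dr: "smooth_form D (\<lambda>u v. dr u v $ i)"
proof -
  have 12: "smooth_form D (\<lambda>u v. I u * exterior (\<lambda>u. r u $ i) u v)" for i
    by (intro smooth_form_intros[OF open_D] smooth_I smooth_r_component)
  have cong: "smooth_form D \<alpha> \<Longrightarrow> (\<And>u v. u \<in> D \<Longrightarrow> \<alpha> u v = \<beta> u v) \<Longrightarrow> smooth_form D \<beta>" for \<alpha> \<beta>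
    unfolding smooth_form_def using smooth_on_cong[OF open_D] by metis
  have 1: "smooth_form D (\<lambda>u v. dr u v $ 1)" by (rule cong[OF 12[of 1]]) (simp add: dr_1)
  have 2: "smooth_form D (\<lambda>u v. dr u v $ 2)" by (rule cong[OF 12[of 2]]) (simp add: dr_2)
  have "smooth_form D (\<lambda>u v. exterior (\<lambda>u. r u $ 3) u v + \<tau> * (Y u * dr u v $ 1 - X u * dr u v $ 2))"
    by (intro smooth_form_intros[OF open_D] smooth_r_component 1 2)
  then have 3: "smooth_form D (\<lambda>u v. dr u v $ 3)" by (rule cong) (simp add: dr_3)
  show ?thesis using exhaust_3[of i] 1 2 3 by auto
qed

lemma smooth_chi: "smooth_form D chi"
  unfolding chi_def[abs_def] by (intro smooth_form_intros[OF open_D] smooth_r_component smooth_dr)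

text \<open>The pulled-back structure equations \<open>d\<omega>\<^sub>1 = \<chi> \<and> \<omega>\<^sub>2\<close>, \<open>d\<omega>\<^sub>2 = - \<chi> \<and> \<omega>\<^sub>1\<close>, \<open>d\<omega>\<^sub>3 = - 2 \<tau> \<omega>\<^sub>1 \<and> \<omega>\<^sub>2\<close> and
  \<open>d\<chi> = - \<kappa> \<omega>\<^sub>1 \<and> \<omega>\<^sub>2\<close>; the last one says that the base has curvature \<open>\<kappa>\<close>. The last two have the same
  origin, the rotation form \<open>(y dx - x dy) / F\<close>.\<close>

lemma curl_1: assumes u: "u \<in> D"
  shows "curl (\<lambda>u v. dr u v $ 1) u = wedge chi (\<lambda>u v. dr u v $ 2) u"
proof -
  have "curl (\<lambda>u v. dr u v $ 1) u = curl (\<lambda>u v. I u * exterior X u v) u"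
    by (rule curl_cong[OF open_D u]) (simp add: dr_1)
  also have "\<dots> = wedge (exterior I) (exterior X) u"
    by (simp add: curl_mult[OF smooth_I smooth_form_exterior u] smooth_r_component curl_exterior[OF open_D _ u])
  also have "\<dots> = wedge chi (\<lambda>u v. dr u v $ 2) u"
    using u by (simp add: wedge_def exterior_I chi_def dr_1 dr_2 power2_eq_square field_simps)
  finally show ?thesis .
qed

lemma curl_2: assumes u: "u \<in> D"
  shows "curl (\<lambda>u v. dr u v $ 2) u = - wedge chi (\<lambda>u v. dr u v $ 1) u"
proof -
  have "curl (\<lambda>u v. dr u v $ 2) u = curl (\<lambda>u v. I u * exterior Y u v) u"
    by (rule curl_cong[OF open_D u]) (simp add: dr_2)
  also have "\<dots> = wedge (exterior I) (exterior Y) u"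
    by (simp add: curl_mult[OF smooth_I smooth_form_exterior u] smooth_r_component curl_exterior[OF open_D _ u])
  also have "\<dots> = - wedge chi (\<lambda>u v. dr u v $ 1) u"
    using u by (simp add: wedge_def exterior_I chi_def dr_1 dr_2 power2_eq_square field_simps)
  finally show ?thesis .
qed

lemma curl_rotation: assumes u: "u \<in> D"
  shows "curl (\<lambda>u v. c * (Y u * dr u v $ 1 - X u * dr u v $ 2)) u
    = - 2 * c * wedge (\<lambda>u v. dr u v $ 1) (\<lambda>u v. dr u v $ 2) u"
proof -
  interpret bcv_point \<kappa> \<tau> "r u" by (rule point[OF u])
  have I: "I u * (4 + \<kappa> * ((X u)\<^sup>2 + (Y u)\<^sup>2)) = 4"
    using F_nz by (simp add: I_def bcv_F_def field_simps)
  then have key: "c * I u * (exterior X u v * exterior Y u w - exterior Y u v * exterior X u w)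
      * (4 - I u * (4 + \<kappa> * ((X u)\<^sup>2 + (Y u)\<^sup>2))) = 0" for v w by simp
  have sf: "smooth_form D (\<lambda>u v. r u $ i * dr u v $ j)" for i j
    by (intro smooth_form_intros[OF open_D] smooth_r_component smooth_dr)
  have "curl (\<lambda>u v. c * (Y u * dr u v $ 1 - X u * dr u v $ 2)) u =
     c * ((wedge (exterior Y) (\<lambda>u v. dr u v $ 1) u + Y u * wedge chi (\<lambda>u v. dr u v $ 2) u)
        - (wedge (exterior X) (\<lambda>u v. dr u v $ 2) u - X u * wedge chi (\<lambda>u v. dr u v $ 1) u))"
    by (simp add: curl_cmult[OF smooth_form_diff[OF open_D sf sf] u] curl_diff[OF sf sf u] curl_mult[OF smooth_r_component smooth_dr u] curl_1[OF u] curl_2[OF u])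
  also have "\<dots> = - 2 * c * wedge (\<lambda>u v. dr u v $ 1) (\<lambda>u v. dr u v $ 2) u"
    using key[of "axis 1 1" "axis 2 1"] u
    by (simp add: wedge_def chi_def dr_1 dr_2 power2_eq_square field_simps)
  finally show ?thesis .
qed

lemma curl_chi: "u \<in> D \<Longrightarrow> curl chi u = - \<kappa> * wedge (\<lambda>u v. dr u v $ 1) (\<lambda>u v. dr u v $ 2) u"
  using curl_rotation[of u "\<kappa> / 2"] by (simp add: chi_def[abs_def])

lemma curl_3: assumes u: "u \<in> D"
  shows "curl (\<lambda>u v. dr u v $ 3) u = - 2 * \<tau> * wedge (\<lambda>u v. dr u v $ 1) (\<lambda>u v. dr u v $ 2) u"
proof -
  have "curl (\<lambda>u v. dr u v $ 3) u
    = curl (\<lambda>u v. exterior (\<lambda>u. r u $ 3) u v + \<tau> * (Y u * dr u v $ 1 - X u * dr u v $ 2)) u"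
    by (rule curl_cong[OF open_D u]) (simp add: dr_3)
  also have "\<dots> = - 2 * \<tau> * wedge (\<lambda>u v. dr u v $ 1) (\<lambda>u v. dr u v $ 2) u"
    by (subst curl_add[OF smooth_form_exterior[OF smooth_r_component] _ u],
        (intro smooth_form_intros[OF open_D] smooth_r_component smooth_dr)[1])
      (simp add: curl_exterior[OF open_D smooth_r_component u] curl_rotation[OF u])
  finally show ?thesis .
qed

lemma smooth_nn: "smooth_on D (\<lambda>u. nn u $ i)"
proof -
  have n: "smooth_on D (\<lambda>u. n u $ i)" for i by (rule smooth_on_component[OF open_D smooth_n])
  have "smooth_on D (\<lambda>u. n u $ 1 * I u)" "smooth_on D (\<lambda>u. n u $ 2 * I u)"
    "smooth_on D (\<lambda>u. n u $ 3 + \<tau> * (Y u * n u $ 1 - X u * n u $ 2) * I u)"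
    by (intro smooth_on_intros[OF open_D] n smooth_I smooth_r_component)+
  then show ?thesis
    using exhaust_3[of i] by (auto simp: nn_def[abs_def] frame_of_def Let_def I_def[abs_def]
        divide_inverse[of _ "bcv_F _ _ _"])
qed

end

text \<open>Evaluation of \<open>\<alpha> \<and> \<beta>\<close> on a pair of vectors multiplies its coefficient by their determinant; this turns
  relations between coefficients into relations between values on an adapted basis.\<close>

lemma linear_forms_det:
  fixes \<alpha> \<beta> :: "real^2 \<Rightarrow> real"
  assumes "linear \<alpha>" "linear \<beta>"
  shows "\<alpha> a * \<beta> b - \<alpha> b * \<beta> a = (a$1 * b$2 - a$2 * b$1) *
    (\<alpha> (axis 1 1) * \<beta> (axis 2 1) - \<alpha> (axis 2 1) * \<beta> (axis 1 1))"
proof -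
  have "\<gamma> v = v$1 * \<gamma> (axis 1 1) + v$2 * \<gamma> (axis 2 1)" if "linear \<gamma>" for \<gamma> :: "real^2 \<Rightarrow> real" and v
    by (subst vec_sum_axis[of v]) (simp add: sum_2 linear_add[OF that] linear_cmul[OF that])
  note this[OF assms(1), of a] this[OF assms(2), of a] this[OF assms(1), of b] this[OF assms(2), of b]
  then show ?thesis by (simp add: algebra_simps)
qed

section \<open>Surfaces of constant angle\<close>

locale helix_patch = surface_patch +
  fixes \<nu> s :: real
  assumes angle: "\<And>u. u \<in> D \<Longrightarrow> nn u $ 3 = \<nu>" and s: "s > 0" "s\<^sup>2 + \<nu>\<^sup>2 = 1"
begin

text \<open>The normal is \<open>(s m, \<nu>)\<close> with a unit vector field \<open>m\<close> in the plane. The tangent frame consists of the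
  direction \<open>E\<^sub>1 = (E\<^sub>3 - \<nu> N) / s\<close> of the tangential part of the Hopf field and the horizontal vector \<open>E\<^sub>2\<close>,
  with dual coframe \<open>\<beta>\<^sub>1\<close>, \<open>\<beta>\<^sub>2\<close>. The form \<open>\<Theta>\<close> measures the rotation of \<open>m\<close> with respect to the connection of
  the base.\<close>

definition "m1 u = nn u $ 1 / s"
definition "m2 u = nn u $ 2 / s"

definition E1 :: "real^2 \<Rightarrow> real^3" where "E1 u = vector [- \<nu> * m1 u, - \<nu> * m2 u, s]"
definition E2 :: "real^2 \<Rightarrow> real^3" where "E2 u = vector [- m2 u, m1 u, 0]"

definition "\<beta>1 u v = dr u v $ 3 / s"
definition "\<beta>2 u v = m1 u * dr u v $ 2 - m2 u * dr u v $ 1"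
definition "\<Theta> u v = m1 u * exterior m2 u v - m2 u * exterior m1 u v + chi u v"

lemma nn_eq: "u \<in> D \<Longrightarrow> nn u = vector [s * m1 u, s * m2 u, \<nu>]"
  using s angle by (simp add: vec_eq_iff forall_3 m1_def m2_def)

lemma m_unit: "u \<in> D \<Longrightarrow> (m1 u)\<^sup>2 + (m2 u)\<^sup>2 = 1"
proof -
  assume "u \<in> D"
  from nn_unit[OF this] have "s\<^sup>2 * ((m1 u)\<^sup>2 + (m2 u)\<^sup>2) + \<nu>\<^sup>2 = s\<^sup>2 + \<nu>\<^sup>2"
    unfolding nn_eq[OF \<open>u \<in> D\<close>] s(2) by (simp add: inner_vec_def sum_3 power2_eq_square algebra_simps)
  then have "s\<^sup>2 * ((m1 u)\<^sup>2 + (m2 u)\<^sup>2) = s\<^sup>2 * 1" by simp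
  then show ?thesis using s(1) by (simp only: mult_cancel_left) auto
qed

lemma smooth_m1: "smooth_on D m1" and smooth_m2: "smooth_on D m2"
  unfolding m1_def[abs_def] m2_def[abs_def] using s
  by (auto intro!: smooth_on_divide[OF open_D] smooth_nn smooth_on_const)

text \<open>The derivative of a unit vector in the plane is a multiple of its quarter turn.\<close>

lemma dm: assumes u: "u \<in> D"
  shows "exterior m1 u v = - m2 u * (m1 u * exterior m2 u v - m2 u * exterior m1 u v)"
    and "exterior m2 u v = m1 u * (m1 u * exterior m2 u v - m2 u * exterior m1 u v)"
proof -
  have "exterior (\<lambda>u. m1 u * m1 u + m2 u * m2 u) u v = exterior (\<lambda>u. 1) u v"
    using exterior_cong[OF open_D u] m_unit by (metis (no_types, lifting) power2_eq_square)
  then have *: "m1 u * exterior m1 u v + m2 u * exterior m2 u v = 0"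
    using smooth_on_mult[OF open_D smooth_m1 smooth_m1] smooth_on_mult[OF open_D smooth_m2 smooth_m2] u
    by (simp add: exterior_add exterior_mult[OF smooth_m1 smooth_m1 u] exterior_mult[OF smooth_m2 smooth_m2 u] algebra_simps)
  show "exterior m1 u v = - m2 u * (m1 u * exterior m2 u v - m2 u * exterior m1 u v)"
    using * m_unit[OF u] by algebra
  show "exterior m2 u v = m1 u * (m1 u * exterior m2 u v - m2 u * exterior m1 u v)"
    using * m_unit[OF u] by algebra
qed

lemma tangency: "u \<in> D \<Longrightarrow> m1 u * dr u v $ 1 + m2 u * dr u v $ 2 = - \<nu> * \<beta>1 u v"
  using nn_normal[of u v] s by (simp add: nn_eq inner_vec_def sum_3 \<beta>1_def field_simps)

lemma dr_eq: assumes u: "u \<in> D" shows "dr u v = \<beta>1 u v *\<^sub>R E1 u + \<beta>2 u v *\<^sub>R E2 u"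
proof -
  have "dr u v $ 1 = \<beta>1 u v * (- \<nu> * m1 u) + \<beta>2 u v * (- m2 u)"
    using tangency[OF u, of v] m_unit[OF u] unfolding \<beta>2_def by algebra
  moreover have "dr u v $ 2 = \<beta>1 u v * (- \<nu> * m2 u) + \<beta>2 u v * m1 u"
    using tangency[OF u, of v] m_unit[OF u] unfolding \<beta>2_def by algebra
  moreover have "dr u v $ 3 = \<beta>1 u v * s" using s by (simp add: \<beta>1_def)
  ultimately show ?thesis by (simp add: vec_eq_iff forall_3 E1_def E2_def)
qed

lemma E_orthonormal: assumes u: "u \<in> D"
  shows "E1 u \<bullet> nn u = 0" "E2 u \<bullet> nn u = 0" "E1 u \<bullet> E1 u = 1" "E2 u \<bullet> E2 u = 1" "E1 u \<bullet> E2 u = 0"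
  unfolding E1_def E2_def nn_eq[OF u] inner_vec_def sum_3 using m_unit[OF u] s(2)
  by (simp_all, algebra+)

lemma adapted_frame:
  assumes "u \<in> D"
  obtains e where "orthonormal_frame g r u e" "dr u (e 1) = E1 u" "dr u (e 2) = E2 u"
  using frame_vectors[OF assms E_orthonormal[OF assms]] .

lemma beta_frame: assumes u: "u \<in> D"
  shows "dr u a = E1 u \<Longrightarrow> \<beta>1 u a = 1 \<and> \<beta>2 u a = 0" "dr u b = E2 u \<Longrightarrow> \<beta>1 u b = 0 \<and> \<beta>2 u b = 1"
  using m_unit[OF u] s(1) by (simp_all add: \<beta>1_def \<beta>2_def E1_def E2_def power2_eq_square)

lemma linear_forms: assumes u: "u \<in> D"
  shows "linear (\<lambda>v. dr u v $ i)" "linear (\<beta>1 u)" "linear (\<beta>2 u)" "linear (chi u)" "linear (\<Theta> u)"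
proof -
  show d: "linear (\<lambda>v. dr u v $ i)" for i
    using linear_add[OF linear_dr[OF u]] linear_cmul[OF linear_dr[OF u]] by (auto intro!: linearI)
  note l = linear_add[OF d] linear_cmul[OF d]
  show "linear (\<beta>1 u)" "linear (\<beta>2 u)" and c: "linear (chi u)"
    using s(1) by (auto intro!: linearI simp: l \<beta>1_def \<beta>2_def chi_def algebra_simps add_divide_distrib)
  have e: "linear (exterior m1 u)" "linear (exterior m2 u)"
    using exterior_has_derivative[OF smooth_m1 u] exterior_has_derivative[OF smooth_m2 u] has_derivative_linear by auto
  show "linear (\<Theta> u)"
    by (auto intro!: linearI simp: linear_add[OF e(1)] linear_add[OF e(2)] linear_cmul[OF e(1)] linear_cmul[OF e(2)]
        linear_add[OF c] linear_cmul[OF c] \<Theta>_def algebra_simps)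
qed

lemma nn_derivative: assumes u: "u \<in> D"
  shows "frechet_derivative nn (at u) v = vector [s * exterior m1 u v, s * exterior m2 u v, 0]"
proof -
  have "frechet_derivative nn (at u) = frechet_derivative (\<lambda>u. vector [s * m1 u, s * m2 u, \<nu>]) (at u)"
    by (rule frechet_derivative_cong_open[OF open_D u nn_eq])
  also have "\<dots> = (\<lambda>v. vector [s * exterior m1 u v, s * exterior m2 u v, 0])"
    by (rule frechet_eqI[OF has_derivative_vector_3[OF has_derivative_mult_right has_derivative_mult_right
        has_derivative_const]])
      (auto intro!: exterior_has_derivative smooth_m1 smooth_m2 u)
  finally show ?thesis by simp
qed

lemma con_eq: "con u v = vector [\<tau> * dr u v $ 1, \<tau> * dr u v $ 2, chi u v - \<tau> * dr u v $ 3]"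
  by (simp add: con_def frame_connection_def chi_def)

lemma II_E1: assumes u: "u \<in> D" and a: "dr u a = E1 u"
  shows "II u v a = \<tau> * \<beta>2 u v"
proof -
  define V1 V2 V3 C where "V1 = dr u v $ 1" "V2 = dr u v $ 2" "V3 = dr u v $ 3" "C = chi u v"
  define A B where "A = exterior m1 u v" "B = exterior m2 u v"
  have AB: "A = - m2 u * (m1 u * B - m2 u * A)" "B = m1 u * (m1 u * B - m2 u * A)"
    using dm[OF u] by (simp_all add: A_B_def)
  have "II u v a = - (- \<nu> * m1 u * (s * A + (\<tau> * V2 * \<nu> - (C - \<tau> * V3) * (s * m2 u)))
     - \<nu> * m2 u * (s * B + ((C - \<tau> * V3) * (s * m1 u) - \<tau> * V1 * \<nu>))
     + s * (\<tau> * V1 * (s * m2 u) - \<tau> * V2 * (s * m1 u)))"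
    unfolding II_def nn_derivative[OF u] con_eq a E1_def nn_eq[OF u] V1_V2_V3_C_def A_B_def
    by (simp add: cross3_def inner_vec_def sum_3 algebra_simps)
  also have "\<dots> = \<tau> * (m1 u * V2 - m2 u * V1)"
    using AB m_unit[OF u] s(2) by algebra
  finally show ?thesis by (simp add: \<beta>2_def V1_V2_V3_C_def)
qed

lemma II_E2: assumes u: "u \<in> D" and a: "dr u a = E2 u"
  shows "II u v a = - s * \<Theta> u v + \<tau> * \<nu> * (m1 u * dr u v $ 1 + m2 u * dr u v $ 2) + \<tau> * s * dr u v $ 3"
proof -
  define V1 V2 V3 C where "V1 = dr u v $ 1" "V2 = dr u v $ 2" "V3 = dr u v $ 3" "C = chi u v"
  define A B where "A = exterior m1 u v" "B = exterior m2 u v"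
  have "II u v a = - (- m2 u * (s * A + (\<tau> * V2 * \<nu> - (C - \<tau> * V3) * (s * m2 u)))
     + m1 u * (s * B + ((C - \<tau> * V3) * (s * m1 u) - \<tau> * V1 * \<nu>)))"
    unfolding II_def nn_derivative[OF u] con_eq a E2_def nn_eq[OF u] V1_V2_V3_C_def A_B_def
    by (simp add: cross3_def inner_vec_def sum_3 algebra_simps)
  also have "\<dots> = - s * (m1 u * B - m2 u * A + C) + \<tau> * \<nu> * (m1 u * V1 + m2 u * V2) + \<tau> * s * V3"
    using m_unit[OF u] by algebra
  finally show ?thesis by (simp add: \<Theta>_def V1_V2_V3_C_def A_B_def)
qed

lemma smooth_beta: "smooth_form D \<beta>1" "smooth_form D \<beta>2" "smooth_form D \<Theta>"
proof -
  have "smooth_form D (\<lambda>u v. 1 / s * dr u v $ 3)" by (rule smooth_form_cmult[OF open_D smooth_dr])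
  then show "smooth_form D \<beta>1" by (simp add: \<beta>1_def[abs_def])
  show "smooth_form D \<beta>2" "smooth_form D \<Theta>"
    unfolding \<beta>2_def[abs_def] \<Theta>_def[abs_def]
    by (intro smooth_form_intros[OF open_D] smooth_dr smooth_m1 smooth_m2 smooth_chi)+
qed

lemma wedge_12: assumes u: "u \<in> D"
  shows "wedge (\<lambda>u v. dr u v $ 1) (\<lambda>u v. dr u v $ 2) u = - \<nu> * wedge \<beta>1 \<beta>2 u"
proof -
  have 1: "dr u v $ 1 = \<beta>1 u v * (- \<nu> * m1 u) + \<beta>2 u v * (- m2 u)"
    and 2: "dr u v $ 2 = \<beta>1 u v * (- \<nu> * m2 u) + \<beta>2 u v * m1 u" for v
    using dr_eq[OF u, of v] by (simp_all add: E1_def E2_def)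
  show ?thesis unfolding wedge_def 1 2 using m_unit[OF u] by algebra
qed

lemma curl_beta1: assumes u: "u \<in> D" shows "curl \<beta>1 u = 2 * \<tau> * \<nu> / s * wedge \<beta>1 \<beta>2 u"
proof -
  have "curl \<beta>1 u = 1 / s * curl (\<lambda>u v. dr u v $ 3) u"
    using curl_cmult[OF smooth_dr u, of "1 / s" 3] by (simp add: \<beta>1_def[abs_def])
  then show ?thesis by (simp add: curl_3[OF u] wedge_12[OF u])
qed

lemma curl_beta2: assumes u: "u \<in> D" shows "curl \<beta>2 u = \<nu> * wedge \<Theta> \<beta>1 u"
proof -
  have sf: "smooth_form D (\<lambda>u v. m1 u * dr u v $ i)" "smooth_form D (\<lambda>u v. m2 u * dr u v $ i)" for i
    by (intro smooth_form_intros[OF open_D] smooth_m1 smooth_m2 smooth_dr)+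
  have "curl \<beta>2 u = (wedge (exterior m1) (\<lambda>u v. dr u v $ 2) u - m1 u * wedge chi (\<lambda>u v. dr u v $ 1) u)
      - (wedge (exterior m2) (\<lambda>u v. dr u v $ 1) u + m2 u * wedge chi (\<lambda>u v. dr u v $ 2) u)"
    by (simp add: \<beta>2_def[abs_def] curl_diff[OF sf(1) sf(2) u] curl_mult[OF smooth_m1 smooth_dr u]
        curl_mult[OF smooth_m2 smooth_dr u] curl_1[OF u] curl_2[OF u])
  also have "\<dots> = - wedge \<Theta> (\<lambda>u v. m1 u * dr u v $ 1 + m2 u * dr u v $ 2) u"
    unfolding wedge_def \<Theta>_def
    using dm[OF u, of "axis 1 1"] dm[OF u, of "axis 2 1"] by algebra
  also have "\<dots> = \<nu> * wedge \<Theta> \<beta>1 u"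
    unfolding wedge_def tangency[OF u] by algebra
  finally show ?thesis .
qed

text \<open>Differentiating the tangency condition determines one component of \<open>\<Theta>\<close>.\<close>

lemma wedge_Theta_beta2: assumes u: "u \<in> D"
  shows "wedge \<Theta> \<beta>2 u = - (2 * \<tau> * \<nu>\<^sup>2 / s) * wedge \<beta>1 \<beta>2 u"
proof -
  have sf: "smooth_form D (\<lambda>u v. m1 u * dr u v $ i)" "smooth_form D (\<lambda>u v. m2 u * dr u v $ i)" for i
    by (intro smooth_form_intros[OF open_D] smooth_m1 smooth_m2 smooth_dr)+
  have "- \<nu> * curl \<beta>1 u = curl (\<lambda>u v. - \<nu> * \<beta>1 u v) u"
    by (simp only: curl_cmult[OF smooth_beta(1) u])
  also have "\<dots> = curl (\<lambda>u v. m1 u * dr u v $ 1 + m2 u * dr u v $ 2) u"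
    by (rule curl_cong[OF open_D u]) (simp add: tangency)
  also have "\<dots> = (wedge (exterior m1) (\<lambda>u v. dr u v $ 1) u + m1 u * wedge chi (\<lambda>u v. dr u v $ 2) u)
      + (wedge (exterior m2) (\<lambda>u v. dr u v $ 2) u - m2 u * wedge chi (\<lambda>u v. dr u v $ 1) u)"
    by (simp add: curl_add[OF sf(1) sf(2) u] curl_mult[OF smooth_m1 smooth_dr u]
        curl_mult[OF smooth_m2 smooth_dr u] curl_1[OF u] curl_2[OF u])
  also have "\<dots> = wedge \<Theta> \<beta>2 u"
    unfolding wedge_def \<Theta>_def \<beta>2_def
    using dm[OF u, of "axis 1 1"] dm[OF u, of "axis 2 1"] by algebra
  finally show ?thesis by (simp add: curl_beta1[OF u] power2_eq_square mult.assoc mult.left_commute)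
qed

lemma curl_Theta: assumes u: "u \<in> D" shows "curl \<Theta> u = \<kappa> * \<nu> * wedge \<beta>1 \<beta>2 u"
proof -
  have sf: "smooth_form D (\<lambda>u v. m1 u * exterior m2 u v)" "smooth_form D (\<lambda>u v. m2 u * exterior m1 u v)"
    by (intro smooth_form_intros[OF open_D] smooth_m1 smooth_m2)+
  have "curl \<Theta> u = wedge (exterior m1) (exterior m2) u - wedge (exterior m2) (exterior m1) u + curl chi u"
    by (simp add: \<Theta>_def[abs_def] curl_add[OF smooth_form_diff[OF open_D sf] smooth_chi u] curl_diff[OF sf u]
        curl_mult[OF smooth_m1 smooth_form_exterior[OF smooth_m2] u]
        curl_mult[OF smooth_m2 smooth_form_exterior[OF smooth_m1] u]
        curl_exterior[OF open_D smooth_m1 u] curl_exterior[OF open_D smooth_m2 u])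
  moreover have "wedge (exterior m1) (exterior m2) u = 0" "wedge (exterior m2) (exterior m1) u = 0"
    unfolding wedge_def using dm[OF u, of "axis 1 1"] dm[OF u, of "axis 2 1"] by algebra+
  ultimately show ?thesis by (simp add: curl_chi[OF u] wedge_12[OF u])
qed

lemma wedge_beta_frame:
  assumes u: "u \<in> D" and a: "dr u a = E1 u" and b: "dr u b = E2 u" and lin: "linear (\<alpha> u)"
  shows "wedge \<alpha> \<beta>2 u = \<alpha> u a * wedge \<beta>1 \<beta>2 u"
    and "wedge \<alpha> \<beta>1 u = - \<alpha> u b * wedge \<beta>1 \<beta>2 u"
    and "wedge \<beta>1 \<beta>2 u \<noteq> 0"
proof -
  note ab = beta_frame(1)[OF u a] beta_frame(2)[OF u b]
  define t where "t = a$1 * b$2 - a$2 * b$1"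
  have 1: "1 = t * wedge \<beta>1 \<beta>2 u"
    using linear_forms_det[OF linear_forms(2,3)[OF u], of a b] ab by (simp add: wedge_def t_def)
  then have t: "t \<noteq> 0" by auto
  have "\<alpha> u a = t * wedge \<alpha> \<beta>2 u" "- \<alpha> u b = t * wedge \<alpha> \<beta>1 u"
    using linear_forms_det[OF lin linear_forms(3)[OF u], of a b] linear_forms_det[OF lin linear_forms(2)[OF u], of a b] ab
    by (simp_all add: wedge_def t_def)
  then show "wedge \<alpha> \<beta>2 u = \<alpha> u a * wedge \<beta>1 \<beta>2 u" "wedge \<alpha> \<beta>1 u = - \<alpha> u b * wedge \<beta>1 \<beta>2 u"
    using 1 by (auto simp: mult_ac)
  show "wedge \<beta>1 \<beta>2 u \<noteq> 0" using 1 by auto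
qed

text \<open>Since \<open>E\<^sub>1\<close> is an asymptotic direction, the mean curvature is the normal curvature in the direction \<open>E\<^sub>2\<close>.\<close>

lemma H_frame: assumes u: "u \<in> D" and b: "dr u b = E2 u"
  shows "H u = - s * \<Theta> u b"
proof -
  obtain e where e: "orthonormal_frame g r u e" "dr u (e 1) = E1 u" "dr u (e 2) = E2 u"
    using adapted_frame[OF u] .
  have "e 2 = b" using inj_dr[OF u] e(3) b by (metis injD)
  then have "H u = \<tau> * \<beta>2 u (e 1) + II u b b"
    using mean_curvature_frame[OF u e(1)] II_E1[OF u e(2)] by simp
  then show ?thesis
    using beta_frame(1)[OF u e(2)] by (simp add: II_E2[OF u b] b E2_def)
qed

text \<open>One component of \<open>\<Theta>\<close> is fixed by integrability, the other one is the mean curvature: \<open>\<Theta>\<close> carries all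
  the extrinsic geometry of a surface of constant angle.\<close>

lemma Theta_eq: assumes u: "u \<in> D"
  shows "\<Theta> u v = - (2 * \<tau> * \<nu>\<^sup>2 / s) * \<beta>1 u v - H u / s * \<beta>2 u v"
proof -
  obtain e where e: "orthonormal_frame g r u e" "dr u (e 1) = E1 u" "dr u (e 2) = E2 u"
    using adapted_frame[OF u] .
  note w = wedge_beta_frame[where \<alpha> = \<Theta>, OF u e(2,3) linear_forms(5)[OF u]]
  have "\<Theta> u (e 1) * wedge \<beta>1 \<beta>2 u = - (2 * \<tau> * \<nu>\<^sup>2 / s) * wedge \<beta>1 \<beta>2 u"
    by (simp only: w(1)[symmetric] wedge_Theta_beta2[OF u])
  then have "\<Theta> u (e 1) = - (2 * \<tau> * \<nu>\<^sup>2 / s)"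
    using mult_right_cancel[OF w(3)] by blast
  moreover have "\<Theta> u (e 2) = - H u / s" using H_frame[OF u e(3)] s(1) by simp
  moreover have "dr u v = dr u (\<beta>1 u v *\<^sub>R e 1 + \<beta>2 u v *\<^sub>R e 2)"
    by (simp add: linear_add[OF linear_dr[OF u]] linear_cmul[OF linear_dr[OF u]] e dr_eq[OF u, of v])
  then have v: "v = \<beta>1 u v *\<^sub>R e 1 + \<beta>2 u v *\<^sub>R e 2" using inj_dr[OF u] by (metis injD)
  have "\<Theta> u v = \<beta>1 u v * \<Theta> u (e 1) + \<beta>2 u v * \<Theta> u (e 2)"
    by (subst v) (simp add: linear_add[OF linear_forms(5)[OF u]] linear_cmul[OF linear_forms(5)[OF u]])
  ultimately show ?thesis by (simp add: mult.commute)
qed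

text \<open>A priori the mean curvature is a trace of an operator defined pointwise; as a component of the smooth
  form \<open>\<Theta>\<close> it is seen to be smooth.\<close>

lemma smooth_H: "smooth_on D H"
proof -
  have nz: "wedge \<beta>1 \<beta>2 u \<noteq> 0" and eq: "s * wedge \<Theta> \<beta>1 u / wedge \<beta>1 \<beta>2 u = H u" if u: "u \<in> D" for u
  proof -
    obtain e where e: "orthonormal_frame g r u e" "dr u (e 1) = E1 u" "dr u (e 2) = E2 u"
      using adapted_frame[OF u] .
    note w = wedge_beta_frame[where \<alpha> = \<Theta>, OF u e(2,3) linear_forms(5)[OF u]]
    show "wedge \<beta>1 \<beta>2 u \<noteq> 0" by (rule w(3))
    then show "s * wedge \<Theta> \<beta>1 u / wedge \<beta>1 \<beta>2 u = H u"
      unfolding w(2) using H_frame[OF u e(3)] by simp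
  qed
  have sm: "smooth_on D (\<lambda>u. \<beta>1 u v)" "smooth_on D (\<lambda>u. \<beta>2 u v)" "smooth_on D (\<lambda>u. \<Theta> u v)" for v
    using smooth_beta unfolding smooth_form_def by auto
  have "smooth_on D (\<lambda>u. s * wedge \<Theta> \<beta>1 u / wedge \<beta>1 \<beta>2 u)"
    unfolding wedge_def
    by (intro smooth_on_intros[OF open_D] sm) (use nz in \<open>auto simp: wedge_def\<close>)
  then show ?thesis by (rule smooth_on_cong[OF open_D eq, rotated])
qed

text \<open>The Riccati equation: the curvature of the base, expressed through \<open>d\<Theta>\<close>, governs the change of
  the mean curvature along the projection of the Hopf field.\<close>

lemma riccati: assumes u: "u \<in> D" and a: "dr u a = E1 u"
  shows "exterior H u a = - (\<nu> / s) * ((H u)\<^sup>2 + \<kappa> * s\<^sup>2 + 4 * \<tau>\<^sup>2 * \<nu>\<^sup>2)"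
proof -
  obtain b where b: "dr u b = E2 u" using adapted_frame[OF u] by metis
  have sf: "smooth_form D (\<lambda>u v. (- (2 * \<tau> * \<nu>\<^sup>2 / s)) * \<beta>1 u v)" "smooth_form D (\<lambda>u v. 1 / s * (H u * \<beta>2 u v))"
     "smooth_form D (\<lambda>u v. H u * \<beta>2 u v)"
    by (intro smooth_form_intros[OF open_D] smooth_beta smooth_H)+
  have "\<kappa> * \<nu> * wedge \<beta>1 \<beta>2 u = curl (\<lambda>u v. (- (2 * \<tau> * \<nu>\<^sup>2 / s)) * \<beta>1 u v - 1 / s * (H u * \<beta>2 u v)) u"
    unfolding curl_Theta[OF u, symmetric] by (rule curl_cong[OF open_D u]) (simp add: Theta_eq)
  also have "\<dots> = - (2 * \<tau> * \<nu>\<^sup>2 / s) * (2 * \<tau> * \<nu> / s * wedge \<beta>1 \<beta>2 u)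
      - 1 / s * (wedge (exterior H) \<beta>2 u + H u * (\<nu> * wedge \<Theta> \<beta>1 u))"
    by (simp only: curl_diff[OF sf(1,2) u] curl_cmult[OF smooth_beta(1) u] curl_cmult[OF sf(3) u]
        curl_mult[OF smooth_H smooth_beta(2) u] curl_beta1[OF u] curl_beta2[OF u])
  also have "wedge (exterior H) \<beta>2 u = exterior H u a * wedge \<beta>1 \<beta>2 u"
    using wedge_beta_frame(1)[OF u a b, of "exterior H"] exterior_has_derivative[OF smooth_H u] has_derivative_linear by blast
  also have "wedge \<Theta> \<beta>1 u = H u / s * wedge \<beta>1 \<beta>2 u"
    using wedge_beta_frame(2)[where \<alpha> = \<Theta>, OF u a b linear_forms(5)[OF u]] H_frame[OF u b] s(1) by simp
  finally have "wedge \<beta>1 \<beta>2 u * (\<kappa> * \<nu>) = wedge \<beta>1 \<beta>2 u * (- (2 * \<tau> * \<nu>\<^sup>2 / s) * (2 * \<tau> * \<nu> / s)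
      - 1 / s * (exterior H u a + H u * (\<nu> * (H u / s))))"
    by (simp add: algebra_simps)
  then have "\<kappa> * \<nu> = - (2 * \<tau> * \<nu>\<^sup>2 / s) * (2 * \<tau> * \<nu> / s) - 1 / s * (exterior H u a + H u * (\<nu> * (H u / s)))"
    using wedge_beta_frame(3)[where \<alpha> = \<Theta>, OF u a b linear_forms(5)[OF u]] by (simp only: mult_cancel_left) simp
  then show ?thesis using s(1) by (simp add: field_simps power2_eq_square)
qed

text \<open>In the frame \<open>E\<^sub>1\<close>, \<open>E\<^sub>2\<close> the shape operator has the rows \<open>(0, \<tau>)\<close> and \<open>(\<tau>, H)\<close>. The numbers \<open>h\<^sub>1\<close>, \<open>h\<^sub>2\<close> are
  the components of the gradient of \<open>H\<close>.\<close>

lemma biconservative_helix: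
  assumes u: "u \<in> D" and bi: "biconservative_at g r n u"
  obtains h1 h2 where "\<And>v. exterior H u v = h1 * \<beta>1 u v + h2 * \<beta>2 u v"
    "s * h1 = - \<nu> * ((H u)\<^sup>2 + \<kappa> * s\<^sup>2 + 4 * \<tau>\<^sup>2 * \<nu>\<^sup>2)"
    "2 * \<tau> * h2 + H u * h1 = 2 * H u * (4 * \<tau>\<^sup>2 - \<kappa>) * \<nu> * s" "2 * \<tau> * h1 + 3 * H u * h2 = 0"
proof -
  obtain e where e: "orthonormal_frame g r u e" "dr u (e 1) = E1 u" "dr u (e 2) = E2 u"
    using adapted_frame[OF u] .
  have linH: "linear (exterior H u)"
    using exterior_has_derivative[OF smooth_H u] has_derivative_linear by blast
  have dif: "H differentiable (at u)" by (rule smooth_on_differentiable[OF smooth_H u])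
  note bet = beta_frame(1)[OF u e(2)] beta_frame(2)[OF u e(3)]
  have II: "II u (e 1) (e 1) = 0" "II u (e 2) (e 1) = \<tau>" "II u (e 1) (e 2) = \<tau>" "II u (e 2) (e 2) = H u"
  proof -
    show "II u (e 1) (e 1) = 0" "II u (e 2) (e 1) = \<tau>" using II_E1[OF u e(2)] bet by auto
    have "II u (e 1) (e 2) = 2 * \<tau> * \<nu>\<^sup>2 + \<tau> * \<nu> * (- \<nu> * ((m1 u)\<^sup>2 + (m2 u)\<^sup>2)) + \<tau> * s * s"
      using s(1) bet by (simp add: II_E2[OF u e(3)] e(2) E1_def Theta_eq[OF u] power2_eq_square algebra_simps)
    also have "\<dots> = \<tau> * (s\<^sup>2 + \<nu>\<^sup>2)" unfolding m_unit[OF u] by (simp add: power2_eq_square algebra_simps)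
    finally show "II u (e 1) (e 2) = \<tau>" by (simp add: s(2))
    show "II u (e 2) (e 2) = H u" using H_frame[OF u e(3)] by (simp add: II_E2[OF u e(3)] e(3) E2_def)
  qed
  show ?thesis
  proof (rule that[of "exterior H u (e 1)" "exterior H u (e 2)"])
    fix v
    have "dr u v = dr u (\<beta>1 u v *\<^sub>R e 1 + \<beta>2 u v *\<^sub>R e 2)"
      by (simp add: linear_add[OF linear_dr[OF u]] linear_cmul[OF linear_dr[OF u]] e dr_eq[OF u, of v])
    then have v: "v = \<beta>1 u v *\<^sub>R e 1 + \<beta>2 u v *\<^sub>R e 2" using inj_dr[OF u] by (metis injD)
    show "exterior H u v = exterior H u (e 1) * \<beta>1 u v + exterior H u (e 2) * \<beta>2 u v"
      by (subst v) (simp add: linear_add[OF linH] linear_cmul[OF linH])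
  next
    show "s * exterior H u (e 1) = - \<nu> * ((H u)\<^sup>2 + \<kappa> * s\<^sup>2 + 4 * \<tau>\<^sup>2 * \<nu>\<^sup>2)"
      unfolding riccati[OF u e(2)] using s(1) by simp
    show "2 * \<tau> * exterior H u (e 2) + H u * exterior H u (e 1) = 2 * H u * (4 * \<tau>\<^sup>2 - \<kappa>) * \<nu> * s"
      using biconservative_frame[OF u e(1) dif bi, of 1]
      by (simp add: II angle[OF u] e(2) E1_def algebra_simps)
    show "2 * \<tau> * exterior H u (e 1) + 3 * H u * exterior H u (e 2) = 0"
      using biconservative_frame[OF u e(1) dif bi, of 2]
      by (simp add: II angle[OF u] e(3) E2_def algebra_simps)
  qed
qed

end

section \<open>Functions on immersed surfaces\<close>

context surface_patch
begin

text \<open>Unless the surface is horizontal at \<open>u\<close>, the first vector can be taken in the direction of the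
  tangential part of the Hopf field, so that its vertical component detects this part.\<close>

lemma orthonormal_frame_exists:
  assumes u: "u \<in> D"
  obtains e where "orthonormal_frame g r u e" "(nn u $ 3)\<^sup>2 \<noteq> 1 \<Longrightarrow> dr u (e 1) $ 3 \<noteq> 0"
proof (cases "(nn u $ 3)\<^sup>2 = 1")
  case True
  then have 0: "nn u $ 1 = 0" "nn u $ 2 = 0"
    using nn_unit[OF u] by (simp_all add: inner_vec_def sum_3 power2_eq_square[symmetric] sum_power2_eq_zero_iff)
  obtain e where "orthonormal_frame g r u e"
    by (rule frame_vectors[OF u, of "vector [1, 0, 0]" "vector [0, 1, 0]"])
      (simp_all add: 0 inner_vec_def sum_3)
  then show ?thesis using that True by blast
next
  case False
  define \<nu> where "\<nu> = nn u $ 3"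
  have un: "(nn u $ 1)\<^sup>2 + (nn u $ 2)\<^sup>2 + \<nu>\<^sup>2 = 1"
    using nn_unit[OF u] by (simp add: inner_vec_def sum_3 power2_eq_square \<nu>_def)
  have "1 - \<nu>\<^sup>2 > 0"
  proof -
    have "1 - \<nu>\<^sup>2 \<ge> 0" using un zero_le_power2[of "nn u $ 1"] zero_le_power2[of "nn u $ 2"] by linarith
    then show ?thesis using False by (simp add: \<nu>_def)
  qed
  define s where "s = sqrt (1 - \<nu>\<^sup>2)"
  have s: "s > 0" "s\<^sup>2 = 1 - \<nu>\<^sup>2" using \<open>1 - \<nu>\<^sup>2 > 0\<close> by (auto simp: s_def)
  define w1 w2 :: "real^3" where "w1 = vector [- \<nu> * nn u $ 1 / s, - \<nu> * nn u $ 2 / s, s]"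
    and "w2 = vector [- nn u $ 2 / s, nn u $ 1 / s, 0]"
  have "w1 \<bullet> nn u = \<nu> / s * (s\<^sup>2 - ((nn u $ 1)\<^sup>2 + (nn u $ 2)\<^sup>2))"
    using s(1) by (simp add: w1_def inner_vec_def sum_3 \<nu>_def field_simps power2_eq_square)
  then have o1: "w1 \<bullet> nn u = 0" using un s(2) by simp
  have "w1 \<bullet> w1 = \<nu>\<^sup>2 * ((nn u $ 1)\<^sup>2 + (nn u $ 2)\<^sup>2) / s\<^sup>2 + s\<^sup>2"
    using s(1) by (simp add: w1_def inner_vec_def sum_3 field_simps power2_eq_square)
  moreover have sq: "(nn u $ 1)\<^sup>2 + (nn u $ 2)\<^sup>2 = s\<^sup>2" using un s(2) by simp
  ultimately have o2: "w1 \<bullet> w1 = 1" using s \<open>1 - \<nu>\<^sup>2 > 0\<close> by auto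
  have "w2 \<bullet> w2 = ((nn u $ 1)\<^sup>2 + (nn u $ 2)\<^sup>2) / s\<^sup>2"
    by (simp add: w2_def inner_vec_def sum_3 power2_eq_square add_divide_distrib)
  then have o3: "w2 \<bullet> w2 = 1" using sq s(1) by simp
  have o4: "w2 \<bullet> nn u = 0" "w1 \<bullet> w2 = 0"
    by (simp_all add: w1_def w2_def inner_vec_def sum_3 field_simps)
  obtain e where "orthonormal_frame g r u e" "dr u (e 1) = w1"
    using frame_vectors[OF u o1 o4(1) o2 o3 o4(2)] by metis
  then show ?thesis using that s(1) by (simp add: w1_def)
qed

end

text \<open>The chain rule carries orthonormal frames to orthonormal frames and respects the second fundamental
  form.\<close>

lemma mean_curvature_reparametrization:
  assumes P: "surface_patch \<kappa> \<tau> D r n" and Q: "surface_patch \<kappa> \<tau> E r' n'"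
    and W: "open W" "u \<in> W" "W \<subseteq> D" and t: "t differentiable (at u)" "t u \<in> E"
    and r: "\<And>x. x \<in> W \<Longrightarrow> r x = r' (t x)" and n: "\<And>x. x \<in> W \<Longrightarrow> n x = n' (t x)"
  shows "mean_curvature (bcv_metric \<kappa> \<tau>) r n u = mean_curvature (bcv_metric \<kappa> \<tau>) r' n' (t u)"
proof -
  interpret P: surface_patch \<kappa> \<tau> D r n by fact
  interpret Q: surface_patch \<kappa> \<tau> E r' n' by fact
  have u: "u \<in> D" using W by auto
  define dt where "dt = frechet_derivative t (at u)"
  have dt: "(t has_derivative dt) (at u)" unfolding dt_def by (rule has_derivative_frechet[OF t(1)])
  have chain: "frechet_derivative f (at u) v = frechet_derivative g (at (t u)) (dt v)"
    if "\<And>x. x \<in> W \<Longrightarrow> f x = g (t x)" "(g has_derivative frechet_derivative g (at (t u))) (at (t u))"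
    for f g :: "real^2 \<Rightarrow> real^3" and v
  proof -
    have "frechet_derivative f (at u) = frechet_derivative (g \<circ> t) (at u)"
      by (rule frechet_derivative_cong_open[OF W(1,2)]) (simp add: that(1))
    then show ?thesis using frechet_eqI[OF diff_chain_at[OF dt that(2)]] by simp
  qed
  have dr: "P.dr u v = Q.dr (t u) (dt v)" for v
    unfolding P.dr_def Q.dr_def r[OF W(2)]
    using chain[OF r Q.r_deriv[OF t(2)]] by simp
  have "P.nn x = Q.nn (t x)" if "x \<in> W" for x
    by (simp add: P.nn_def Q.nn_def r n that)
  then have dn: "frechet_derivative P.nn (at u) v = frechet_derivative Q.nn (at (t u)) (dt v)" and nu: "P.nn u = Q.nn (t u)" for v
    using chain[OF _ Q.nn_has_derivative[OF t(2)]] W(2) by auto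
  have II: "P.II u v w = Q.II (t u) (dt v) (dt w)" for v w
    by (simp add: P.II_def Q.II_def dn dr nu P.con_def Q.con_def r[OF W(2)])
  obtain e where e: "orthonormal_frame (bcv_metric \<kappa> \<tau>) r u e"
    using P.orthonormal_frame_exists[OF u] .
  then have "orthonormal_frame (bcv_metric \<kappa> \<tau>) r' (t u) (\<lambda>i. dt (e i))"
    by (simp add: P.orthonormal_frame_dr[OF u] Q.orthonormal_frame_dr[OF t(2)] dr)
  then show ?thesis
    using P.mean_curvature_frame[OF u e] Q.mean_curvature_frame[OF t(2)] by (simp add: II)
qed

locale bcv_surface =
  fixes \<kappa> \<tau> :: real and M :: "'a::{t2_space,second_countable_topology} set"
    and \<A> :: "'a atlas" and \<phi> N :: "'a \<Rightarrow> real^3"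
  assumes surface: "bcv_immersed_surface \<kappa> \<tau> M \<A> \<phi> N" and connected: "connected M"
begin

abbreviation "gM \<equiv> bcv_metric \<kappa> \<tau>"

lemma chart:
  assumes "(D, x) \<in> \<A>"
  shows "open D" "openin (top_of_set M) (x ` D)" "\<exists>y. homeomorphism D (x ` D) x y" "x ` D \<subseteq> M"
  using surface assms unfolding bcv_immersed_surface_def oriented_surface_def by blast+

lemma in_chart:
  assumes "p \<in> M"
  obtains D x u where "(D, x) \<in> \<A>" "u \<in> D" "x u = p"
  using surface assms unfolding bcv_immersed_surface_def oriented_surface_def by blast

lemma patch: assumes "(D, x) \<in> \<A>" shows "surface_patch \<kappa> \<tau> D (\<phi> \<circ> x) (N \<circ> x)"
proof
  show "open D" using chart[OF assms] by simp
  have im: "immersion_in (bcv_domain \<kappa>) M \<A> \<phi>" and un: "unit_normal gM \<A> \<phi> N"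
    using surface unfolding bcv_immersed_surface_def by auto
  show "smooth_on D (\<phi> \<circ> x)" "\<And>u. u \<in> D \<Longrightarrow> inj (frechet_derivative (\<phi> \<circ> x) (at u))"
    using im assms unfolding immersion_in_def by auto
  show "\<And>u. u \<in> D \<Longrightarrow> (\<phi> \<circ> x) u \<in> bcv_domain \<kappa>"
    using im chart(4)[OF assms] unfolding immersion_in_def by auto
  show "smooth_on D (N \<circ> x)"
    "\<And>u. u \<in> D \<Longrightarrow> gM ((\<phi> \<circ> x) u) ((N \<circ> x) u) ((N \<circ> x) u) = 1"
    "\<And>u v. u \<in> D \<Longrightarrow> gM ((\<phi> \<circ> x) u) (frechet_derivative (\<phi> \<circ> x) (at u) v) ((N \<circ> x) u) = 0"
    using un assms unfolding unit_normal_def by auto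
qed

lemma open_chart_image:
  assumes "(D, x) \<in> \<A>" "open U" "U \<subseteq> D"
  shows "openin (top_of_set M) (x ` U)"
proof -
  obtain y where "homeomorphism D (x ` D) x y" using chart[OF assms(1)] by blast
  then have "openin (top_of_set (x ` D)) (x ` U)"
    by (rule homeomorphism_imp_open_map) (use assms in \<open>simp add: openin_open_eq chart\<close>)
  then show ?thesis using chart(2)[OF assms(1)] openin_trans by blast
qed

lemma continuous_on_surface:
  assumes "\<And>D x. (D, x) \<in> \<A> \<Longrightarrow> continuous_on D (h \<circ> x)"
  shows "continuous_on M h"
proof -
  have "\<exists>T. openin (top_of_set M) T \<and> p \<in> T \<and> continuous_on T h" if p: "p \<in> M" for p
  proof -
    obtain D x u where c: "(D, x) \<in> \<A>" "u \<in> D" "x u = p" using in_chart[OF p] .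
    obtain y where y: "homeomorphism D (x ` D) x y" using chart[OF c(1)] by blast
    have "continuous_on (x ` D) ((h \<circ> x) \<circ> y)"
      by (rule continuous_on_compose) (use y assms[OF c(1)] in \<open>auto simp: homeomorphism_def\<close>)
    then have "continuous_on (x ` D) h"
      by (rule continuous_on_eq) (use y in \<open>auto simp: homeomorphism_def\<close>)
    then show ?thesis using chart(2)[OF c(1)] c by blast
  qed
  then obtain T where T: "\<And>p. p \<in> M \<Longrightarrow> openin (top_of_set M) (T p) \<and> p \<in> T p \<and> continuous_on (T p) h"
    by metis
  show ?thesis
    unfolding continuous_on_eq_continuous_within
  proof
    fix p assume p: "p \<in> M"
    then obtain G where G: "open G" "T p = M \<inter> G" using T openin_open by metis
    have "continuous (at p within M \<inter> G) h"
      using T[OF p] G(2) by (simp add: continuous_on_eq_continuous_within)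
    then show "continuous (at p within M) h"
      using at_within_nhd[of p G M "M \<inter> G"] T[OF p] G by auto
  qed
qed

lemma locally_constant_on_surface:
  fixes h :: "'a \<Rightarrow> 'b::real_normed_vector"
  assumes "\<And>D x u. (D, x) \<in> \<A> \<Longrightarrow> u \<in> D \<Longrightarrow> ((h \<circ> x) has_derivative (\<lambda>_. 0)) (at u)"
  shows "h constant_on M"
proof (rule locally_constant_imp_constant[OF connected])
  fix p assume "p \<in> M"
  then obtain D x u where c: "(D, x) \<in> \<A>" "u \<in> D" "x u = p" using in_chart by blast
  obtain e where e: "e > 0" "ball u e \<subseteq> D" using chart(1)[OF c(1)] c(2) openE by blast
  have "\<exists>k. \<forall>w\<in>ball u e. (h \<circ> x) w = k"
  proof (rule has_derivative_zero_constant[OF convex_ball])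
    fix w assume "w \<in> ball u e"
    then show "(h \<circ> x has_derivative (\<lambda>_. 0)) (at w within ball u e)"
      using has_derivative_at_withinI[OF assms[OF c(1)]] e by blast
  qed
  then have "\<forall>q\<in>x ` ball u e. h q = h p" using c e by auto
  then show "\<exists>T. openin (top_of_set M) T \<and> p \<in> T \<and> (\<forall>q\<in>T. h q = h p)"
    using open_chart_image[OF c(1) open_ball e(2)] c e by (intro exI[of _ "x ` ball u e"]) auto
qed

text \<open>The mean curvature as a function on the surface; the choice of a parametrization is harmless by the
  reparametrization invariance.\<close>

definition mc :: "'a \<Rightarrow> real" where
  "mc p = (SOME f. \<exists>D x u. (D, x) \<in> \<A> \<and> u \<in> D \<and> x u = p \<and> f = mean_curvature gM (\<phi> \<circ> x) (N \<circ> x) u)"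

lemma mean_curvature_chart_independent:
  assumes x: "(D, x) \<in> \<A>" "u \<in> D" and y: "(E, y) \<in> \<A>" "v \<in> E" and eq: "x u = y v"
  shows "mean_curvature gM (\<phi> \<circ> x) (N \<circ> x) u = mean_curvature gM (\<phi> \<circ> y) (N \<circ> y) v"
proof -
  define W where "W = {u \<in> D. x u \<in> y ` E}"
  define t where "t = inv_into E y \<circ> x"
  obtain x' y' where hx: "homeomorphism D (x ` D) x x'" and hy: "homeomorphism E (y ` E) y y'"
    using chart[OF x(1)] chart[OF y(1)] by blast
  have inj: "inj_on y E" by (rule inj_on_inverseI[of E y']) (use hy in \<open>auto simp: homeomorphism_def\<close>)
  have "openin (top_of_set D) (D \<inter> x -` (y ` E))"
    by (rule continuous_openin_preimage[OF _ _ chart(2)[OF y(1)]])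
      (use hx chart(4)[OF x(1)] in \<open>auto simp: homeomorphism_def\<close>)
  moreover have "D \<inter> x -` (y ` E) = W" by (auto simp: W_def)
  ultimately have W: "open W" using chart(1)[OF x(1)] openin_open_eq by metis
  have uW: "u \<in> W" using x y eq by (auto simp: W_def)
  have "\<forall>(D, x)\<in>\<A>. \<forall>(E, y)\<in>\<A>. smooth_on {u\<in>D. x u \<in> y ` E} (inv_into E y \<circ> x)"
    using surface unfolding bcv_immersed_surface_def oriented_surface_def Let_def by fast
  from bspec[OF this x(1)] have "\<forall>(E, y)\<in>\<A>. smooth_on {u\<in>D. x u \<in> y ` E} (inv_into E y \<circ> x)"
    by simp
  from bspec[OF this y(1)] have "smooth_on W t"
    by (simp add: W_def t_def)
  then have t: "t differentiable (at u)" using uW smooth_on_differentiable by blast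
  have yt: "y (t w) = x w" if "w \<in> W" for w
    using that f_inv_into_f[of "x w" y E] by (simp add: W_def t_def)
  have "t u = v" using inj y eq by (simp add: t_def)
  then show ?thesis
    using mean_curvature_reparametrization[OF patch[OF x(1)] patch[OF y(1)] W uW _ t] y(2) yt
    by (auto simp: W_def)
qed

lemma mc_chart:
  assumes "(D, x) \<in> \<A>" "u \<in> D"
  shows "mean_curvature gM (\<phi> \<circ> x) (N \<circ> x) u = mc (x u)"
  unfolding mc_def
proof (rule someI2)
  show "\<exists>D' x' u'. (D', x') \<in> \<A> \<and> u' \<in> D' \<and> x' u' = x u \<and>
      mean_curvature gM (\<phi> \<circ> x) (N \<circ> x) u = mean_curvature gM (\<phi> \<circ> x') (N \<circ> x') u'"
    using assms by blast
next
  fix f assume "\<exists>D' x' u'. (D', x') \<in> \<A> \<and> u' \<in> D' \<and> x' u' = x u \<and> f = mean_curvature gM (\<phi> \<circ> x') (N \<circ> x') u'"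
  then show "mean_curvature gM (\<phi> \<circ> x) (N \<circ> x) u = f"
    using mean_curvature_chart_independent[OF assms] by metis
qed

lemma mean_curvature_all_charts:
  "(\<forall>(D, x)\<in>\<A>. \<forall>u\<in>D. mean_curvature gM (\<phi> \<circ> x) (N \<circ> x) u = f) \<longleftrightarrow> (\<forall>p\<in>M. mc p = f)"
    (is "?L \<longleftrightarrow> ?R")
proof
  assume L: ?L
  show ?R
  proof
    fix p assume "p \<in> M"
    then obtain D x u where c: "(D, x) \<in> \<A>" "u \<in> D" "x u = p" using in_chart by blast
    then have "mean_curvature gM (\<phi> \<circ> x) (N \<circ> x) u = f" using L by blast
    then show "mc p = f" using mc_chart[OF c(1,2)] c(3) by simp
  qed
next
  assume R: ?R
  show ?L
  proof clarify
    fix D x u assume c: "(D, x) \<in> \<A>" "u \<in> D"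
    then have "x u \<in> M" using chart(4) by blast
    then show "mean_curvature gM (\<phi> \<circ> x) (N \<circ> x) u = f" using R mc_chart[OF c] by simp
  qed
qed

lemma cmc_iff: "cmc_surface \<kappa> \<tau> \<A> \<phi> N \<longleftrightarrow> (\<exists>f. \<forall>p\<in>M. mc p = f)"
  unfolding cmc_surface_def mean_curvature_all_charts ..

lemma minimal_iff: "minimal_surface \<kappa> \<tau> \<A> \<phi> N \<longleftrightarrow> (\<forall>p\<in>M. mc p = 0)"
  unfolding minimal_surface_def mean_curvature_all_charts ..

definition normal_frame :: "'a \<Rightarrow> real^3" where "normal_frame p = frame_of \<kappa> \<tau> (\<phi> p) (N p)"

lemma nn_chart: "(D, x) \<in> \<A> \<Longrightarrow> surface_patch.nn \<kappa> \<tau> (\<phi> \<circ> x) (N \<circ> x) u = normal_frame (x u)"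
  using surface_patch.nn_def[OF patch] by (simp add: normal_frame_def)

lemma constant_angle_iff:
  "constant_angle_surface \<kappa> \<tau> M \<phi> N \<longleftrightarrow> (\<exists>\<nu>. \<forall>p\<in>M. normal_frame p $ 3 = \<nu>)"
proof -
  have g: "gM (\<phi> p) hopf_field (N p) = normal_frame p $ 3" for p
    by (simp add: bcv_metric_def hopf_field_def normal_frame_def frame_of_def Let_def axis_def)
  have bound: "normal_frame p $ 3 \<in> {-1..1}" if p: "p \<in> M" for p
  proof -
    obtain D x u where c: "(D, x) \<in> \<A>" "u \<in> D" "x u = p" using in_chart[OF p] .
    have "normal_frame p \<bullet> normal_frame p = 1"
      using surface_patch.nn_unit[OF patch[OF c(1)] c(2)] nn_chart[OF c(1)] c(3) by simp
    then have "norm (normal_frame p) = 1" by (simp add: norm_eq_1)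
    then show ?thesis using component_le_norm_cart[of "normal_frame p" 3] by auto
  qed
  show ?thesis
  proof
    assume "\<exists>\<nu>. \<forall>p\<in>M. normal_frame p $ 3 = \<nu>"
    then obtain \<nu> where \<nu>: "\<forall>p\<in>M. normal_frame p $ 3 = \<nu>" by blast
    show "constant_angle_surface \<kappa> \<tau> M \<phi> N"
    proof (cases "M = {}")
      case True
      then show ?thesis by (auto simp: constant_angle_surface_def intro: exI[of _ 0])
    next
      case False
      then obtain p where "p \<in> M" by blast
      then have "\<nu> \<in> {-1..1}" using \<nu> bound[of p] by simp
      then show ?thesis unfolding constant_angle_surface_def g
        using \<nu> by (intro bexI[of _ "arccos \<nu>"]) (auto simp: arccos_lbound arccos_ubound)
    qed
  qed (unfold constant_angle_surface_def g, metis)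
qed

lemma continuous_normal_frame: "continuous_on M (\<lambda>p. normal_frame p $ i)"
proof (rule continuous_on_surface)
  fix D x assume c: "(D, x) \<in> \<A>"
  show "continuous_on D ((\<lambda>p. normal_frame p $ i) \<circ> x)"
    using smooth_on_continuous[OF surface_patch.smooth_nn[OF patch[OF c]]] nn_chart[OF c]
    by (simp add: o_def)
qed

lemma continuous_phi: "continuous_on M (\<lambda>p. \<phi> p $ i)"
proof (rule continuous_on_surface)
  fix D x assume c: "(D, x) \<in> \<A>"
  show "continuous_on D ((\<lambda>p. \<phi> p $ i) \<circ> x)"
    using smooth_on_continuous[OF surface_patch.smooth_r_component[OF patch[OF c]]] by (simp add: o_def)
qed

lemma helix_patch:
  assumes "\<forall>p\<in>M. normal_frame p $ 3 = \<nu>" "s > 0" "s\<^sup>2 + \<nu>\<^sup>2 = 1" "(D, x) \<in> \<A>"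
  shows "helix_patch \<kappa> \<tau> D (\<phi> \<circ> x) (N \<circ> x) \<nu> s"
proof -
  interpret surface_patch \<kappa> \<tau> D "\<phi> \<circ> x" "N \<circ> x" by (rule patch[OF assms(4)])
  show ?thesis
  proof unfold_locales
    fix u assume "u \<in> D"
    then have "x u \<in> M" using chart(4)[OF assms(4)] by blast
    then show "nn u $ 3 = \<nu>" using assms(1) by (simp add: nn_chart[OF assms(4)])
  qed (use assms in auto)
qed

lemma vertical_minimal:
  assumes "\<forall>p\<in>M. normal_frame p $ 3 = \<epsilon>" "\<epsilon>\<^sup>2 = 1" "p \<in> M"
  shows "mc p = 0"
proof -
  obtain D x u where c: "(D, x) \<in> \<A>" "u \<in> D" "x u = p" using in_chart[OF assms(3)] .
  interpret surface_patch \<kappa> \<tau> D "\<phi> \<circ> x" "N \<circ> x" by (rule patch[OF c(1)])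
  have "mean_curvature gM (\<phi> \<circ> x) (N \<circ> x) u = 0"
    by (rule vertical_normal_minimal[of \<epsilon>]) (use assms c nn_chart[OF c(1)] chart(4)[OF c(1)] in auto)
  then show ?thesis using mc_chart c by auto
qed

end

section \<open>Constant angle and constant mean curvature\<close>

locale biconservative_bcv_surface = bcv_surface +
  assumes not_bundle: "\<kappa> \<noteq> 4 * \<tau>\<^sup>2" and not_minimal: "\<not> minimal_surface \<kappa> \<tau> \<A> \<phi> N"
    and biconservative: "biconservative_surface \<kappa> \<tau> \<A> \<phi> N"
begin

lemma bi: "(D, x) \<in> \<A> \<Longrightarrow> u \<in> D \<Longrightarrow> biconservative_at gM (\<phi> \<circ> x) (N \<circ> x) u"
  using biconservative unfolding biconservative_surface_def by auto

lemma M_nonempty: "M \<noteq> {}" using not_minimal by (auto simp: minimal_iff)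

text \<open>Constant mean curvature forces the Ricci term to vanish, so at each point the normal is
  horizontal or vertical; by connectedness one alternative holds throughout, and the vertical one
  would give a minimal surface.\<close>

lemma cmc_imp_horizontal_normal:
  assumes "\<forall>p\<in>M. mc p = f"
  shows "\<forall>p\<in>M. normal_frame p $ 3 = 0"
proof -
  have f: "f \<noteq> 0" using not_minimal assms by (auto simp: minimal_iff)
  have "normal_frame p $ 3 = 0 \<or> (normal_frame p $ 3)\<^sup>2 = 1" if p: "p \<in> M" for p
  proof (rule ccontr)
    assume *: "\<not> ?thesis"
    obtain D x u where c: "(D, x) \<in> \<A>" "u \<in> D" "x u = p" using in_chart[OF p] .
    interpret surface_patch \<kappa> \<tau> D "\<phi> \<circ> x" "N \<circ> x" by (rule patch[OF c(1)])
    have H: "H w = f" if "w \<in> D" for w using mc_chart[OF c(1) that] assms chart(4)[OF c(1)] that by auto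
    have dH: "H differentiable (at u)"
      by (rule differentiable_cong_open[OF open_D c(2), of "\<lambda>_. f"]) (auto simp: H)
    have "exterior H u = exterior (\<lambda>_. f) u" by (rule exterior_cong[OF open_D c(2) H])
    then have 0: "exterior H u v = 0" for v by simp
    obtain e where e: "orthonormal_frame gM (\<phi> \<circ> x) u e" "(nn u $ 3)\<^sup>2 \<noteq> 1 \<Longrightarrow> dr u (e 1) $ 3 \<noteq> 0"
      using orthonormal_frame_exists[OF c(2)] by blast
    then show False
      using biconservative_frame[OF c(2) e(1) dH bi[OF c(1,2)], of 1] * f not_bundle
      by (simp add: 0 H[OF c(2)] nn_chart[OF c(1)] c(3))
  qed
  then have "(\<lambda>p. normal_frame p $ 3) ` M \<subseteq> {0, 1, -1}"
    by (auto simp: power2_eq_1_iff)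
  then have "(\<lambda>p. normal_frame p $ 3) constant_on M"
    using continuous_finite_range_constant[OF connected continuous_normal_frame] finite_subset by blast
  then obtain \<nu> where \<nu>: "\<forall>p\<in>M. normal_frame p $ 3 = \<nu>" unfolding constant_on_def by blast
  obtain p where "p \<in> M" using M_nonempty by blast
  then have "\<nu>\<^sup>2 \<noteq> 1" using vertical_minimal[OF \<nu>] assms f by auto
  then show ?thesis using \<nu> \<open>p \<in> M\<close> \<open>(\<lambda>p. normal_frame p $ 3) ` M \<subseteq> {0, 1, -1}\<close> by force
qed

lemma cmc_imp_constant_angle: "cmc_surface \<kappa> \<tau> \<A> \<phi> N \<Longrightarrow> constant_angle_surface \<kappa> \<tau> M \<phi> N"
  using cmc_imp_horizontal_normal by (auto simp: cmc_iff constant_angle_iff)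

text \<open>If \<open>cos \<alpha> \<noteq> 0\<close>, eliminating the gradient of \<open>f\<close> between the Riccati equation and the two components of
  the biconservative equation leaves a polynomial equation for \<open>f\<close> with constant coefficients and leading
  coefficient 3, so \<open>f\<close> is a continuous function with finite range. If \<open>cos \<alpha> = 0\<close> that equation is void;
  the Riccati equation then says that \<open>f\<close> is constant in the direction of the Hopf field, the other
  component gives \<open>f grad f = 0\<close>, and \<open>f\<^sup>2\<close> is locally constant.\<close>

lemma constant_angle_imp_cmc:
  assumes "constant_angle_surface \<kappa> \<tau> M \<phi> N"
  shows "cmc_surface \<kappa> \<tau> \<A> \<phi> N"
proof -
  obtain \<nu> where \<nu>: "\<forall>p\<in>M. normal_frame p $ 3 = \<nu>" using assms constant_angle_iff by blast
  obtain p0 where p0: "p0 \<in> M" using M_nonempty by blast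
  have "\<nu>\<^sup>2 \<noteq> 1" using vertical_minimal[OF \<nu>] not_minimal by (auto simp: minimal_iff)
  moreover have "\<nu>\<^sup>2 \<le> 1"
  proof -
    obtain D x u where c: "(D, x) \<in> \<A>" "u \<in> D" "x u = p0" using in_chart[OF p0] .
    have "normal_frame p0 \<bullet> normal_frame p0 = 1"
      using surface_patch.nn_unit[OF patch[OF c(1)] c(2)] nn_chart[OF c(1)] c(3) by simp
    then show ?thesis using \<nu> p0
      by (simp add: inner_vec_def sum_3 power2_eq_square) (smt (verit) zero_le_square)
  qed
  ultimately have "1 - \<nu>\<^sup>2 > 0" by simp
  then obtain s where s: "s > 0" "s\<^sup>2 + \<nu>\<^sup>2 = 1"
    by (intro that[of "sqrt (1 - \<nu>\<^sup>2)"]) auto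
  note helix = helix_patch[OF \<nu> s]
  have cont: "continuous_on M mc"
  proof (rule continuous_on_surface)
    fix D x assume c: "(D, x) \<in> \<A>"
    have "continuous_on D (mean_curvature gM (\<phi> \<circ> x) (N \<circ> x))"
      by (rule smooth_on_continuous[OF helix_patch.smooth_H[OF helix[OF c]]])
    then show "continuous_on D (mc \<circ> x)"
      by (rule continuous_on_eq) (simp add: mc_chart[OF c])
  qed
  define C where "C = \<kappa> * s\<^sup>2 + 4 * \<tau>\<^sup>2 * \<nu>\<^sup>2"
  have "finite (mc ` M)"
  proof (cases "\<nu> = 0")
    case True
    have "(\<lambda>p. mc p ^ 2) constant_on M"
    proof (rule locally_constant_on_surface)
      fix D x u assume c: "(D, x) \<in> \<A>" "u \<in> D"
      interpret helix_patch \<kappa> \<tau> D "\<phi> \<circ> x" "N \<circ> x" \<nu> s by (rule helix[OF c(1)])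
      obtain h1 h2 where h: "\<And>v. exterior H u v = h1 * \<beta>1 u v + h2 * \<beta>2 u v"
        "s * h1 = - \<nu> * ((H u)\<^sup>2 + \<kappa> * s\<^sup>2 + 4 * \<tau>\<^sup>2 * \<nu>\<^sup>2)" "2 * \<tau> * h1 + 3 * H u * h2 = 0"
        using biconservative_helix[OF c(2) bi[OF c]] by metis
      from h(2) have "s * h1 = 0" by (simp add: True)
      with h(3) have "h1 = 0" "H u * h2 = 0" using s by auto
      then have 0: "H u * exterior H u v = 0" for v by (auto simp: h(1))
      have "((\<lambda>u. H u * H u) has_derivative (\<lambda>v. H u * exterior H u v + exterior H u v * H u)) (at u)"
        by (intro has_derivative_mult exterior_has_derivative[OF smooth_H c(2)])
      then have "((\<lambda>u. H u * H u) has_derivative (\<lambda>v. 0)) (at u)"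
        by (simp add: 0 mult.commute[of "exterior H u _"])
      then show "((\<lambda>p. mc p ^ 2) \<circ> x has_derivative (\<lambda>_. 0)) (at u)"
        by (rule has_derivative_transform_within_open[OF _ open_D c(2)])
          (simp add: mc_chart[OF c(1)] power2_eq_square)
    qed
    then obtain k where "\<And>p. p \<in> M \<Longrightarrow> (mc p)\<^sup>2 = k" unfolding constant_on_def by blast
    then have "mc ` M \<subseteq> {sqrt k, - sqrt k}" by (force simp: real_sqrt_abs abs_if)
    then show ?thesis by (rule finite_subset) simp
  next
    case False
    \<comment> \<open>the expansion of \<open>(3 h\<^sup>2 - 4 \<tau>\<^sup>2) (h\<^sup>2 + C) + 6 h\<^sup>2 (4 \<tau>\<^sup>2 - \<kappa>) s\<^sup>2\<close>\<close>
    define P where "P = (\<lambda>h::real. \<Sum>i\<le>4. ([- 4 * \<tau>\<^sup>2 * C, 0, 3 * C - 4 * \<tau>\<^sup>2 + 6 * (4 * \<tau>\<^sup>2 - \<kappa>) * s\<^sup>2, 0, 3] ! i) * h ^ i)"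
    have "mc ` M \<subseteq> {h. P h = 0}"
    proof clarify
      fix p assume "p \<in> M"
      then obtain D x u where c: "(D, x) \<in> \<A>" "u \<in> D" "x u = p" using in_chart by blast
      interpret helix_patch \<kappa> \<tau> D "\<phi> \<circ> x" "N \<circ> x" \<nu> s by (rule helix[OF c(1)])
      obtain h1 h2 where h: "s * h1 = - \<nu> * ((H u)\<^sup>2 + \<kappa> * s\<^sup>2 + 4 * \<tau>\<^sup>2 * \<nu>\<^sup>2)"
        "2 * \<tau> * h2 + H u * h1 = 2 * H u * (4 * \<tau>\<^sup>2 - \<kappa>) * \<nu> * s" "2 * \<tau> * h1 + 3 * H u * h2 = 0"
        using biconservative_helix[OF c(2) bi[OF c(1,2)]] by metis
      have "\<nu> * ((3 * (H u)\<^sup>2 - 4 * \<tau>\<^sup>2) * ((H u)\<^sup>2 + C) + 6 * (H u)\<^sup>2 * (4 * \<tau>\<^sup>2 - \<kappa>) * s\<^sup>2) = 0"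
        using h unfolding C_def by algebra
      then have "(3 * (H u)\<^sup>2 - 4 * \<tau>\<^sup>2) * ((H u)\<^sup>2 + C) + 6 * (H u)\<^sup>2 * (4 * \<tau>\<^sup>2 - \<kappa>) * s\<^sup>2 = 0"
        using False by simp
      then have "P (H u) = 0"
        by (simp add: P_def eval_nat_numeral algebra_simps)
      then show "P (mc p) = 0" using mc_chart[OF c(1,2)] c(3) by simp
    qed
    moreover have "finite {h. P h = 0}"
      unfolding P_def polyfun_finite_roots by (rule exI[of _ 4]) (simp add: eval_nat_numeral)
    ultimately show ?thesis by (rule finite_subset)
  qed
  then have "mc constant_on M"
    by (rule continuous_finite_range_constant[OF connected cont])
  then show ?thesis by (auto simp: cmc_iff constant_on_def)
qed

end

section \<open>Curves of constant geodesic curvature as Euclidean circles\<close>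

text \<open>In the conformal coordinates the curves of constant geodesic curvature are Euclidean circles and
  lines, that is, zero sets of the following function with \<open>b\<^sub>1\<^sup>2 + b\<^sub>2\<^sup>2 - 2 K c = 1\<close>. The normalization
  makes \<open>(b\<^sub>1 - K X, b\<^sub>2 - K Y)\<close> a unit normal and \<open>K\<close> the Euclidean curvature.\<close>

definition circle_eq :: "real \<Rightarrow> real \<Rightarrow> real \<Rightarrow> real \<Rightarrow> real \<Rightarrow> real \<Rightarrow> real" where
  "circle_eq K b1 b2 c X Y = K / 2 * (X\<^sup>2 + Y\<^sup>2) - b1 * X - b2 * Y + c"

text \<open>The Euclidean curvature of a curve through \<open>(X, Y)\<close> with unit normal \<open>(m\<^sub>1, m\<^sub>2)\<close> whose geodesic
  curvature in the base is \<open>k\<close>: under the conformal factor, \<open>k = F K + \<kappa> / 2 (X m\<^sub>1 + Y m\<^sub>2)\<close>.\<close>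

definition euclidean_curvature :: "real \<Rightarrow> real \<Rightarrow> real \<Rightarrow> real \<Rightarrow> real \<Rightarrow> real \<Rightarrow> real" where
  "euclidean_curvature \<kappa> k X Y m1 m2 = (k - \<kappa> / 2 * (X * m1 + Y * m2)) / bcv_F \<kappa> X Y"

text \<open>The coefficients of the osculating circle of such a curve.\<close>

definition osculating_circle :: "real \<Rightarrow> real \<Rightarrow> real \<Rightarrow> real \<Rightarrow> real \<Rightarrow> real \<Rightarrow> real \<times> real \<times> real \<times> real" where
  "osculating_circle \<kappa> k X Y m1 m2 = (let K = euclidean_curvature \<kappa> k X Y m1 m2 in
     (K, K * X + m1, K * Y + m2, X * m1 + Y * m2 + K / 2 * (X * X + Y * Y)))"

text \<open>The hypothesis \<open>turn\<close> is the Frenet equation \<open>dm = - K dp\<close>. It makes \<open>d(K p + m) = p dK\<close>, and the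
  definition of \<open>K\<close>, cleared of its denominator \<open>F\<close>, gives \<open>F dK = 0\<close> for constant \<open>k\<close>.\<close>

lemma osculating_circle_constant:
  fixes X Y m1 m2 :: "'a::real_normed_vector \<Rightarrow> real"
  assumes X: "(X has_derivative X') (at u)" and Y: "(Y has_derivative Y') (at u)"
    and m1: "(m1 has_derivative m1') (at u)" and m2: "(m2 has_derivative m2') (at u)"
    and F: "bcv_F \<kappa> (X u) (Y u) \<noteq> 0"
    and K: "K = (\<lambda>u. euclidean_curvature \<kappa> k (X u) (Y u) (m1 u) (m2 u))"
    and turn: "\<And>v. m1' v = - K u * X' v" "\<And>v. m2' v = - K u * Y' v"
    and perp: "\<And>v. m1 u * X' v + m2 u * Y' v = 0"
  shows "((\<lambda>u. osculating_circle \<kappa> k (X u) (Y u) (m1 u) (m2 u)) has_derivative (\<lambda>_. 0)) (at u)"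
proof -
  note XX = has_derivative_mult[OF X X] and YY = has_derivative_mult[OF Y Y]
    and Xm = has_derivative_mult[OF X m1] and Ym = has_derivative_mult[OF Y m2]
  have num: "((\<lambda>u. k - \<kappa> / 2 * (X u * m1 u + Y u * m2 u)) has_derivative
      (\<lambda>v. K u * (\<kappa> / 2 * (X u * X' v + Y u * Y' v)))) (at u)"
    by (rule has_derivative_eq_rhs[OF has_derivative_diff[OF has_derivative_const
          has_derivative_mult_right[OF has_derivative_add[OF Xm Ym]]]])
      (use perp in \<open>simp add: fun_eq_iff turn algebra_simps\<close>)
  have den: "((\<lambda>u. bcv_F \<kappa> (X u) (Y u)) has_derivative (\<lambda>v. \<kappa> / 2 * (X u * X' v + Y u * Y' v))) (at u)"
    unfolding bcv_F_def power2_eq_square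
    by (rule has_derivative_eq_rhs[OF has_derivative_add[OF has_derivative_const
          has_derivative_mult_right[OF has_derivative_add[OF XX YY]]]])
      (simp add: fun_eq_iff algebra_simps)
  have KF: "k - \<kappa> / 2 * (X u * m1 u + Y u * m2 u) = K u * bcv_F \<kappa> (X u) (Y u)"
    using F by (simp add: K euclidean_curvature_def)
  have "(K has_derivative (\<lambda>v. (K u * (\<kappa> / 2 * (X u * X' v + Y u * Y' v)) * bcv_F \<kappa> (X u) (Y u)
      - (k - \<kappa> / 2 * (X u * m1 u + Y u * m2 u)) * (\<kappa> / 2 * (X u * X' v + Y u * Y' v)))
      / (bcv_F \<kappa> (X u) (Y u) * bcv_F \<kappa> (X u) (Y u)))) (at u)"
    unfolding K euclidean_curvature_def
    using has_derivative_divide'[OF num den F] by (simp add: K euclidean_curvature_def)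
  then have dK: "(K has_derivative (\<lambda>_. 0)) (at u)"
    unfolding KF by (simp add: mult_ac)
  have dB: "((\<lambda>u. K u * X u + m1 u) has_derivative (\<lambda>_. 0)) (at u)"
    by (rule has_derivative_eq_rhs[OF has_derivative_add[OF has_derivative_mult[OF dK X] m1]])
      (simp add: fun_eq_iff turn)
  have dB': "((\<lambda>u. K u * Y u + m2 u) has_derivative (\<lambda>_. 0)) (at u)"
    by (rule has_derivative_eq_rhs[OF has_derivative_add[OF has_derivative_mult[OF dK Y] m2]])
      (simp add: fun_eq_iff turn)
  have K2: "((\<lambda>u. K u / 2) has_derivative (\<lambda>v. 0)) (at u)"
    using has_derivative_mult_right[OF dK, of "1/2"] by simp
  have "((\<lambda>u. X u * m1 u + Y u * m2 u + K u / 2 * (X u * X u + Y u * Y u)) has_derivative (\<lambda>_. 0)) (at u)"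
    by (rule has_derivative_eq_rhs[OF has_derivative_add[OF has_derivative_add[OF Xm Ym]
          has_derivative_mult[OF K2 has_derivative_add[OF XX YY]]]])
      (use perp in \<open>simp add: fun_eq_iff turn algebra_simps\<close>)
  from has_derivative_Pair[OF dK has_derivative_Pair[OF dB has_derivative_Pair[OF dB' this]]]
  show ?thesis by (simp add: osculating_circle_def K Let_def zero_prod_def)
qed

lemma osculating_circle:
  assumes "m1\<^sup>2 + m2\<^sup>2 = 1" "osculating_circle \<kappa> k X Y m1 m2 = (K, b1, b2, c)"
  shows "circle_eq K b1 b2 c X Y = 0" "b1\<^sup>2 + b2\<^sup>2 - 2 * K * c = 1"
proof -
  have eq: "b1 = K * X + m1" "b2 = K * Y + m2" "c = X * m1 + Y * m2 + K / 2 * (X * X + Y * Y)"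
    using assms(2) by (auto simp: osculating_circle_def Let_def)
  show "circle_eq K b1 b2 c X Y = 0"
    unfolding eq circle_eq_def by (simp add: power2_eq_square algebra_simps)
  have "b1\<^sup>2 + b2\<^sup>2 - 2 * K * c = m1\<^sup>2 + m2\<^sup>2"
    unfolding eq by (simp add: power2_eq_square algebra_simps)
  then show "b1\<^sup>2 + b2\<^sup>2 - 2 * K * c = 1" using assms(1) by simp
qed

lemma circle_normal_unit:
  assumes "b1\<^sup>2 + b2\<^sup>2 - 2 * K * c = 1" "circle_eq K b1 b2 c X Y = 0"
  shows "(b1 - K * X)\<^sup>2 + (b2 - K * Y)\<^sup>2 = 1"
proof -
  have "(b1 - K * X)\<^sup>2 + (b2 - K * Y)\<^sup>2 = b1\<^sup>2 + b2\<^sup>2 - 2 * K * c + 2 * K * circle_eq K b1 b2 c X Y"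
    by (simp add: circle_eq_def power2_eq_square algebra_simps)
  then show ?thesis using assms by simp
qed

text \<open>The property through which constant mean curvature and the Hopf tube condition are compared.\<close>

definition (in bcv_surface) projects_to_circle :: "real \<Rightarrow> real \<Rightarrow> real \<Rightarrow> real \<Rightarrow> bool" where
  "projects_to_circle K b1 b2 c \<longleftrightarrow> b1\<^sup>2 + b2\<^sup>2 - 2 * K * c = 1 \<and>
     (\<forall>p\<in>M. circle_eq K b1 b2 c (\<phi> p $ 1) (\<phi> p $ 2) = 0)"

context surface_patch
begin

lemma exterior_X: assumes u: "u \<in> D"
  shows "exterior X u v = bcv_F \<kappa> (X u) (Y u) * dr u v $ 1" "exterior Y u v = bcv_F \<kappa> (X u) (Y u) * dr u v $ 2"
  using bcv_point.F_nz[OF point[OF u]] by (simp_all add: dr_1[OF u] dr_2[OF u] I_def)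

end

context biconservative_bcv_surface
begin

text \<open>The normal is horizontal, so \<open>N\<close> projects to a unit normal \<open>m\<close> of the image in the base, the image is
  a curve, and \<open>\<Theta> = - f \<beta>\<^sub>2\<close> is its Frenet equation with geodesic curvature \<open>f\<close>. The osculating circle is then
  the same at all points of the connected surface.\<close>

lemma cmc_imp_projects_to_circle:
  assumes "\<forall>p\<in>M. mc p = f"
  obtains K b1 b2 c where "projects_to_circle K b1 b2 c"
proof -
  note hor = cmc_imp_horizontal_normal[OF assms]
  define C where "C p = osculating_circle \<kappa> f (\<phi> p $ 1) (\<phi> p $ 2) (normal_frame p $ 1) (normal_frame p $ 2)" for p
  have dC: "(C \<circ> x has_derivative (\<lambda>_. 0)) (at u)"
    and unit: "(normal_frame (x u) $ 1)\<^sup>2 + (normal_frame (x u) $ 2)\<^sup>2 = 1"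
    if c: "(D, x) \<in> \<A>" "u \<in> D" for D x u
  proof -
    interpret helix_patch \<kappa> \<tau> D "\<phi> \<circ> x" "N \<circ> x" 0 1
      by (rule helix_patch[OF hor _ _ c(1)]) auto
    have m: "m1 = (\<lambda>u. normal_frame (x u) $ 1)" "m2 = (\<lambda>u. normal_frame (x u) $ 2)"
      by (auto simp: m1_def m2_def nn_chart[OF c(1)])
    have H: "H u = f" using mc_chart[OF c] assms chart(4)[OF c(1)] c(2) by auto
    have F: "bcv_F \<kappa> (X u) (Y u) \<noteq> 0" by (rule bcv_point.F_nz[OF point[OF c(2)]])
    have d1: "dr u v $ 1 = - m2 u * \<beta>2 u v" and d2: "dr u v $ 2 = m1 u * \<beta>2 u v" for v
      using dr_eq[OF c(2), of v] by (simp_all add: E1_def E2_def)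
    define L where "L = (\<lambda>u. euclidean_curvature \<kappa> f (X u) (Y u) (m1 u) (m2 u))"
    have LF: "L u * bcv_F \<kappa> (X u) (Y u) = f - \<kappa> / 2 * (X u * m1 u + Y u * m2 u)"
      using F by (simp add: L_def euclidean_curvature_def)
    have turn: "m1 u * exterior m2 u v - m2 u * exterior m1 u v = - (L u * bcv_F \<kappa> (X u) (Y u)) * \<beta>2 u v" for v
      unfolding LF using Theta_eq[OF c(2), of v]
      by (simp add: \<Theta>_def chi_def d1 d2 H algebra_simps)
    have t1: "exterior m1 u v = - L u * exterior X u v" and t2: "exterior m2 u v = - L u * exterior Y u v" for v
      using dm[OF c(2), of v] unfolding turn exterior_X[OF c(2)] d1 d2 by (simp_all add: mult_ac)
    have perp: "m1 u * exterior X u v + m2 u * exterior Y u v = 0" for v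
      unfolding exterior_X[OF c(2)] d1 d2 by (simp add: algebra_simps)
    have "((\<lambda>u. osculating_circle \<kappa> f (X u) (Y u) (m1 u) (m2 u)) has_derivative (\<lambda>_. 0)) (at u)"
      by (rule osculating_circle_constant[OF exterior_has_derivative exterior_has_derivative exterior_has_derivative
            exterior_has_derivative F L_def t1 t2 perp]) (rule smooth_r_component smooth_m1 smooth_m2 c(2))+
    then show "(C \<circ> x has_derivative (\<lambda>_. 0)) (at u)" unfolding m by (simp add: C_def o_def)
    show "(normal_frame (x u) $ 1)\<^sup>2 + (normal_frame (x u) $ 2)\<^sup>2 = 1"
      using m_unit[OF c(2)] by (simp add: m)
  qed
  have "C constant_on M" by (rule locally_constant_on_surface) (rule dC)
  then obtain K0 b1 b2 c where C: "\<And>p. p \<in> M \<Longrightarrow> C p = (K0, b1, b2, c)"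
    unfolding constant_on_def by (metis prod_cases4)
  have "circle_eq K0 b1 b2 c (\<phi> p $ 1) (\<phi> p $ 2) = 0 \<and> b1\<^sup>2 + b2\<^sup>2 - 2 * K0 * c = 1" if p: "p \<in> M" for p
  proof -
    have "(normal_frame p $ 1)\<^sup>2 + (normal_frame p $ 2)\<^sup>2 = 1" using unit in_chart[OF p] by metis
    from osculating_circle[OF this C[OF p, unfolded C_def]] show ?thesis by simp
  qed
  then have "projects_to_circle K0 b1 b2 c"
    using M_nonempty unfolding projects_to_circle_def by blast
  then show ?thesis by (rule that)
qed

end

context bcv_surface
begin

lemma circle_tangency:
  assumes "projects_to_circle K b1 b2 c0" and c: "(D, x) \<in> \<A>" "u \<in> D"
  shows "(b1 - K * (\<phi> \<circ> x) u $ 1) * exterior (\<lambda>u. (\<phi> \<circ> x) u $ 1) u v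
    + (b2 - K * (\<phi> \<circ> x) u $ 2) * exterior (\<lambda>u. (\<phi> \<circ> x) u $ 2) u v = 0"
proof -
  have circ: "\<And>p. p \<in> M \<Longrightarrow> circle_eq K b1 b2 c0 (\<phi> p $ 1) (\<phi> p $ 2) = 0"
    using assms(1) unfolding projects_to_circle_def by auto
  interpret surface_patch \<kappa> \<tau> D "\<phi> \<circ> x" "N \<circ> x" by (rule patch[OF c(1)])
  note dX = exterior_has_derivative[OF smooth_r_component[of 1] c(2)] and dY = exterior_has_derivative[OF smooth_r_component[of 2] c(2)]
  have d: "((\<lambda>u. K / 2 * (X u * X u + Y u * Y u) - b1 * X u - b2 * Y u + c0) has_derivative
     (\<lambda>v. K / 2 * (X u * exterior X u v + exterior X u v * X u + (Y u * exterior Y u v + exterior Y u v * Y u))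
        - b1 * exterior X u v - b2 * exterior Y u v + 0)) (at u)"
    by (intro has_derivative_add has_derivative_diff has_derivative_mult_right has_derivative_mult dX dY has_derivative_const)
  have z: "exterior (\<lambda>u. K / 2 * (X u * X u + Y u * Y u) - b1 * X u - b2 * Y u + c0) u = exterior (\<lambda>_. 0) u"
  proof (rule exterior_cong[OF open_D c(2)])
    fix w assume "w \<in> D"
    then have "x w \<in> M" using chart(4)[OF c(1)] by blast
    then show "K / 2 * (X w * X w + Y w * Y w) - b1 * X w - b2 * Y w + c0 = 0"
      using circ by (simp add: circle_eq_def power2_eq_square)
  qed
  show ?thesis
    using fun_cong[OF z, of v] unfolding exterior_eqI[OF d] by (simp add: algebra_simps)
qed

text \<open>Conversely, over a circle the normal is the lift of the normal of the circle, up to a sign which is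
  constant by connectedness; the mean curvature is then, up to this sign, the geodesic curvature
  \<open>K + \<kappa> c / 2\<close> of the circle.\<close>

lemma projects_to_circle_imp_cmc:
  assumes "projects_to_circle K b1 b2 c"
  shows "cmc_surface \<kappa> \<tau> \<A> \<phi> N"
proof -
  have norm: "b1\<^sup>2 + b2\<^sup>2 - 2 * K * c = 1"
    and circ: "\<And>p. p \<in> M \<Longrightarrow> circle_eq K b1 b2 c (\<phi> p $ 1) (\<phi> p $ 2) = 0"
    using assms unfolding projects_to_circle_def by auto
  define q where "q p = (vector [b1 - K * \<phi> p $ 1, b2 - K * \<phi> p $ 2, 0] :: real^3)" for p
  define \<sigma> where "\<sigma> p = q p \<bullet> normal_frame p" for p
  have normal_eq: "normal_frame p = \<sigma> p *\<^sub>R q p \<and> (\<sigma> p)\<^sup>2 = 1" if p: "p \<in> M" for p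
  proof -
    obtain D x u where c: "(D, x) \<in> \<A>" "u \<in> D" "x u = p" using in_chart[OF p] .
    interpret surface_patch \<kappa> \<tau> D "\<phi> \<circ> x" "N \<circ> x" by (rule patch[OF c(1)])
    have F: "bcv_F \<kappa> (X u) (Y u) \<noteq> 0" by (rule bcv_point.F_nz[OF point[OF c(2)]])
    note e0 = circle_tangency[OF assms c(1,2)]
    have "bcv_F \<kappa> (X u) (Y u) * (q p \<bullet> dr u v) = 0" for v
      using e0[of v] unfolding exterior_X[OF c(2)]
      by (simp add: q_def inner_vec_def sum_3 c(3) algebra_simps)
    then have q_dr: "q p \<bullet> dr u v = 0" for v using F by simp
    have qq: "q p \<bullet> q p = 1"
      using circle_normal_unit[OF norm circ[OF p]] by (simp add: q_def inner_vec_def sum_3 power2_eq_square)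
    define n where "n = normal_frame p"
    have nn: "nn u = n" using nn_chart[OF c(1)] c(3) by (simp add: n_def)
    have n1: "n \<bullet> n = 1" using nn_unit[OF c(2)] by (simp add: nn)
    have "(q p - \<sigma> p *\<^sub>R n) \<bullet> nn u = 0" by (simp add: nn inner_diff_left n1 \<sigma>_def n_def[symmetric])
    then obtain a where "dr u a = q p - \<sigma> p *\<^sub>R n" using tangent_vector_exists[OF c(2)] by blast
    then have "q p \<bullet> (q p - \<sigma> p *\<^sub>R n) = 0" using q_dr by metis
    then have s2: "(\<sigma> p)\<^sup>2 = 1" by (simp add: inner_diff_right qq \<sigma>_def n_def[symmetric] power2_eq_square)
    have "(n - \<sigma> p *\<^sub>R q p) \<bullet> (n - \<sigma> p *\<^sub>R q p) = 1 - (\<sigma> p)\<^sup>2"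
      by (simp add: inner_diff_left inner_diff_right n1 qq \<sigma>_def n_def[symmetric] inner_commute power2_eq_square algebra_simps)
    then show ?thesis using s2 by (simp add: n_def)
  qed
  have "\<sigma> constant_on M"
  proof (rule continuous_finite_range_constant[OF connected])
    show "continuous_on M \<sigma>"
      unfolding \<sigma>_def[abs_def] q_def inner_vec_def sum_3
      by (simp, intro continuous_intros continuous_phi continuous_normal_frame)
    have "\<sigma> ` M \<subseteq> {1, -1}" using normal_eq by (auto simp: power2_eq_1_iff)
    then show "finite (\<sigma> ` M)" by (rule finite_subset) simp
  qed
  then obtain s0 where s0: "\<And>p. p \<in> M \<Longrightarrow> \<sigma> p = s0" unfolding constant_on_def by blast
  have hor: "\<forall>p\<in>M. normal_frame p $ 3 = 0" using normal_eq by (simp add: q_def)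
  have "mc p = s0 * (K + \<kappa> / 2 * c)" if p: "p \<in> M" for p
  proof -
    obtain D x u where ch: "(D, x) \<in> \<A>" "u \<in> D" "x u = p" using in_chart[OF p] .
    interpret helix_patch \<kappa> \<tau> D "\<phi> \<circ> x" "N \<circ> x" 0 1
      by (rule helix_patch[OF hor _ _ ch(1)]) auto
    have m: "m1 w = s0 * (b1 - K * X w)" "m2 w = s0 * (b2 - K * Y w)" if "w \<in> D" for w
    proof -
      have "x w \<in> M" using that chart(4)[OF ch(1)] by blast
      then show "m1 w = s0 * (b1 - K * X w)" "m2 w = s0 * (b2 - K * Y w)"
        using normal_eq[of "x w"] s0[of "x w"] by (simp_all add: m1_def m2_def nn_chart[OF ch(1)] q_def)
    qed
    have dm: "exterior m1 u v = - s0 * K * exterior X u v" "exterior m2 u v = - s0 * K * exterior Y u v" for v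
    proof -
      have 1: "exterior m1 u = exterior (\<lambda>w. s0 * (b1 - K * X w)) u"
        and 2: "exterior m2 u = exterior (\<lambda>w. s0 * (b2 - K * Y w)) u"
        by (rule exterior_cong[OF open_D ch(2)], simp add: m)+
      have d: "((\<lambda>w. s0 * (b - K * (\<phi> \<circ> x) w $ i)) has_derivative
          (\<lambda>v. s0 * (0 - K * exterior (\<lambda>w. (\<phi> \<circ> x) w $ i) u v))) (at u)" for b i
        by (intro has_derivative_mult_right has_derivative_diff has_derivative_const
            exterior_has_derivative[OF smooth_r_component ch(2)])
      show "exterior m1 u v = - s0 * K * exterior X u v" "exterior m2 u v = - s0 * K * exterior Y u v"
        unfolding 1 2 using exterior_eqI[OF d] by auto
    qed
    obtain b where b: "dr u b = E2 u" using adapted_frame[OF ch(2)] by metis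
    have "H u = - \<Theta> u b" using H_frame[OF ch(2) b] by simp
    also have "\<dots> = s0 * K * bcv_F \<kappa> (X u) (Y u) * ((m1 u)\<^sup>2 + (m2 u)\<^sup>2) + \<kappa> / 2 * (X u * m1 u + Y u * m2 u)"
      unfolding \<Theta>_def dm exterior_X[OF ch(2)] chi_def b
      by (simp add: E2_def power2_eq_square algebra_simps)
    also have "\<dots> = s0 * (K * bcv_F \<kappa> (X u) (Y u) + \<kappa> / 2 * (X u * (b1 - K * X u) + Y u * (b2 - K * Y u)))"
      unfolding m_unit[OF ch(2)] unfolding m[OF ch(2)] by (simp add: algebra_simps)
    also have "\<dots> = s0 * (K + \<kappa> / 2 * c - \<kappa> / 2 * circle_eq K b1 b2 c (X u) (Y u))"
      by (simp add: bcv_F_def circle_eq_def power2_eq_square field_simps)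
    also have "\<dots> = s0 * (K + \<kappa> / 2 * c)" using circ[OF p] ch(3) by simp
    finally show ?thesis using mc_chart[OF ch(1,2)] ch(3) by simp
  qed
  then show ?thesis by (auto simp: cmc_iff)
qed

end

section \<open>Geodesic curvature in the base\<close>

text \<open>For the conformal metric the connection is, up to the derivative of the factor \<open>1 / F\<close>, the rotation by
  the form \<open>\<chi> = \<kappa> / 2 (y dx - x dy) / F\<close>.\<close>

lemma base_christoffel:
  fixes p :: "real^2"
  assumes p: "p \<in> base_domain \<kappa>"
  defines "F \<equiv> bcv_F \<kappa> (p$1) (p$2)"
  shows "christoffel_form (base_metric \<kappa>) p v w =
     (- (\<kappa> / 2 * (p$1 * v$1 + p$2 * v$2)) / F) *\<^sub>R w + (\<kappa> / 2 * (p$2 * v$1 - p$1 * v$2) / F) *\<^sub>R quarter_turn w"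
    (is "_ = ?G v w")
proof (rule christoffel_form_unique)
  have F: "F > 0" using p by (simp add: F_def base_domain_def)
  show "bilinear (base_metric \<kappa> p)"
    unfolding bilinear_def base_metric_def
    by (auto intro!: linearI simp: add_divide_distrib algebra_simps)
  show "base_metric \<kappa> p v w = base_metric \<kappa> p w v" for v w
    by (simp add: base_metric_def mult.commute)
  show "base_metric \<kappa> p v v \<noteq> 0" if "v \<noteq> 0" for v
    using that F by (auto simp: base_metric_def F_def[symmetric] vec_eq_iff forall_2 sum_squares_eq_zero_iff)
  show "bilinear ?G"
    unfolding bilinear_def
    by (intro conjI allI linearI)
      (use F in \<open>simp_all add: quarter_turn_def vec_eq_iff forall_2 field_simps\<close>)
  show "?G v w = ?G w v" for v w
    using F by (simp add: quarter_turn_def vec_eq_iff forall_2 field_simps)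
next
  fix v w u :: "real^2"
  have F: "F > 0" "F \<noteq> 0" using p by (simp_all add: F_def base_domain_def)
  have c: "((\<lambda>q::real^2. q $ i) has_derivative (\<lambda>h. h $ i)) (at p)" for i
    by (rule has_derivative_component[OF has_derivative_ident])
  have dF: "((\<lambda>q::real^2. bcv_F \<kappa> (q$1) (q$2)) has_derivative (\<lambda>v. \<kappa> / 2 * (p$1 * v$1 + p$2 * v$2))) (at p)"
    unfolding bcv_F_def power2_eq_square
    by (rule has_derivative_eq_rhs[OF has_derivative_add[OF has_derivative_const has_derivative_mult_right[OF
            has_derivative_add[OF has_derivative_mult[OF c c] has_derivative_mult[OF c c]]]]])
      (simp add: fun_eq_iff algebra_simps)
  have "((\<lambda>q. (w$1 * u$1 + w$2 * u$2) / (bcv_F \<kappa> (q$1) (q$2) * bcv_F \<kappa> (q$1) (q$2))) has_derivative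
     (\<lambda>v. (0 * (F * F) - (w$1 * u$1 + w$2 * u$2) * (F * (\<kappa> / 2 * (p$1 * v$1 + p$2 * v$2)) + (\<kappa> / 2 * (p$1 * v$1 + p$2 * v$2)) * F))
         / ((F * F) * (F * F)))) (at p)"
    using has_derivative_divide'[OF has_derivative_const has_derivative_mult[OF dF dF], of "w$1 * u$1 + w$2 * u$2"] F
    by (simp add: F_def)
  from frechet_eqI[OF this]
  have D: "frechet_derivative (\<lambda>q. base_metric \<kappa> q w u) (at p) v =
     - (w$1 * u$1 + w$2 * u$2) * (\<kappa> * (p$1 * v$1 + p$2 * v$2)) / (F * F * F)"
    unfolding base_metric_def power2_eq_square using F by (simp add: field_simps)
  show "frechet_derivative (\<lambda>q. base_metric \<kappa> q w u) (at p) v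
     = base_metric \<kappa> p (?G v w) u + base_metric \<kappa> p w (?G v u)"
    unfolding D using F by (simp add: base_metric_def F_def[symmetric] quarter_turn_def power2_eq_square field_simps)
qed

definition euclidean_normal :: "(real \<Rightarrow> real^2) \<Rightarrow> real \<Rightarrow> real^2" where
  "euclidean_normal c t = quarter_turn (vector_derivative c (at t) /\<^sub>R norm (vector_derivative c (at t)))"

lemma norm_real2: "norm (v::real^2) = sqrt (v$1 * v$1 + v$2 * v$2)"
  by (simp add: norm_vec_def L2_set_def sum_2 power2_eq_square)

lemma sum_squares_real2: "v$1 * v$1 + v$2 * v$2 = (norm (v::real^2))\<^sup>2"
  by (simp add: norm_real2)

text \<open>The Frenet equation: for the unit tangent \<open>T\<close> of Euclidean length 1 the unit tangent of the base is
  \<open>F T\<close>, and the geodesic curvature becomes the Euclidean one times \<open>F\<close>, plus the derivative of \<open>F\<close> along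
  the normal.\<close>

lemma frenet:
  assumes c: "regular_curve_in (base_domain \<kappa>) I c" and t: "t \<in> I"
  defines "c' \<equiv> \<lambda>t. vector_derivative c (at t)"
  defines "m \<equiv> euclidean_normal c"
  defines "K \<equiv> euclidean_curvature \<kappa> (geodesic_curvature (base_metric \<kappa>) c t) (c t $ 1) (c t $ 2) (m t $ 1) (m t $ 2)"
  shows "(c has_derivative (\<lambda>s. s *\<^sub>R c' t)) (at t)"
    and "((\<lambda>t. m t $ i) has_derivative (\<lambda>s. - K * (s * c' t $ i))) (at t)"
    and "m t $ 1 * c' t $ 1 + m t $ 2 * c' t $ 2 = 0" and "(m t $ 1)\<^sup>2 + (m t $ 2)\<^sup>2 = 1"
proof -
  have I: "open I" and sm: "smooth_on I c" and dom: "\<And>t. t \<in> I \<Longrightarrow> c t \<in> base_domain \<kappa>"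
    and reg: "\<And>t. t \<in> I \<Longrightarrow> c' t \<noteq> 0"
    using c by (auto simp: regular_curve_in_def c'_def)
  have dc: "(c has_derivative (\<lambda>s. s *\<^sub>R c' t)) (at t)" if "t \<in> I" for t
    using smooth_on_differentiable[OF sm that]
    by (simp add: c'_def has_vector_derivative_def[symmetric] vector_derivative_works[symmetric])
  show "(c has_derivative (\<lambda>s. s *\<^sub>R c' t)) (at t)" by (rule dc[OF t])
  have c'_frechet: "frechet_derivative c (at t) 1 = c' t" if "t \<in> I" for t
    using frechet_eqI[OF dc[OF that]] by simp
  have "smooth_on I c'"
    by (rule smooth_on_cong[OF I c'_frechet smooth_on_derivative[OF sm]])
  then have "c' differentiable (at t)" using t by (rule smooth_on_differentiable)
  then have dc': "((\<lambda>t. c' t $ i) has_derivative (\<lambda>s. frechet_derivative c' (at t) s $ i)) (at t)" for i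
    by (intro has_derivative_component has_derivative_frechet)
  define L where "L t = norm (c' t)" for t
  have Lpos: "L t > 0" if "t \<in> I" for t using reg[OF that] by (simp add: L_def)
  have "norm differentiable (at (c' t))"
    using has_derivative_norm[OF reg[OF t]] by (auto simp: differentiable_def)
  then have "L differentiable (at t)"
    using differentiable_chain_at[OF \<open>c' differentiable (at t)\<close>] by (simp add: L_def[abs_def] o_def)
  define T1 T2 where "T1 t = c' t $ 1 / L t" and "T2 t = c' t $ 2 / L t" for t
  have "T1 differentiable (at t)" "T2 differentiable (at t)"
    unfolding T1_def[abs_def] T2_def[abs_def]
    using differentiableI[OF dc'] \<open>L differentiable (at t)\<close> Lpos[OF t]
    by (auto intro!: differentiable_divide)
  then obtain T1' T2' where dT: "(T1 has_derivative (\<lambda>s. s * T1')) (at t)" "(T2 has_derivative (\<lambda>s. s * T2')) (at t)"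
    by (metis has_field_derivative_def has_real_derivative_iff mult_commute_abs real_differentiable_def)
  have Tu: "T1 t * T1 t + T2 t * T2 t = 1" if "t \<in> I" for t
    using Lpos[OF that] sum_squares_real2[of "c' t"]
    by (simp add: T1_def T2_def L_def[symmetric] field_simps power2_eq_square)
  have "((\<lambda>t. T1 t * T1 t + T2 t * T2 t) has_derivative
      (\<lambda>s. T1 t * (s * T1') + (s * T1') * T1 t + (T2 t * (s * T2') + (s * T2') * T2 t))) (at t)"
    by (intro has_derivative_add has_derivative_mult dT)
  moreover have "((\<lambda>t. T1 t * T1 t + T2 t * T2 t) has_derivative (\<lambda>s. 0)) (at t)"
    by (rule has_derivative_transform_within_open[OF has_derivative_const I t]) (simp add: Tu)
  ultimately have "(\<lambda>s. T1 t * (s * T1') + (s * T1') * T1 t + (T2 t * (s * T2') + (s * T2') * T2 t)) = (\<lambda>s. 0)"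
    by (rule has_derivative_unique)
  from fun_cong[OF this, of 1] have orth: "T1 t * T1' + T2 t * T2' = 0"
    by (simp add: mult.commute)
  define \<omega> where "\<omega> = T1 t * T2' - T2 t * T1'"
  have T': "T1' = - \<omega> * T2 t" "T2' = \<omega> * T1 t"
    using orth Tu[OF t] unfolding \<omega>_def by algebra+
  define F where "F t = bcv_F \<kappa> (c t $ 1) (c t $ 2)" for t
  have Fpos: "F t > 0" if "t \<in> I" for t using dom[OF that] by (simp add: F_def base_domain_def)
  have m: "m t = vector [- T2 t, T1 t]" for t
    by (simp add: m_def euclidean_normal_def quarter_turn_def T1_def T2_def L_def c'_def vec_eq_iff forall_2
        divide_inverse mult.commute)
  have m12: "(\<lambda>t. m t $ 1) = (\<lambda>t. - T2 t)" "(\<lambda>t. m t $ 2) = T1" by (auto simp: m)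
  have c'T: "c' t $ 1 = L t * T1 t" "c' t $ 2 = L t * T2 t"
    using Lpos[OF t] by (simp_all add: T1_def T2_def)
  show "m t $ 1 * c' t $ 1 + m t $ 2 * c' t $ 2 = 0" by (simp add: m c'T)
  show "(m t $ 1)\<^sup>2 + (m t $ 2)\<^sup>2 = 1" using Tu[OF t] by (simp add: m power2_eq_square)
  have speed: "curve_speed (base_metric \<kappa>) c t = L t / F t" if "t \<in> I" for t
    using Fpos[OF that]
    by (simp add: curve_speed_def base_metric_def c'_def F_def[symmetric] L_def norm_real2 real_sqrt_divide)
  have U: "unit_tangent (base_metric \<kappa>) c t = vector [F t * T1 t, F t * T2 t]" if "t \<in> I" for t
    by (simp add: unit_tangent_def speed[OF that] c'_def T1_def T2_def vec_eq_iff forall_2 divide_inverse mult.commute)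
  have dci: "((\<lambda>t. c t $ i) has_derivative (\<lambda>s. s * c' t $ i)) (at t)" for i
    using has_derivative_component[OF dc[OF t], of i] by simp
  have dF: "(F has_derivative (\<lambda>s. s * (\<kappa> / 2 * (c t $ 1 * c' t $ 1 + c t $ 2 * c' t $ 2)))) (at t)"
    unfolding F_def[abs_def] bcv_F_def power2_eq_square
    by (rule has_derivative_eq_rhs[OF has_derivative_add[OF has_derivative_const has_derivative_mult_right[OF
            has_derivative_add[OF has_derivative_mult[OF dci dci] has_derivative_mult[OF dci dci]]]]])
      (simp add: fun_eq_iff algebra_simps)
  define F' where "F' = \<kappa> / 2 * (c t $ 1 * c' t $ 1 + c t $ 2 * c' t $ 2)"
  have dU: "((\<lambda>t. vector [F t * T1 t, F t * T2 t] :: real^2) has_derivative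
     (\<lambda>s. vector [F t * (s * T1') + s * F' * T1 t, F t * (s * T2') + s * F' * T2 t])) (at t)"
    using dF by (intro has_derivative_vector_2 has_derivative_mult dT) (simp_all add: F'_def)
  have "frechet_derivative (unit_tangent (base_metric \<kappa>) c) (at t) 1 = vector [F t * T1' + F' * T1 t, F t * T2' + F' * T2 t]"
    using frechet_derivative_cong_open[OF I t U] frechet_eqI[OF dU] by simp
  then have V: "nabla_along (base_metric \<kappa>) c (unit_tangent (base_metric \<kappa>) c) t 1
    = vector [F t * T1' - \<kappa> / 2 * (c t $ 2 * c' t $ 1 - c t $ 1 * c' t $ 2) * T2 t,
        F t * T2' + \<kappa> / 2 * (c t $ 2 * c' t $ 1 - c t $ 1 * c' t $ 2) * T1 t]"
    using Fpos[OF t]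
    by (simp add: nabla_along_def base_christoffel[OF dom[OF t]] c'_frechet[OF t] U[OF t] F_def[symmetric] F'_def
        quarter_turn_def vec_eq_iff forall_2)
  have "geodesic_curvature (base_metric \<kappa>) c t
     = ((F t * T1' - \<kappa> / 2 * (c t $ 2 * c' t $ 1 - c t $ 1 * c' t $ 2) * T2 t) * (- (F t * T2 t))
      + (F t * T2' + \<kappa> / 2 * (c t $ 2 * c' t $ 1 - c t $ 1 * c' t $ 2) * T1 t) * (F t * T1 t)) / (F t)\<^sup>2 / (L t / F t)"
    unfolding geodesic_curvature_def V speed[OF t] U[OF t] by (simp add: base_metric_def quarter_turn_def F_def[symmetric])
  also have "\<dots> = (F t * \<omega> + \<kappa> / 2 * L t * (c t $ 2 * T1 t - c t $ 1 * T2 t)) / L t * (T1 t * T1 t + T2 t * T2 t)"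
    using Fpos[OF t] Lpos[OF t] by (simp add: T' c'T power2_eq_square field_simps)
  also have "\<dots> = F t * \<omega> / L t + \<kappa> / 2 * (c t $ 1 * m t $ 1 + c t $ 2 * m t $ 2)"
    using Lpos[OF t] by (simp add: Tu[OF t] m field_simps)
  finally have K: "K = \<omega> / L t"
    using Fpos[OF t] by (simp add: K_def euclidean_curvature_def F_def[symmetric])
  have "((\<lambda>t. m t $ 1) has_derivative (\<lambda>s. - K * (s * c' t $ 1))) (at t)"
    unfolding m12 using Lpos[OF t]
    by (intro has_derivative_eq_rhs[OF has_derivative_minus[OF dT(2)]]) (simp add: fun_eq_iff K T' c'T)
  moreover have "((\<lambda>t. m t $ 2) has_derivative (\<lambda>s. - K * (s * c' t $ 2))) (at t)"
    unfolding m12 using Lpos[OF t]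
    by (intro has_derivative_eq_rhs[OF dT(1)]) (simp add: fun_eq_iff K T' c'T)
  ultimately show "((\<lambda>t. m t $ i) has_derivative (\<lambda>s. - K * (s * c' t $ i))) (at t)"
    using exhaust_2[of i] by auto
qed

lemma constant_geodesic_curvature_imp_circle:
  assumes c: "regular_curve_in (base_domain \<kappa>) I c"
    and k: "\<And>t. t \<in> I \<Longrightarrow> geodesic_curvature (base_metric \<kappa>) c t = k"
  obtains K b1 b2 d where "b1\<^sup>2 + b2\<^sup>2 - 2 * K * d = 1"
    "\<And>t. t \<in> I \<Longrightarrow> circle_eq K b1 b2 d (c t $ 1) (c t $ 2) = 0"
proof (cases "I = {}")
  case True
  then show ?thesis using that[of 1 0 0 0] by auto
next
  case False
  define m where "m = euclidean_normal c"
  define C where "C t = osculating_circle \<kappa> k (c t $ 1) (c t $ 2) (m t $ 1) (m t $ 2)" for t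
  have conv: "convex I" using c by (simp add: regular_curve_in_def is_interval_convex_1)
  note fr = frenet[OF c]
  have "(C has_derivative (\<lambda>_. 0)) (at t)" if t: "t \<in> I" for t
  proof -
    have F: "bcv_F \<kappa> (c t $ 1) (c t $ 2) \<noteq> 0"
      using c t by (force simp: regular_curve_in_def base_domain_def)
    have p: "m t $ 1 * (s * vector_derivative c (at t) $ 1) + m t $ 2 * (s * vector_derivative c (at t) $ 2) = 0" for s
      using fr(3)[OF t] unfolding m_def by algebra
    have dc: "((\<lambda>t. c t $ i) has_derivative (\<lambda>s. s * vector_derivative c (at t) $ i)) (at t)" for i
      using has_derivative_component[OF fr(1)[OF t], of i] by simp
    define K where "K = (\<lambda>t. euclidean_curvature \<kappa> k (c t $ 1) (c t $ 2) (m t $ 1) (m t $ 2))"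
    have dm: "((\<lambda>t. m t $ i) has_derivative (\<lambda>s. - K t * (s * vector_derivative c (at t) $ i))) (at t)" for i
      using fr(2)[OF t, of i] by (simp add: m_def K_def k[OF t])
    show ?thesis
      unfolding C_def[abs_def] by (rule osculating_circle_constant[OF dc dc dm dm F K_def _ _ p]; simp)
  qed
  then have "\<exists>y. \<forall>t\<in>I. C t = y"
    using has_derivative_zero_constant[OF conv, of C] has_derivative_at_withinI by blast
  then obtain K b1 b2 d where C: "\<And>t. t \<in> I \<Longrightarrow> C t = (K, b1, b2, d)" by (metis prod_cases4)
  have "circle_eq K b1 b2 d (c t $ 1) (c t $ 2) = 0 \<and> b1\<^sup>2 + b2\<^sup>2 - 2 * K * d = 1" if t: "t \<in> I" for t
    using osculating_circle[OF fr(4)[OF t]] C[OF t] unfolding C_def m_def by blast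
  then show ?thesis using False that by blast
qed

text \<open>The prescribed velocity is the quarter turn of the unit normal \<open>(b\<^sub>1 - K c\<^sub>1, b\<^sub>2 - K c\<^sub>2)\<close> of the circle, so
  \<open>c\<close> has unit Euclidean speed. The last clause requires the whole part of the circle inside the base to
  be covered.\<close>

definition traverses_circle :: "real \<Rightarrow> real \<Rightarrow> real \<Rightarrow> real \<Rightarrow> real \<Rightarrow> real set \<Rightarrow> (real \<Rightarrow> real^2) \<Rightarrow> bool" where
  "traverses_circle \<kappa> K b1 b2 d I c \<longleftrightarrow> regular_curve_in (base_domain \<kappa>) I c \<and>
     (\<forall>t\<in>I. circle_eq K b1 b2 d (c t $ 1) (c t $ 2) = 0 \<and>
        vector_derivative c (at t) = vector [b2 - K * c t $ 2, - (b1 - K * c t $ 1)]) \<and>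
     (\<forall>q\<in>base_domain \<kappa>. circle_eq K b1 b2 d (q $ 1) (q $ 2) = 0 \<longrightarrow> q \<in> c ` I)"

lemma circle_geodesic_curvature:
  assumes unit: "b1\<^sup>2 + b2\<^sup>2 - 2 * K * d = 1" and trav: "traverses_circle \<kappa> K b1 b2 d I c" and t: "t \<in> I"
  shows "geodesic_curvature (base_metric \<kappa>) c t = K + \<kappa> / 2 * d"
proof -
  have c: "regular_curve_in (base_domain \<kappa>) I c"
    and circ: "\<And>t. t \<in> I \<Longrightarrow> circle_eq K b1 b2 d (c t $ 1) (c t $ 2) = 0"
    and c': "\<And>t. t \<in> I \<Longrightarrow> vector_derivative c (at t) = vector [b2 - K * c t $ 2, - (b1 - K * c t $ 1)]"
    using trav by (auto simp: traverses_circle_def)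
  note fr = frenet[OF c t]
  define m where "m = euclidean_normal c"
  define k where "k = geodesic_curvature (base_metric \<kappa>) c t"
  define L where "L = euclidean_curvature \<kappa> k (c t $ 1) (c t $ 2) (m t $ 1) (m t $ 2)"
  have I: "open I" using c by (simp add: regular_curve_in_def)
  have m: "m s = vector [b1 - K * c s $ 1, b2 - K * c s $ 2]" if s: "s \<in> I" for s
  proof -
    have "norm (vector_derivative c (at s)) = 1"
      using circle_normal_unit[OF unit circ[OF s]] by (simp add: c'[OF s] norm_real2 power2_eq_square algebra_simps)
    then show ?thesis by (simp add: m_def euclidean_normal_def c'[OF s] quarter_turn_def vec_eq_iff forall_2)
  qed
  have dc: "((\<lambda>t. c t $ i) has_derivative (\<lambda>s. s * vector_derivative c (at t) $ i)) (at t)" for i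
    using has_derivative_component[OF fr(1), of i] by simp
  have "L * vector_derivative c (at t) $ i = K * vector_derivative c (at t) $ i" for i
  proof -
    define b where "b = (if i = 1 then b1 else b2)"
    have "((\<lambda>t. b - K * c t $ i) has_derivative (\<lambda>s. 0 - K * (s * vector_derivative c (at t) $ i))) (at t)"
      by (intro has_derivative_diff has_derivative_const has_derivative_mult_right dc)
    then have "((\<lambda>t. m t $ i) has_derivative (\<lambda>s. 0 - K * (s * vector_derivative c (at t) $ i))) (at t)"
      by (rule has_derivative_transform_within_open[OF _ I t]) (use exhaust_2[of i] m in \<open>auto simp: b_def\<close>)
    then have "(\<lambda>s. 0 - K * (s * vector_derivative c (at t) $ i)) = (\<lambda>s. - L * (s * vector_derivative c (at t) $ i))"
      using has_derivative_unique fr(2)[of i] unfolding m_def L_def k_def by blast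
    from fun_cong[OF this, of 1] show ?thesis by auto
  qed
  moreover obtain i where "vector_derivative c (at t) $ i \<noteq> 0"
    using c t by (auto simp: regular_curve_in_def vec_eq_iff)
  ultimately have "L = K" by (metis mult_right_cancel)
  moreover have F: "bcv_F \<kappa> (c t $ 1) (c t $ 2) \<noteq> 0"
    using c t by (force simp: regular_curve_in_def base_domain_def)
  ultimately have "k = K * bcv_F \<kappa> (c t $ 1) (c t $ 2) + \<kappa> / 2 * (c t $ 1 * (b1 - K * c t $ 1) + c t $ 2 * (b2 - K * c t $ 2))"
    by (simp add: L_def euclidean_curvature_def m[OF t] field_simps)
  also have "\<dots> = K + \<kappa> / 2 * d - \<kappa> / 2 * circle_eq K b1 b2 d (c t $ 1) (c t $ 2)"
    by (simp add: bcv_F_def circle_eq_def power2_eq_square field_simps)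
  finally show ?thesis using circ[OF t] by (simp add: k_def)
qed

lemma (in bcv_surface) hopf_tube_imp_cmc:
  assumes "hopf_tube_const_geodesic_curvature \<kappa> M \<phi>"
  shows "cmc_surface \<kappa> \<tau> \<A> \<phi> N"
proof -
  obtain I c k where tube: "is_hopf_tube_over \<kappa> M \<phi> I c"
    and k: "\<And>t. t \<in> I \<Longrightarrow> geodesic_curvature (base_metric \<kappa>) c t = k"
    using assms unfolding hopf_tube_const_geodesic_curvature_def by blast
  then have c: "regular_curve_in (base_domain \<kappa>) I c" by (simp add: is_hopf_tube_over_def)
  obtain K b1 b2 d where circ: "b1\<^sup>2 + b2\<^sup>2 - 2 * K * d = 1"
    "\<And>t. t \<in> I \<Longrightarrow> circle_eq K b1 b2 d (c t $ 1) (c t $ 2) = 0"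
    by (rule constant_geodesic_curvature_imp_circle[OF c k that])
  have "circle_eq K b1 b2 d (\<phi> p $ 1) (\<phi> p $ 2) = 0" if p: "p \<in> M" for p
  proof -
    obtain U J where U: "p \<in> U" "J \<subseteq> I" "openin (top_of_set (hopf_tube \<kappa> c J)) (\<phi> ` U)"
      using tube p unfolding is_hopf_tube_over_def by blast
    then have "\<phi> p \<in> hopf_tube \<kappa> c J" using openin_imp_subset by blast
    then obtain t where "t \<in> I" "c t = hopf_fibration (\<phi> p)" using U by (auto simp: hopf_tube_def)
    then show ?thesis using circ(2)[of t] by (simp add: hopf_fibration_def)
  qed
  then have "projects_to_circle K b1 b2 d" using circ(1) by (simp add: projects_to_circle_def)
  then show ?thesis by (rule projects_to_circle_imp_cmc)
qed

section \<open>From the circle to the Hopf tube\<close>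

lemma Ck_on_trigonometric_curve:
  fixes A a b l :: "'a::real_normed_vector"
  assumes "open S"
  shows "Ck_on k S (\<lambda>t::real. A + cos (\<omega> * t) *\<^sub>R a + sin (\<omega> * t) *\<^sub>R b + t *\<^sub>R l)"
proof (induction k arbitrary: A a b l)
  case 0
  show ?case by (auto intro!: continuous_intros)
next
  case (Suc k)
  have d: "((\<lambda>t. A + cos (\<omega> * t) *\<^sub>R a + sin (\<omega> * t) *\<^sub>R b + t *\<^sub>R l) has_derivative
     (\<lambda>v. v *\<^sub>R l + cos (\<omega> * t) *\<^sub>R ((v * \<omega>) *\<^sub>R b) + sin (\<omega> * t) *\<^sub>R (- (v * \<omega>) *\<^sub>R a) + t *\<^sub>R 0)) (at t)" for t
    by (auto intro!: derivative_eq_intros simp: fun_eq_iff algebra_simps)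
  show ?case
    by (rule Ck_on_SucI[OF assms d Suc.IH])
qed

lemma smooth_on_trigonometric_curve:
  "open S \<Longrightarrow> smooth_on S (\<lambda>t::real. A + cos (\<omega> * t) *\<^sub>R a + sin (\<omega> * t) *\<^sub>R b + t *\<^sub>R l)"
  for A a b l :: "'a::real_normed_vector"
  unfolding smooth_on_def using Ck_on_trigonometric_curve by blast

text \<open>The line meets the base in a segment: on it \<open>F\<close> is concave if \<open>\<kappa> < 0\<close> and positive otherwise.\<close>

lemma circle_parametrization_line:
  fixes p0 :: "real^2"
  assumes unit: "b1\<^sup>2 + b2\<^sup>2 = (1::real)" and p0: "circle_eq 0 b1 b2 d (p0 $ 1) (p0 $ 2) = 0"
  obtains I c where "traverses_circle \<kappa> 0 b1 b2 d I c"
proof -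
  define l :: "real^2" where "l = vector [b2, - b1]"
  define c where "c t = p0 + t *\<^sub>R l" for t
  define f where "f t = bcv_F \<kappa> (c t $ 1) (c t $ 2)" for t
  define I where "I = {t. f t > 0}"
  have f: "f t = 1 + \<kappa> / 4 * ((p0 $ 1 + t * b2)\<^sup>2 + (p0 $ 2 - t * b1)\<^sup>2)" for t
    by (simp add: f_def bcv_F_def c_def l_def)
  have "open I" unfolding I_def f by (intro open_Collect_less continuous_intros)
  have conv: "convex I"
  proof (cases "\<kappa> \<ge> 0")
    case True
    then have "I = UNIV" by (auto simp: I_def f add_pos_nonneg)
    then show ?thesis by simp
  next
    case False
    show ?thesis
    proof (rule convexI)
      fix s t u v :: real assume st: "s \<in> I" "t \<in> I" and uv: "0 \<le> u" "0 \<le> v" "u + v = 1"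
      have v: "v = 1 - u" using uv by simp
      have "f (u * s + v * t) = u * f s + v * f t - \<kappa> / 4 * (u * v * (s - t)\<^sup>2) * (b1\<^sup>2 + b2\<^sup>2)"
        unfolding f v by (simp add: power2_eq_square field_simps)
      moreover have "- (\<kappa> / 4 * (u * v * (s - t)\<^sup>2)) \<ge> 0"
        using False uv by (simp add: mult_nonpos_nonneg)
      moreover have "u * f s + v * f t > 0"
        using st uv by (cases "u = 0") (auto simp: I_def intro!: add_pos_nonneg mult_pos_pos)
      ultimately show "u *\<^sub>R s + v *\<^sub>R t \<in> I" using unit by (simp add: I_def)
    qed
  qed
  have dc: "vector_derivative c (at t) = l" for t
    unfolding c_def[abs_def] by (rule vector_derivative_at) (auto intro!: derivative_eq_intros)
  have "l \<noteq> 0" using unit by (auto simp: l_def vec_eq_iff forall_2)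
  have "smooth_on I c"
    using smooth_on_trigonometric_curve[OF \<open>open I\<close>, of p0 0 0 0 l] by (simp add: c_def[abs_def])
  then have "regular_curve_in (base_domain \<kappa>) I c"
    using \<open>open I\<close> conv \<open>l \<noteq> 0\<close> dc
    by (auto simp: regular_curve_in_def is_interval_convex_1 I_def f_def base_domain_def)
  moreover have "circle_eq 0 b1 b2 d (c t $ 1) (c t $ 2) = 0" for t
    using p0 by (simp add: circle_eq_def c_def l_def algebra_simps)
  moreover have "q \<in> c ` I" if q: "q \<in> base_domain \<kappa>" "circle_eq 0 b1 b2 d (q $ 1) (q $ 2) = 0" for q
  proof -
    define t where "t = (q $ 1 - p0 $ 1) * b2 - (q $ 2 - p0 $ 2) * b1"
    have e: "(q $ 1 - p0 $ 1) * b1 + (q $ 2 - p0 $ 2) * b2 = 0"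
      using p0 q(2) by (simp add: circle_eq_def algebra_simps)
    have "q $ 1 = p0 $ 1 + t * b2" "q $ 2 = p0 $ 2 - t * b1"
      using e unit unfolding t_def by algebra+
    then have "q = c t" by (simp add: c_def l_def vec_eq_iff forall_2)
    then show ?thesis using q(1) by (auto simp: I_def f_def base_domain_def)
  qed
  ultimately show ?thesis using that[of I c] by (simp add: traverses_circle_def dc l_def)
qed

lemma unit_direction_exists:
  obtains \<beta> e1 e2 :: real where "\<beta> \<ge> 0" "e1\<^sup>2 + e2\<^sup>2 = 1" "b1 = \<beta> * e1" "b2 = \<beta> * e2"
proof (cases "b1\<^sup>2 + b2\<^sup>2 = 0")
  case True
  then show ?thesis using that[of 0 1 0] by (simp add: sum_power2_eq_zero_iff)
next
  case False
  define \<beta> where "\<beta> = sqrt (b1\<^sup>2 + b2\<^sup>2)"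
  have "\<beta> > 0" using False by (simp add: \<beta>_def sum_power2_gt_zero_iff sum_power2_eq_zero_iff)
  moreover have "\<beta>\<^sup>2 = b1\<^sup>2 + b2\<^sup>2" by (simp add: \<beta>_def)
  moreover have "(b1 / \<beta>)\<^sup>2 + (b2 / \<beta>)\<^sup>2 = (b1\<^sup>2 + b2\<^sup>2) / \<beta>\<^sup>2"
    by (simp add: power_divide add_divide_distrib)
  ultimately show ?thesis
    using that[of \<beta> "b1 / \<beta>" "b2 / \<beta>"] False by simp
qed

lemma unit_vector_angle:
  assumes "x\<^sup>2 + y\<^sup>2 = (1::real)"
  obtains t where "\<bar>t\<bar> \<le> pi" "x = cos t" "y = sin t"
proof (cases "y \<ge> 0")
  case True
  then show ?thesis using sincos_total_pi[OF True] assms that by (metis abs_of_nonneg)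
next
  case False
  then obtain t where "0 \<le> t" "t \<le> pi" "x = cos t" "- y = sin t"
    using sincos_total_pi[of "- y" x] assms by auto
  then show ?thesis using that[of "- t"] by auto
qed

text \<open>With the angle of the normal measured from the direction of \<open>(b\<^sub>1, b\<^sub>2)\<close>, the function \<open>F\<close> along the circle is \<open>P + R cos (K t)\<close>. Either
  this is always positive and the whole circle lies in the base, or \<open>\<kappa> < 0\<close>, \<open>R \<ge> 0\<close> and the part inside
  the disc is an arc symmetric about the angle 0, where \<open>F\<close> is largest; it stays away from the angle \<open>\<pi>\<close>.\<close>

lemma circle_parametrization_circle:
  assumes unit: "b1\<^sup>2 + b2\<^sup>2 - 2 * K * d = (1::real)" and K: "K \<noteq> 0"
  obtains I c where "traverses_circle \<kappa> K b1 b2 d I c"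
proof -
  obtain \<beta> e1 e2 :: real where e: "\<beta> \<ge> 0" "e1\<^sup>2 + e2\<^sup>2 = 1" "b1 = \<beta> * e1" "b2 = \<beta> * e2"
    using unit_direction_exists .
  define A0 a b :: "real^2" where "A0 = vector [b1 / K, b2 / K]"
    and "a = vector [- e1 / K, - e2 / K]" and "b = vector [e2 / K, - e1 / K]"
  define c where "c t = A0 + cos (K * t) *\<^sub>R a + sin (K * t) *\<^sub>R b + t *\<^sub>R 0" for t
  have q: "b1 - K * c t $ 1 = cos (K * t) * e1 - sin (K * t) * e2"
    "b2 - K * c t $ 2 = cos (K * t) * e2 + sin (K * t) * e1" for t
    using K by (simp_all add: c_def A0_def a_def b_def field_simps)
  have circ: "circle_eq K b1 b2 d (c t $ 1) (c t $ 2) = 0" for t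
  proof -
    have "2 * K * circle_eq K b1 b2 d (c t $ 1) (c t $ 2)
        = (b1 - K * c t $ 1)\<^sup>2 + (b2 - K * c t $ 2)\<^sup>2 - (b1\<^sup>2 + b2\<^sup>2 - 2 * K * d)"
      by (simp add: circle_eq_def power2_eq_square algebra_simps)
    also have "(b1 - K * c t $ 1)\<^sup>2 + (b2 - K * c t $ 2)\<^sup>2 = ((cos (K * t))\<^sup>2 + (sin (K * t))\<^sup>2) * (e1\<^sup>2 + e2\<^sup>2)"
      unfolding q by algebra
    finally show ?thesis using K by (simp add: unit e(2))
  qed
  have dc: "vector_derivative c (at t) = vector [b2 - K * c t $ 2, - (b1 - K * c t $ 1)]" for t
  proof -
    have "(c has_vector_derivative (- (K * sin (K * t))) *\<^sub>R a + (K * cos (K * t)) *\<^sub>R b) (at t)"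
      unfolding c_def[abs_def] has_vector_derivative_def
      by (auto intro!: derivative_eq_intros simp: fun_eq_iff algebra_simps)
    moreover have "(- (K * sin (K * t))) *\<^sub>R a + (K * cos (K * t)) *\<^sub>R b = vector [b2 - K * c t $ 2, - (b1 - K * c t $ 1)]"
      unfolding q using K by (simp add: a_def b_def vec_eq_iff forall_2)
    ultimately show ?thesis using vector_derivative_at by metis
  qed
  have dc0: "vector_derivative c (at t) \<noteq> 0" for t
    using circle_normal_unit[OF unit circ[of t]] by (auto simp: dc vec_eq_iff forall_2)
  define P R where "P = 1 + \<kappa> * (\<beta>\<^sup>2 + 1) / (4 * K\<^sup>2)" and "R = - \<kappa> * \<beta> / (2 * K\<^sup>2)"
  have F: "bcv_F \<kappa> (c t $ 1) (c t $ 2) = P + R * cos (K * t)" for t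
  proof -
    have "K\<^sup>2 * ((c t $ 1)\<^sup>2 + (c t $ 2)\<^sup>2)
       = (b1 - (b1 - K * c t $ 1))\<^sup>2 + (b2 - (b2 - K * c t $ 2))\<^sup>2"
      by (simp add: power2_eq_square algebra_simps)
    also have "\<dots> = (\<beta>\<^sup>2 + ((cos (K * t))\<^sup>2 + (sin (K * t))\<^sup>2) - 2 * \<beta> * cos (K * t)) * (e1\<^sup>2 + e2\<^sup>2)"
      unfolding q unfolding e(3,4) by algebra
    finally have "K\<^sup>2 * ((c t $ 1)\<^sup>2 + (c t $ 2)\<^sup>2) = \<beta>\<^sup>2 + 1 - 2 * \<beta> * cos (K * t)"
      by (simp add: e(2))
    then have sq: "(c t $ 1)\<^sup>2 + (c t $ 2)\<^sup>2 = (\<beta>\<^sup>2 + 1 - 2 * \<beta> * cos (K * t)) / K\<^sup>2"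
      using K by (simp add: field_simps)
    show ?thesis unfolding bcv_F_def sq using K by (simp add: P_def R_def field_simps)
  qed
  have sm: "smooth_on I c" if "open I" for I
    unfolding c_def[abs_def] by (rule smooth_on_trigonometric_curve[OF that])
  have onto: "\<exists>t. \<bar>K * t\<bar> \<le> pi \<and> q = c t" if "circle_eq K b1 b2 d (q $ 1) (q $ 2) = 0" for q :: "real^2"
  proof -
    define x y where "x = (b1 - K * q $ 1) * e1 + (b2 - K * q $ 2) * e2"
      and "y = (b2 - K * q $ 2) * e1 - (b1 - K * q $ 1) * e2"
    have "x\<^sup>2 + y\<^sup>2 = ((b1 - K * q $ 1)\<^sup>2 + (b2 - K * q $ 2)\<^sup>2) * (e1\<^sup>2 + e2\<^sup>2)"
      unfolding x_def y_def by (simp add: power2_eq_square algebra_simps)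
    then have "x\<^sup>2 + y\<^sup>2 = 1" using circle_normal_unit[OF unit that] e(2) by simp
    then obtain s where s: "\<bar>s\<bar> \<le> pi" "x = cos s" "y = sin s" by (rule unit_vector_angle)
    have "b1 - K * q $ 1 = x * e1 - y * e2" "b2 - K * q $ 2 = x * e2 + y * e1"
      using e(2) unfolding x_def y_def by algebra+
    then have "b1 - K * q $ 1 = b1 - K * c (s / K) $ 1" "b2 - K * q $ 2 = b2 - K * c (s / K) $ 2"
      unfolding q using K s by simp_all
    then have "q = c (s / K)" using K by (simp add: vec_eq_iff forall_2)
    then show ?thesis using s K by (intro exI[of _ "s / K"]) simp
  qed
  show ?thesis
  proof (cases "\<forall>t. P + R * cos (K * t) > 0")
    case True
    have "regular_curve_in (base_domain \<kappa>) UNIV c"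
      using sm dc0 True by (auto simp: regular_curve_in_def base_domain_def F)
    then show ?thesis using that[of UNIV c] circ dc onto unfolding traverses_circle_def by blast
  next
    case False
    then obtain t0 where t0: "P + R * cos (K * t0) \<le> 0" by (auto simp: not_less)
    have \<kappa>: "\<kappa> < 0"
    proof (rule ccontr)
      assume "\<not> \<kappa> < 0"
      then have "bcv_F \<kappa> (c t0 $ 1) (c t0 $ 2) > 0" by (simp add: bcv_F_def add_pos_nonneg)
      then show False using t0 by (simp add: F)
    qed
    then have R: "R \<ge> 0" using e(1) by (simp add: R_def divide_nonpos_nonneg mult_nonpos_nonneg)
    have "R * (- 1) \<le> R * cos (K * t0)" using R by (intro mult_left_mono) auto
    then have PR: "P - R \<le> 0" using t0 by simp
    define I where "I = {t. \<bar>K * t\<bar> < pi \<and> P + R * cos (K * t) > 0}"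
    have "I = {t. \<bar>K * t\<bar> < pi} \<inter> {t. P + R * cos (K * t) > 0}" by (auto simp: I_def)
    moreover have "open {t. \<bar>K * t\<bar> < pi}" "open {t. P + R * cos (K * t) > 0}"
      by (intro open_Collect_less continuous_intros)+
    ultimately have "open I" by (simp add: open_Int)
    have "is_interval I"
      unfolding is_interval_1
    proof (intro ballI allI impI)
      fix s t x assume st: "s \<in> I" "t \<in> I" and x: "s \<le> x \<and> x \<le> t"
      have "\<bar>K * x\<bar> \<le> \<bar>K * s\<bar> \<or> \<bar>K * x\<bar> \<le> \<bar>K * t\<bar>"
      proof -
        have "\<bar>x\<bar> \<le> \<bar>s\<bar> \<or> \<bar>x\<bar> \<le> \<bar>t\<bar>" using x by linarith
        then show ?thesis by (auto simp: abs_mult mult_left_mono)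
      qed
      then obtain w where w: "w \<in> I" "\<bar>K * x\<bar> \<le> \<bar>K * w\<bar>" using st by blast
      then have "cos \<bar>K * w\<bar> \<le> cos \<bar>K * x\<bar>" by (intro cos_monotone_0_pi_le) (auto simp: I_def)
      then have "R * cos (K * w) \<le> R * cos (K * x)" using R by (simp add: mult_left_mono)
      then show "x \<in> I" using w by (simp add: I_def)
    qed
    then have "regular_curve_in (base_domain \<kappa>) I c"
      using sm dc0 \<open>open I\<close> by (auto simp: regular_curve_in_def base_domain_def F I_def)
    moreover have "q \<in> c ` I" if q: "q \<in> base_domain \<kappa>" "circle_eq K b1 b2 d (q $ 1) (q $ 2) = 0" for q
    proof -
      obtain t where t: "\<bar>K * t\<bar> \<le> pi" "q = c t" using onto[OF q(2)] by blast
      have pos: "P + R * cos (K * t) > 0" using q(1) by (simp add: t(2) base_domain_def F)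
      have "\<bar>K * t\<bar> \<noteq> pi"
      proof
        assume "\<bar>K * t\<bar> = pi"
        then have "cos (K * t) = - 1" by (metis cos_abs_real cos_pi)
        then show False using pos PR by simp
      qed
      then show ?thesis using t pos by (auto simp: I_def)
    qed
    ultimately show ?thesis using that[of I c] circ dc unfolding traverses_circle_def by blast
  qed
qed

lemma open_image_regular:
  fixes f :: "'a::euclidean_space \<Rightarrow> 'a"
  assumes S: "open S" and d: "\<And>x. x \<in> S \<Longrightarrow> (f has_derivative f' x) (at x)" and inj: "\<And>x. x \<in> S \<Longrightarrow> inj (f' x)"
  shows "open (f ` S)"
proof -
  have cont: "continuous_on S f"
    using d by (intro continuous_at_imp_continuous_on ballI has_derivative_continuous)
  have "f x \<in> interior (f ` S)" if x: "x \<in> S" for x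
  proof -
    obtain g where g: "linear g" "\<forall>y. f' x (g y) = y"
      using linear_injective_isomorphism[OF has_derivative_linear[OF d[OF x]] inj[OF x]] by blast
    show ?thesis
      by (rule sussmann_open_mapping[OF S cont x d[OF x] linear_linear[THEN iffD2, OF g(1)]])
        (use g x S in \<open>auto simp: fun_eq_iff interior_open\<close>)
  qed
  then show ?thesis by (metis (no_types, lifting) image_subsetI interior_subset open_interior subset_antisym)
qed

text \<open>Coordinates adapted to a point of the circle: \<open>a\<close> along the tangent and \<open>h\<close> along the normal. On the
  part of the circle where \<open>K h < 1\<close> the coordinate \<open>a\<close> determines the point.\<close>

lemma circle_graph:
  assumes unit: "b1\<^sup>2 + b2\<^sup>2 - 2 * K * d = (1::real)"
    and 0: "circle_eq K b1 b2 d x0 y0 = 0" and m: "m1 = b1 - K * x0" "m2 = b2 - K * y0"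
    and X: "circle_eq K b1 b2 d X Y = 0" "K * ((X - x0) * m1 + (Y - y0) * m2) < 1"
    and X': "circle_eq K b1 b2 d X' Y' = 0" "K * ((X' - x0) * m1 + (Y' - y0) * m2) < 1"
    and a: "(X - x0) * m2 - (Y - y0) * m1 = (X' - x0) * m2 - (Y' - y0) * m1"
  shows "X = X' \<and> Y = Y'"
proof -
  have mu: "m1\<^sup>2 + m2\<^sup>2 = 1" using circle_normal_unit[OF unit 0] by (simp add: m)
  have rel: "(X - x0) * m1 + (Y - y0) * m2 = K / 2 * (((X - x0) * m2 - (Y - y0) * m1)\<^sup>2 + ((X - x0) * m1 + (Y - y0) * m2)\<^sup>2)"
    if "circle_eq K b1 b2 d X Y = 0" for X Y
  proof -
    have "K / 2 * ((X - x0)\<^sup>2 + (Y - y0)\<^sup>2) - ((X - x0) * m1 + (Y - y0) * m2)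
        = circle_eq K b1 b2 d X Y - circle_eq K b1 b2 d x0 y0"
      by (simp add: circle_eq_def m power2_eq_square field_simps)
    then have "(X - x0) * m1 + (Y - y0) * m2 = K / 2 * (((X - x0)\<^sup>2 + (Y - y0)\<^sup>2) * (m1\<^sup>2 + m2\<^sup>2))"
      using that 0 mu by simp
    then show ?thesis by (simp add: power2_eq_square algebra_simps)
  qed
  define h h' where "h = (X - x0) * m1 + (Y - y0) * m2" and "h' = (X' - x0) * m1 + (Y' - y0) * m2"
  have "h - h' = K / 2 * (h\<^sup>2 - h'\<^sup>2)"
    using rel[OF X(1)] rel[OF X'(1)] unfolding a h_def[symmetric] h'_def[symmetric] by (simp add: algebra_simps)
  then have "(h - h') * (2 - (K * h + K * h')) = 0" by (simp add: power2_eq_square algebra_simps)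
  moreover have "2 - (K * h + K * h') > 0" using X(2) X'(2) by (simp add: h_def h'_def)
  ultimately have "h = h'" by simp
  then show ?thesis using a mu unfolding h_def h'_def by algebra
qed

text \<open>Near a point of the surface the tube over a short arc of the circle is a graph over its coordinates
  \<open>(a, z)\<close>. In these coordinates the surface becomes a map \<open>\<real>\<^sup>2 \<rightarrow> \<real>\<^sup>2\<close> with injective differential, because both the
  surface and the tube are tangent to the kernel of the differential of the circle equation; such a map
  has open image.\<close>

lemma (in bcv_surface) circle_imp_hopf_tube:
  assumes proj: "projects_to_circle K b1 b2 d"
    and trav: "traverses_circle \<kappa> K b1 b2 d I c"
  shows "is_hopf_tube_over \<kappa> M \<phi> I c"
  unfolding is_hopf_tube_over_def
proof (intro conjI ballI)
  show c: "regular_curve_in (base_domain \<kappa>) I c" using trav by (simp add: traverses_circle_def)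
  have circ: "\<And>t. t \<in> I \<Longrightarrow> circle_eq K b1 b2 d (c t $ 1) (c t $ 2) = 0"
    and c': "\<And>t. t \<in> I \<Longrightarrow> vector_derivative c (at t) = vector [b2 - K * c t $ 2, - (b1 - K * c t $ 1)]"
    and onto: "\<And>q. q \<in> base_domain \<kappa> \<Longrightarrow> circle_eq K b1 b2 d (q $ 1) (q $ 2) = 0 \<Longrightarrow> q \<in> c ` I"
    using trav by (auto simp: traverses_circle_def)
  have circ_unit: "b1\<^sup>2 + b2\<^sup>2 - 2 * K * d = 1"
    and circM: "\<And>p. p \<in> M \<Longrightarrow> circle_eq K b1 b2 d (\<phi> p $ 1) (\<phi> p $ 2) = 0"
    using proj unfolding projects_to_circle_def by auto
  have I: "open I" using c by (simp add: regular_curve_in_def)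
  have dom: "\<phi> p \<in> bcv_domain \<kappa>" if "p \<in> M" for p
    using surface that unfolding bcv_immersed_surface_def immersion_in_def by auto
  have proj_dom: "hopf_fibration q \<in> base_domain \<kappa>" if "q \<in> bcv_domain \<kappa>" for q
    using that by (simp add: hopf_fibration_def bcv_domain_def base_domain_def)
  fix p assume p: "p \<in> M"
  obtain D x u0 where ch: "(D, x) \<in> \<A>" "u0 \<in> D" "x u0 = p" using in_chart[OF p] .
  interpret surface_patch \<kappa> \<tau> D "\<phi> \<circ> x" "N \<circ> x" by (rule patch[OF ch(1)])
  define x0 y0 where "x0 = \<phi> p $ 1" and "y0 = \<phi> p $ 2"
  define m1 m2 where "m1 = b1 - K * x0" and "m2 = b2 - K * y0"
  have circ0: "circle_eq K b1 b2 d x0 y0 = 0" using circM[OF p] by (simp add: x0_def y0_def)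
  have mu: "m1\<^sup>2 + m2\<^sup>2 = 1" using circle_normal_unit[OF circ_unit circ0] by (simp add: m1_def m2_def)
  define a where "a X Y = (X - x0) * m2 - (Y - y0) * m1" for X Y
  define h where "h X Y = (X - x0) * m1 + (Y - y0) * m2" for X Y
  have graph: "X = X' \<and> Y = Y'" if "circle_eq K b1 b2 d X Y = 0" "K * h X Y < 1"
    "circle_eq K b1 b2 d X' Y' = 0" "K * h X' Y' < 1" "a X Y = a X' Y'" for X Y X' Y'
    using circle_graph[OF circ_unit circ0 m1_def m2_def] that unfolding a_def h_def by blast
  have qm: "(b1 - K * X) * m1 + (b2 - K * Y) * m2 = 1 - K * h X Y" for X Y
    using mu unfolding h_def m1_def m2_def by algebra
  have "hopf_fibration (\<phi> p) \<in> c ` I"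
    by (rule onto[OF proj_dom[OF dom[OF p]]]) (use circM[OF p] in \<open>simp add: hopf_fibration_def\<close>)
  then obtain t0 where t0I: "t0 \<in> I" "hopf_fibration (\<phi> p) = c t0" by blast
  have t0: "t0 \<in> I" "c t0 $ 1 = x0" "c t0 $ 2 = y0"
    unfolding t0I(2)[symmetric] using t0I(1) by (simp_all add: hopf_fibration_def x0_def y0_def)
  have dc: "((\<lambda>t. c t $ i) has_derivative (\<lambda>s. s * vector_derivative c (at t) $ i)) (at t)" if "t \<in> I" for i t
    using has_derivative_component[OF frenet(1)[OF c that], of i] by simp
  have cc: "continuous_on I (\<lambda>t. c t $ i)" for i
    using dc by (intro continuous_at_imp_continuous_on ballI has_derivative_continuous)
  \<comment> \<open>the arc on which the coordinate \<open>a\<close> determines the point\<close>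
  define I' where "I' = {t \<in> I. K * h (c t $ 1) (c t $ 2) < 1}"
  have "open I'"
  proof -
    have "continuous_on I (\<lambda>t. K * h (c t $ 1) (c t $ 2))"
      unfolding h_def by (intro continuous_intros cc)
    then have "open (I \<inter> (\<lambda>t. K * h (c t $ 1) (c t $ 2)) -` {..<1})"
      using I by (intro continuous_open_preimage) auto
    moreover have "I \<inter> (\<lambda>t. K * h (c t $ 1) (c t $ 2)) -` {..<1} = I'" by (auto simp: I'_def)
    ultimately show ?thesis by simp
  qed
  moreover have "t0 \<in> I'" using t0 by (simp add: I'_def h_def)
  ultimately obtain e where e: "e > 0" "ball t0 e \<subseteq> I'" using openE by blast
  define J where "J = ball t0 e"
  have J: "open J" "is_interval J" "J \<subseteq> I" "t0 \<in> J" and JI': "J \<subseteq> I'"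
    using e by (auto simp: J_def is_interval_ball_real I'_def)
  define A where "A = (\<lambda>t. a (c t $ 1) (c t $ 2)) ` J"
  have "open A"
    unfolding A_def
  proof (rule open_image_regular[OF J(1)])
    fix t assume "t \<in> J"
    then have t: "t \<in> I" "K * h (c t $ 1) (c t $ 2) < 1" using JI' by (auto simp: I'_def)
    show "((\<lambda>t. a (c t $ 1) (c t $ 2)) has_derivative (\<lambda>s. s * (1 - K * h (c t $ 1) (c t $ 2)))) (at t)"
      unfolding a_def
      by (rule has_derivative_eq_rhs[OF has_derivative_diff[OF
            has_derivative_mult_left[OF has_derivative_diff[OF dc[OF t(1)] has_derivative_const]]
            has_derivative_mult_left[OF has_derivative_diff[OF dc[OF t(1)] has_derivative_const]]]])
        (simp add: fun_eq_iff c'[OF t(1)] qm[symmetric] algebra_simps)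
    show "inj (\<lambda>s. s * (1 - K * h (c t $ 1) (c t $ 2)))" using t(2) by (auto simp: inj_def)
  qed
  \<comment> \<open>\<open>u\<close> belongs to \<open>U\<close> if its image lies over the arc \<open>c ` J\<close>\<close>
  define U where "U = {u \<in> D. K * h (X u) (Y u) < 1 \<and> a (X u) (Y u) \<in> A}"
  have cX: "continuous_on D (\<lambda>u. (\<phi> \<circ> x) u $ i)" for i by (rule smooth_on_continuous[OF smooth_r_component])
  have "open U"
  proof -
    have "continuous_on D (\<lambda>u. K * h (X u) (Y u))" "continuous_on D (\<lambda>u. a (X u) (Y u))"
      unfolding h_def a_def by (intro continuous_intros cX)+
    then have op: "open (D \<inter> (\<lambda>u. K * h (X u) (Y u)) -` {..<1})" "open (D \<inter> (\<lambda>u. a (X u) (Y u)) -` A)"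
      using open_D \<open>open A\<close> by (auto intro!: continuous_open_preimage)
    have eq: "(D \<inter> (\<lambda>u. K * h (X u) (Y u)) -` {..<1}) \<inter> (D \<inter> (\<lambda>u. a (X u) (Y u)) -` A) = U"
      by (auto simp: U_def)
    show ?thesis using open_Int[OF op] unfolding eq .
  qed
  have "U \<subseteq> D" by (auto simp: U_def)
  have "u0 \<in> U"
    using ch t0 J(4) by (auto simp: U_def h_def x0_def y0_def A_def image_iff intro!: bexI[of _ t0])
  define G :: "real^3 \<Rightarrow> real^2" where "G q = vector [a (q $ 1) (q $ 2), q $ 3]" for q
  have "open ((\<lambda>u. G ((\<phi> \<circ> x) u)) ` U)"
  proof (rule open_image_regular[OF \<open>open U\<close>])
    fix u assume "u \<in> U"
    then have u: "u \<in> D" "K * h (X u) (Y u) < 1" by (auto simp: U_def)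
    let ?dX = "exterior X u" and ?dY = "exterior Y u" and ?dZ = "exterior (\<lambda>u. (\<phi> \<circ> x) u $ 3) u"
    let ?G' = "\<lambda>v. vector [?dX v * m2 - ?dY v * m1, ?dZ v] :: real^2"
    note dX = exterior_has_derivative[OF smooth_r_component u(1)]
    show G': "((\<lambda>u. G ((\<phi> \<circ> x) u)) has_derivative ?G') (at u)"
      unfolding G_def a_def
      by (rule has_derivative_eq_rhs[OF has_derivative_vector_2[OF has_derivative_diff[OF
            has_derivative_mult_left[OF has_derivative_diff[OF dX has_derivative_const]]
            has_derivative_mult_left[OF has_derivative_diff[OF dX has_derivative_const]]] dX]])
        (simp add: fun_eq_iff)
    show "inj ?G'"
      unfolding linear_injective_0[OF has_derivative_linear[OF G']]
    proof (intro allI impI)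
      fix v assume "?G' v = 0"
      then have z: "?dX v * m2 - ?dY v * m1 = 0" "?dZ v = 0" by (simp_all add: vec_eq_iff forall_2)
      have "(b1 - K * X u) * ?dX v + (b2 - K * Y u) * ?dY v = 0" by (rule circle_tangency[OF proj ch(1) u(1)])
      then have "((b1 - K * X u) * m1 + (b2 - K * Y u) * m2) * ?dX v = 0"
        "((b1 - K * X u) * m1 + (b2 - K * Y u) * m2) * ?dY v = 0"
        using z(1) by algebra+
      then have "?dX v = 0" "?dY v = 0" using u(2) unfolding qm by simp_all
      then have "frechet_derivative (\<phi> \<circ> x) (at u) v = 0"
        using z(2) unfolding exterior_component[OF u(1)] by (simp add: vec_eq_iff forall_3)
      then show "v = 0"
        using immersion[OF u(1)] linear_0[OF has_derivative_linear[OF r_deriv[OF u(1)]]] by (metis injD)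
    qed
  qed
  moreover have "continuous_on (hopf_tube \<kappa> c J) G"
  proof -
    have "G = (\<lambda>q. \<chi> i. if i = 1 then a (q $ 1) (q $ 2) else q $ 3)"
      by (auto simp: fun_eq_iff G_def vec_eq_iff forall_2)
    moreover have "continuous_on (hopf_tube \<kappa> c J) (\<lambda>q. if i = 1 then a (q $ 1) (q $ 2) else q $ 3)" for i :: 2
      unfolding a_def by (cases "i = 1") (simp_all, (intro continuous_intros)+)
    ultimately show ?thesis by (simp add: continuous_on_vec_lambda)
  qed
  ultimately have "openin (top_of_set (hopf_tube \<kappa> c J)) (hopf_tube \<kappa> c J \<inter> G -` ((\<lambda>u. G ((\<phi> \<circ> x) u)) ` U))"
    by (rule continuous_openin_preimage_gen[rotated])
  moreover have "hopf_tube \<kappa> c J \<inter> G -` ((\<lambda>u. G ((\<phi> \<circ> x) u)) ` U) = \<phi> ` (x ` U)"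
  proof (intro equalityI subsetI)
    fix q assume "q \<in> hopf_tube \<kappa> c J \<inter> G -` ((\<lambda>u. G ((\<phi> \<circ> x) u)) ` U)"
    then obtain t u where tu: "t \<in> J" "hopf_fibration q = c t" "u \<in> U" "G q = G ((\<phi> \<circ> x) u)"
      by (auto simp: hopf_tube_def)
    have q12: "q $ 1 = c t $ 1" "q $ 2 = c t $ 2" using tu(2)[symmetric] by (simp_all add: hopf_fibration_def)
    have t: "t \<in> I" "K * h (c t $ 1) (c t $ 2) < 1" using tu(1) JI' by (auto simp: I'_def)
    have u: "u \<in> D" "K * h (X u) (Y u) < 1" "x u \<in> M" using tu(3) chart(4)[OF ch(1)] by (auto simp: U_def)
    have "a (q $ 1) (q $ 2) = a (X u) (Y u)" "q $ 3 = (\<phi> \<circ> x) u $ 3"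
      using tu(4) by (simp_all add: G_def vec_eq_iff forall_2)
    moreover then have "c t $ 1 = X u \<and> c t $ 2 = Y u"
      using graph[OF circ[OF t(1)] t(2) _ u(2)] circM[OF u(3)] by (simp add: q12)
    ultimately have "q = \<phi> (x u)" by (simp add: vec_eq_iff forall_3 q12)
    then show "q \<in> \<phi> ` (x ` U)" using tu(3) by blast
  next
    fix q assume "q \<in> \<phi> ` (x ` U)"
    then obtain u where uU: "u \<in> U" and q: "q = \<phi> (x u)" by blast
    then have u: "u \<in> D" "K * h (X u) (Y u) < 1" "a (X u) (Y u) \<in> A" "x u \<in> M"
      using chart(4)[OF ch(1)] by (auto simp: U_def)
    then obtain t where t: "t \<in> J" "a (X u) (Y u) = a (c t $ 1) (c t $ 2)" by (auto simp: A_def)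
    have tI: "t \<in> I" "K * h (c t $ 1) (c t $ 2) < 1" using t(1) JI' by (auto simp: I'_def)
    have "X u = c t $ 1 \<and> Y u = c t $ 2"
      using graph[OF _ u(2) circ[OF tI(1)] tI(2) t(2)] circM[OF u(4)] by simp
    then have "hopf_fibration q = c t" by (simp add: hopf_fibration_def q vec_eq_iff forall_2)
    then have "q \<in> hopf_tube \<kappa> c J" using t(1) dom[OF u(4)] q by (auto simp: hopf_tube_def)
    then show "q \<in> hopf_tube \<kappa> c J \<inter> G -` ((\<lambda>u. G ((\<phi> \<circ> x) u)) ` U)" using uU q by auto
  qed
  ultimately have "openin (top_of_set (hopf_tube \<kappa> c J)) (\<phi> ` (x ` U))" by simp
  moreover have "openin (top_of_set M) (x ` U)" by (rule open_chart_image[OF ch(1) \<open>open U\<close> \<open>U \<subseteq> D\<close>])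
  moreover have "p \<in> x ` U" using \<open>u0 \<in> U\<close> ch(3) by blast
  ultimately show "\<exists>U J. openin (top_of_set M) U \<and> p \<in> U \<and>
        open J \<and> is_interval J \<and> J \<subseteq> I \<and> openin (top_of_set (hopf_tube \<kappa> c J)) (\<phi> ` U)"
    using J by blast
qed

lemma (in biconservative_bcv_surface) cmc_imp_hopf_tube:
  assumes "cmc_surface \<kappa> \<tau> \<A> \<phi> N"
  shows "hopf_tube_const_geodesic_curvature \<kappa> M \<phi>"
proof -
  obtain f where "\<forall>p\<in>M. mc p = f" using assms cmc_iff by blast
  then obtain K b1 b2 d where proj: "projects_to_circle K b1 b2 d" using cmc_imp_projects_to_circle by blast
  then have unit: "b1\<^sup>2 + b2\<^sup>2 - 2 * K * d = 1" by (simp add: projects_to_circle_def)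
  obtain p where p: "p \<in> M" using M_nonempty by blast
  obtain I c where c: "traverses_circle \<kappa> K b1 b2 d I c"
  proof (cases "K = 0")
    case True
    have 0: "circle_eq 0 b1 b2 d (hopf_fibration (\<phi> p) $ 1) (hopf_fibration (\<phi> p) $ 2) = 0"
      using proj p True by (simp add: projects_to_circle_def hopf_fibration_def)
    have 1: "b1\<^sup>2 + b2\<^sup>2 = 1" using unit True by simp
    show ?thesis by (rule circle_parametrization_line[OF 1 0, of \<kappa>]) (simp add: that True)
  next
    case False
    show ?thesis by (rule circle_parametrization_circle[OF unit False that])
  qed
  have "is_hopf_tube_over \<kappa> M \<phi> I c" by (rule circle_imp_hopf_tube[OF proj c])
  moreover have "geodesic_curvature (base_metric \<kappa>) c t = K + \<kappa> / 2 * d" if "t \<in> I" for t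
    by (rule circle_geodesic_curvature[OF unit c that])
  ultimately show ?thesis unfolding hopf_tube_const_geodesic_curvature_def by blast
qed

section \<open>The equivalence\<close>

text \<open>A homotopy between two constant loops traces a path between their base points.\<close>

lemma simply_connected_imp_connected_space:
  fixes S :: "'a::topological_space set"
  assumes "simply_connected S"
  shows "connected S"
proof (rule path_connected_imp_connected)
  show "path_connected S"
    unfolding path_connected_component
  proof (intro ballI)
    fix a b assume "a \<in> S" "b \<in> S"
    then have "homotopic_loops S (\<lambda>_. a) (\<lambda>_. b)"
      using assms[unfolded simply_connected_def, rule_format, of "\<lambda>_. a" "\<lambda>_. b"]
      by (auto simp: path_def pathfinish_def pathstart_def path_image_def)
    then show "path_component S a b"
      using homotopic_loops_imp_path_component_value[of S "\<lambda>_. a" "\<lambda>_. b" 0] by simp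
  qed
qed

theorem theorem4p4:
  fixes \<kappa> \<tau> :: real
    and M :: "'a::{t2_space,second_countable_topology} set"
    and \<A> :: "'a atlas"
    and \<phi> N :: "'a \<Rightarrow> real^3"
  assumes "\<kappa> \<noteq> 4 * \<tau>\<^sup>2"
    and "bcv_immersed_surface \<kappa> \<tau> M \<A> \<phi> N"
    and "simply_connected M"
    and "\<not> minimal_surface \<kappa> \<tau> \<A> \<phi> N"
    and "biconservative_surface \<kappa> \<tau> \<A> \<phi> N"
  shows "(constant_angle_surface \<kappa> \<tau> M \<phi> N \<longleftrightarrow> cmc_surface \<kappa> \<tau> \<A> \<phi> N) \<and>
         (cmc_surface \<kappa> \<tau> \<A> \<phi> N \<longleftrightarrow> hopf_tube_const_geodesic_curvature \<kappa> M \<phi>)"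
proof -
  interpret biconservative_bcv_surface \<kappa> \<tau> M \<A> \<phi> N
    by unfold_locales (use assms simply_connected_imp_connected_space in auto)
  show ?thesis
    using constant_angle_imp_cmc cmc_imp_constant_angle cmc_imp_hopf_tube hopf_tube_imp_cmc by blast
qed

end
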